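(* Let $d\ge2$ and $p\in(0,p_c)$. There exist $c=c(p)>0$ and $C=C(p)>0$ such that for all positive integers $n$ and all choices of integer $h(n)\ge6n$, we have $$\Phi\left(c\,h(n)^{d-1}\exp\left(-\frac{n}{\xi(p)}\right)\right)\le\mathbb{P}_p(R_n\text{ has a left-right open crossing})\le C\,h(n)^{d-1}\exp\left(-\frac{n}{\xi(p)}\right),$$ where $\Phi(s)=\frac{s}{s+1}$ for $s>0$.
   Context: Bernoulli bond percolation on $\mathbb{Z}^d$: under $\mathbb{P}_p$ each nearest-neighbor edge is independently open with probability $p$ and closed with probability $1-p$; $x\leftrightarrow y$ means that there is a path of open edges from $x$ to $y$. $p_c=\sup\{p\in[0,1]:\mathbb{P}_p(\#\{y:0\leftrightarrow y\}=\infty)=0\}\in(0,1)$. The correlation length is $\xi(p)=\left(\lim_{n\to\infty}-\frac1n\log\mathbb{P}_p(0\leftrightarrow n\mathbf{e}_1)\right)^{-1}$, with $\mathbf{e}_1$ the first coordinate vector; it is known that the limit exists and $0<\xi(p)<\infty$ for $p\in(0,p_c)$. For positive integers $n$ and $h(n)$, $R_n=([0,n]\times[0,h(n)]^{d-1})\cap\mathbb{Z}^d$. $R_n$ has a left-right open crossing if there is an open path which uses only vertices of $R_n$ and connects a vertex of $\{0\}\times[0,h(n)]^{d-1}$ to a vertex of $\{n\}\times[0,h(n)]^{d-1}$. *)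

theory Defs
  imports "HOL-Probability.Probability"
begin

text \<open>Points of \<open>\<int>\<^sup>d\<close> are extensional functions on the index set \<open>{..<d}\<close>; index \<open>0\<close> is the
  first coordinate.\<close>

definition lattice :: "nat \<Rightarrow> (nat \<Rightarrow> int) set" where
  "lattice d = {..<d} \<rightarrow>\<^sub>E UNIV"

definition axis_point :: "nat \<Rightarrow> nat \<Rightarrow> nat \<Rightarrow> int" where
  "axis_point d n = (\<lambda>i\<in>{..<d}. if i = 0 then int n else 0)"

abbreviation origin :: "nat \<Rightarrow> nat \<Rightarrow> int" where
  "origin d \<equiv> axis_point d 0"

definition edges :: "nat \<Rightarrow> (nat \<Rightarrow> int) set set" where
  "edges d = {{x, y} | x y. x \<in> lattice d \<and> y \<in> lattice d \<and> (\<Sum>i<d. \<bar>x i - y i\<bar>) = 1}"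

text \<open>A configuration maps each edge to \<open>True\<close> (open) or \<open>False\<close> (closed).\<close>

type_synonym config = "(nat \<Rightarrow> int) set \<Rightarrow> bool"

definition percolation :: "nat \<Rightarrow> real \<Rightarrow> config measure" where
  "percolation d p = (\<Pi>\<^sub>M e\<in>edges d. measure_pmf (bernoulli_pmf p))"

text \<open>\<open>joined_in d V \<omega> x y\<close>: some path of open edges, all of whose vertices lie in \<open>V\<close>, leads
  from \<open>x\<close> to \<open>y\<close> (a path may have length zero).\<close>

definition joined_in ::
    "nat \<Rightarrow> (nat \<Rightarrow> int) set \<Rightarrow> config \<Rightarrow> (nat \<Rightarrow> int) \<Rightarrow> (nat \<Rightarrow> int) \<Rightarrow> bool" where
  "joined_in d V \<omega> x y \<longleftrightarrow> x \<in> V \<and> y \<in> V \<and>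
     (x, y) \<in> {(u, v). u \<in> V \<and> v \<in> V \<and> {u, v} \<in> edges d \<and> \<omega> {u, v}}\<^sup>*"

definition joined :: "nat \<Rightarrow> config \<Rightarrow> (nat \<Rightarrow> int) \<Rightarrow> (nat \<Rightarrow> int) \<Rightarrow> bool" where
  "joined d = joined_in d (lattice d)"

definition critical_prob :: "nat \<Rightarrow> real" where
  "critical_prob d = Sup {p \<in> {0..1}.
     \<P>(\<omega> in percolation d p. infinite {y. joined d \<omega> (origin d) y}) = 0}"

definition correlation_length :: "nat \<Rightarrow> real \<Rightarrow> real" where
  "correlation_length d p = inverse (lim (\<lambda>n.
     - (1 / real n) * ln (\<P>(\<omega> in percolation d p. joined d \<omega> (origin d) (axis_point d n)))))"

definition rect :: "nat \<Rightarrow> nat \<Rightarrow> nat \<Rightarrow> (nat \<Rightarrow> int) set" where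
  "rect d n h = (\<Pi>\<^sub>E i\<in>{..<d}. if i = 0 then {0..int n} else {0..int h})"

definition left_right_crossing :: "nat \<Rightarrow> nat \<Rightarrow> nat \<Rightarrow> config \<Rightarrow> bool" where
  "left_right_crossing d n h \<omega> \<longleftrightarrow>
     (\<exists>x\<in>rect d n h. \<exists>y\<in>rect d n h. x 0 = 0 \<and> y 0 = int n \<and> joined_in d (rect d n h) \<omega> x y)"

definition Phi :: "real \<Rightarrow> real" where
  "Phi s = s / (s + 1)"

end

theory Submission
  imports Defs
begin

text \<open>
  All estimates are made for a random subset of a finite set of edges; infinite-volume
  probabilities of increasing events are suprema of finite-volume ones.

  Write \<open>r = 1 / \<xi>(p)\<close> and let \<open>cross n\<close> be the probability that the origin is connected to the
  hyperplane \<open>x\<^sub>0 = n\<close> inside the slab \<open>0 \<le> x\<^sub>0 \<le> n\<close>. Exploring the left part of a slab first gives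
  \<open>p * cross n * cross m \<le> cross (n + m + 1)\<close>, so \<open>cross n \<le> exp (- r * (n + 1)) / p\<close> without any
  correction, and a union bound over the left face gives the upper bound.

  For the lower bound let \<open>G n\<close> be the sum of the connection probabilities from the origin to the points
  of the hyperplane \<open>x\<^sub>0 = n\<close>. The van den Berg--Kesten inequality makes \<open>G\<close> submultiplicative, hence
  \<open>G n \<ge> exp (- r * n)\<close>; a second moment estimate based on the tree-graph inequality compares \<open>G n\<close>
  with \<open>cross n\<close> and, at record values of \<open>G n * exp (r * n)\<close>, forces this sequence to be bounded.
  Therefore \<open>cross n\<close> and \<open>G n\<close> are both of order \<open>exp (- r * n)\<close>. Another second moment estimate, for the
  number of vertices of the left face connected to the right face, whose variance is controlled by
  the BK inequality, yields \<open>\<Phi>\<close>.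

  The sums converge because \<open>r > 0\<close>, which is the sharpness of the phase transition; it is proved by
  the argument of Duminil-Copin and Tassion.
\<close>

section \<open>Random subsets of a finite set\<close>

text \<open>\<open>cross\<close> is supermultiplicative up to the factor \<open>p\<close> and
  \<open>G\<close> is submultiplicative, so each can be compared with its exponential rate from one
  side only. \<open>H\<close>, which is \<open>G\<close> with the paths confined to the slab, closes
  the gap: cutting a path at its last visit to level 0 and its next visit to level \<open>n\<close>
  gives \<open>G n \<le> G 0 * H n * G 0\<close>, and Cauchy-Schwarz gives
  \<open>(H n)\<^sup>2 \<le> cross n * second_moment n\<close>. That the common rate is the one
  along the axis rests on a reflection argument, by which \<open>tau\<close> decays at rate
  \<open>r\<close> in the largest coordinate.

  The condition \<open>h \<ge> 6 * n\<close> leaves room for starting vertices at distance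
  \<open>2 * n\<close> from the lateral sides. Wandering that far sideways has probability of order
  \<open>exp (- 2 * r * n)\<close>, and at least a third of each side length remains for the
  starting vertices.

  \<open>Phi\<close> comes from Cauchy-Schwarz for a counting variable \<open>N\<close> with mean
  \<open>M\<close>: if the variance is at most \<open>K * M\<close>, then \<open>N\<close> is
  positive with probability at least
  \<open>M\<^sup>2 / (M\<^sup>2 + K * M) = Phi (M / K)\<close>.\<close>

definition bexp :: "'e set \<Rightarrow> real \<Rightarrow> ('e set \<Rightarrow> real) \<Rightarrow> real" where
  "bexp E p f = (\<Sum>S\<in>Pow E. p ^ card S * (1 - p) ^ card (E - S) * f S)"

definition bprob :: "'e set \<Rightarrow> real \<Rightarrow> ('e set \<Rightarrow> bool) \<Rightarrow> real" where
  "bprob E p A = bexp E p (\<lambda>S. of_bool (A S))"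

lemma bexp_empty [simp]: "bexp {} p f = f {}"
  by (simp add: bexp_def)

text \<open>Conditioning on the state of the single element \<open>e\<close>; the inductions on
  \<open>E\<close> below unfold this recursion instead of the weights.\<close>

lemma bexp_insert:
  assumes "finite E" "e \<notin> E"
  shows "bexp (insert e E) p f = p * bexp E p (\<lambda>S. f (insert e S)) + (1 - p) * bexp E p f"
proof -
  have inj: "inj_on (insert e) (Pow E)"
    using assms by (auto simp: inj_on_def)
  have disj: "Pow E \<inter> insert e ` Pow E = {}"
    using assms by auto
  have "bexp (insert e E) p f =
      (\<Sum>S\<in>Pow E. p ^ card S * (1 - p) ^ card (insert e E - S) * f S)
    + (\<Sum>S\<in>insert e ` Pow E. p ^ card S * (1 - p) ^ card (insert e E - S) * f S)"
    unfolding bexp_def Pow_insert by (rule sum.union_disjoint) (use assms disj in auto)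
  also have "(\<Sum>S\<in>Pow E. p ^ card S * (1 - p) ^ card (insert e E - S) * f S) = (1 - p) * bexp E p f"
    unfolding bexp_def sum_distrib_left
  proof (rule sum.cong[OF refl])
    fix S assume "S \<in> Pow E"
    then have "insert e E - S = insert e (E - S)" using assms by auto
    then have "card (insert e E - S) = Suc (card (E - S))" using assms by simp
    then show "p ^ card S * (1 - p) ^ card (insert e E - S) * f S
        = (1 - p) * (p ^ card S * (1 - p) ^ card (E - S) * f S)" by simp
  qed
  also have "(\<Sum>S\<in>insert e ` Pow E. p ^ card S * (1 - p) ^ card (insert e E - S) * f S)
      = p * bexp E p (\<lambda>S. f (insert e S))"
    unfolding bexp_def sum_distrib_left sum.reindex[OF inj] o_def
  proof (rule sum.cong[OF refl])
    fix S assume S: "S \<in> Pow E"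
    then have "insert e E - insert e S = E - S" using assms by auto
    moreover have "card (insert e S) = Suc (card S)"
      using S assms by (metis PowD card_insert_disjoint finite_subset subsetD)
    ultimately show "p ^ card (insert e S) * (1 - p) ^ card (insert e E - insert e S) * f (insert e S)
        = p * (p ^ card S * (1 - p) ^ card (E - S) * f (insert e S))" by simp
  qed
  finally show ?thesis by simp
qed

lemma bexp_cong: "(\<And>S. S \<subseteq> E \<Longrightarrow> f S = g S) \<Longrightarrow> bexp E p f = bexp E p g"
  by (simp add: bexp_def)

lemma bexp_add: "bexp E p (\<lambda>S. f S + g S) = bexp E p f + bexp E p g"
  by (simp add: bexp_def algebra_simps sum.distrib)

lemma bexp_diff: "bexp E p (\<lambda>S. f S - g S) = bexp E p f - bexp E p g"
  by (simp add: bexp_def algebra_simps sum_subtractf)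

lemma bexp_cmult: "bexp E p (\<lambda>S. c * f S) = c * bexp E p f"
  unfolding bexp_def sum_distrib_left by (intro sum.cong) (auto simp: mult_ac)

lemma bexp_multc: "bexp E p (\<lambda>S. f S * c) = bexp E p f * c"
  unfolding bexp_def sum_distrib_right by (intro sum.cong) (auto simp: mult_ac)

lemma bexp_sum: "bexp E p (\<lambda>S. \<Sum>i\<in>I. f i S) = (\<Sum>i\<in>I. bexp E p (f i))"
  unfolding bexp_def by (subst sum.swap) (simp add: sum_distrib_left)

lemma bexp_const: "finite E \<Longrightarrow> bexp E p (\<lambda>S. c) = c"
  by (induction E rule: finite_induct) (auto simp: bexp_insert algebra_simps)

lemma bexp_mono:
  assumes "0 \<le> p" "p \<le> 1" "\<And>S. S \<subseteq> E \<Longrightarrow> f S \<le> g S"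
  shows "bexp E p f \<le> bexp E p g"
  unfolding bexp_def using assms by (intro sum_mono mult_left_mono) auto

lemma bexp_nonneg:
  assumes "0 \<le> p" "p \<le> 1" "\<And>S. S \<subseteq> E \<Longrightarrow> 0 \<le> f S"
  shows "0 \<le> bexp E p f"
  unfolding bexp_def using assms by (intro sum_nonneg mult_nonneg_nonneg) auto

lemma bexp_Un:
  assumes "finite E" "finite F" "E \<inter> F = {}"
  shows "bexp (E \<union> F) p f = bexp E p (\<lambda>S. bexp F p (\<lambda>T. f (S \<union> T)))"
  using assms(1,3)
proof (induction E arbitrary: f rule: finite_induct)
  case (insert e E)
  then have "e \<notin> E \<union> F" "finite (E \<union> F)" "E \<inter> F = {}" using assms(2) by auto
  then show ?case using insert by (simp add: bexp_insert)
qed simp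

lemma bexp_indep:
  assumes "finite E" "A \<subseteq> E" "B \<subseteq> E" "A \<inter> B = {}"
  shows "bexp E p (\<lambda>S. f (S \<inter> A) * g (S \<inter> B)) = bexp A p f * bexp B p g"
proof -
  let ?C = "E - A - B"
  have fin: "finite A" "finite B" "finite ?C" using assms finite_subset by auto
  have "E = A \<union> (B \<union> ?C)" using assms by auto
  then have "bexp E p (\<lambda>S. f (S \<inter> A) * g (S \<inter> B))
      = bexp (A \<union> (B \<union> ?C)) p (\<lambda>S. f (S \<inter> A) * g (S \<inter> B))" by simp
  also have "\<dots> = bexp A p (\<lambda>S. bexp B p (\<lambda>T. bexp ?C p
      (\<lambda>U. f ((S \<union> (T \<union> U)) \<inter> A) * g ((S \<union> (T \<union> U)) \<inter> B))))"
    by (subst bexp_Un; (subst bexp_Un)?) (use fin assms in auto)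
  also have "\<dots> = bexp A p (\<lambda>S. bexp B p (\<lambda>T. bexp ?C p (\<lambda>U. f S * g T)))"
  proof (rule bexp_cong, rule bexp_cong, rule bexp_cong)
    fix S T U assume "S \<subseteq> A" "T \<subseteq> B" "U \<subseteq> ?C"
    then have "(S \<union> (T \<union> U)) \<inter> A = S" "(S \<union> (T \<union> U)) \<inter> B = T" using assms(4) by auto
    then show "f ((S \<union> (T \<union> U)) \<inter> A) * g ((S \<union> (T \<union> U)) \<inter> B) = f S * g T" by simp
  qed
  also have "\<dots> = bexp A p (\<lambda>S. f S * bexp B p g)"
    by (simp add: bexp_const[OF fin(3)] bexp_cmult bexp_multc)
  finally show ?thesis by (simp add: bexp_multc)
qed

lemma bexp_restrict:
  assumes "finite E" "A \<subseteq> E"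
  shows "bexp E p (\<lambda>S. f (S \<inter> A)) = bexp A p f"
  using bexp_indep[OF assms, of "{}" p f "\<lambda>_. 1"] by simp

lemma bexp_image:
  assumes "finite E" "inj_on h E"
  shows "bexp (h ` E) p f = bexp E p (\<lambda>S. f (h ` S))"
  using assms
proof (induction E arbitrary: f rule: finite_induct)
  case (insert e E)
  then have "h e \<notin> h ` E" by (auto simp: inj_on_def)
  then show ?case using insert by (simp add: bexp_insert inj_on_insert)
qed simp

lemma bexp_CS:
  assumes "0 \<le> p" "p \<le> 1"
  shows "(bexp E p (\<lambda>S. f S * g S))\<^sup>2 \<le> bexp E p (\<lambda>S. (f S)\<^sup>2) * bexp E p (\<lambda>S. (g S)\<^sup>2)"
proof -
  define w where "w S = p ^ card S * (1 - p) ^ card (E - S)" for S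
  have w: "w S \<ge> 0" for S unfolding w_def using assms by simp
  have "(\<Sum>S\<in>Pow E. (sqrt (w S) * f S) * (sqrt (w S) * g S))\<^sup>2
      \<le> (\<Sum>S\<in>Pow E. (sqrt (w S) * f S)\<^sup>2) * (\<Sum>S\<in>Pow E. (sqrt (w S) * g S)\<^sup>2)"
    by (rule Cauchy_Schwarz_ineq_sum)
  moreover have "sqrt (w S) * f S * (sqrt (w S) * g S) = w S * (f S * g S)" for S
    using w by (metis mult.assoc mult.left_commute real_sqrt_mult_self abs_of_nonneg)
  ultimately show ?thesis
    unfolding bexp_def w_def[symmetric] by (simp add: power_mult_distrib w)
qed

section \<open>Increasing functions, the Harris inequality and Russo's formula\<close>

definition incr :: "('e set \<Rightarrow> 'b::order) \<Rightarrow> bool" where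
  "incr f \<longleftrightarrow> (\<forall>S T. S \<subseteq> T \<longrightarrow> f S \<le> f T)"

lemma incrI: "(\<And>S T. S \<subseteq> T \<Longrightarrow> f S \<le> f T) \<Longrightarrow> incr f"
  by (simp add: incr_def)

lemma incrD: "incr f \<Longrightarrow> S \<subseteq> T \<Longrightarrow> f S \<le> f T"
  by (simp add: incr_def)

lemma incr_insert: "incr f \<Longrightarrow> incr (\<lambda>S. f (insert e S))"
  by (auto intro!: incrI incrD[of f])

lemma incr_of_bool: "incr A \<Longrightarrow> incr (\<lambda>S. of_bool (A S) :: real)"
  by (auto simp: incr_def)

text \<open>Induction reduces the claim to a single element, where the gap between the two sides is
  exactly \<open>p * (1 - p) * ((f1 - f0) * (g1 - g0))\<close>. Both increments are nonnegative for
  increasing functions.\<close>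

lemma harris:
  assumes "0 \<le> p" "p \<le> 1" "finite E" "incr f" "incr g"
  shows "bexp E p f * bexp E p g \<le> bexp E p (\<lambda>S. f S * g S)"
  using assms(3-5)
proof (induction E arbitrary: f g rule: finite_induct)
  case (insert e E)
  let ?f1 = "bexp E p (\<lambda>S. f (insert e S))" and ?f0 = "bexp E p f"
  let ?g1 = "bexp E p (\<lambda>S. g (insert e S))" and ?g0 = "bexp E p g"
  have 1: "?f1 * ?g1 \<le> bexp E p (\<lambda>S. f (insert e S) * g (insert e S))"
    using insert.IH[OF incr_insert incr_insert] insert.prems by blast
  have 0: "?f0 * ?g0 \<le> bexp E p (\<lambda>S. f S * g S)"
    using insert.IH insert.prems by blast
  have mono: "?f0 \<le> ?f1" "?g0 \<le> ?g1"
    using assms(1,2) insert.prems by (auto intro!: bexp_mono incrD[of f] incrD[of g])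
  have "p * (1 - p) * ((?f1 - ?f0) * (?g1 - ?g0)) \<ge> 0"
    using mono assms(1,2) by auto
  then have "(p * ?f1 + (1 - p) * ?f0) * (p * ?g1 + (1 - p) * ?g0)
      \<le> p * (?f1 * ?g1) + (1 - p) * (?f0 * ?g0)"
    by (simp add: algebra_simps)
  also have "\<dots> \<le> p * bexp E p (\<lambda>S. f (insert e S) * g (insert e S)) + (1 - p) * bexp E p (\<lambda>S. f S * g S)"
    using 0 1 assms(1,2) by (intro add_mono mult_left_mono) auto
  finally show ?case using insert by (simp add: bexp_insert)
qed simp

text \<open>Russo's formula for an arbitrary function. It is applied to indicators of increasing
  events, where the summand for \<open>e\<close> is the probability that \<open>e\<close> is
  pivotal.\<close>

lemma bexp_has_derivative:
  assumes "finite E"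
  shows "((\<lambda>t. bexp E t f) has_real_derivative
    (\<Sum>e\<in>E. bexp E t (\<lambda>S. f (insert e S) - f (S - {e})))) (at t)"
  using assms
proof (induction E arbitrary: f rule: finite_induct)
  case (insert e E)
  let ?D = "\<lambda>f. \<Sum>e\<in>E. bexp E t (\<lambda>S. f (insert e S) - f (S - {e}))"
  have E: "bexp (insert e E) t f = t * bexp E t (\<lambda>S. f (insert e S)) + (1 - t) * bexp E t f" for t
    using insert by (simp add: bexp_insert)
  have D: "((\<lambda>t. bexp (insert e E) t f) has_real_derivative
      (bexp E t (\<lambda>S. f (insert e S)) - bexp E t f + (t * ?D (\<lambda>S. f (insert e S)) + (1 - t) * ?D f))) (at t)"
    unfolding E by (rule derivative_eq_intros insert.IH refl | simp)+
  \<comment> \<open>The difference does not read the state of \<open>e\<close> itself, so that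
    coordinate integrates out.\<close>
  have e: "bexp (insert e E) t (\<lambda>S. f (insert e S) - f (S - {e}))
     = bexp E t (\<lambda>S. f (insert e S)) - bexp E t f"
  proof -
    have "bexp (insert e E) t (\<lambda>S. f (insert e S) - f (S - {e})) =
       bexp (insert e E) t (\<lambda>S. f (insert e (S \<inter> E)) - f (S \<inter> E))"
    proof (rule bexp_cong)
      fix S assume "S \<subseteq> insert e E"
      then have "insert e (S \<inter> E) = insert e S" "S \<inter> E = S - {e}" using insert by auto
      then show "f (insert e S) - f (S - {e}) = f (insert e (S \<inter> E)) - f (S \<inter> E)" by simp
    qed
    also have "\<dots> = bexp E t (\<lambda>S. f (insert e S) - f S)"
      using bexp_restrict[of "insert e E" E t "\<lambda>S. f (insert e S) - f S"] insert by auto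
    finally show ?thesis by (simp add: bexp_diff)
  qed
  have e': "bexp (insert e E) t (\<lambda>S. f (insert e' S) - f (S - {e'}))
      = t * bexp E t (\<lambda>S. f (insert e (insert e' S)) - f (insert e (S - {e'})))
       + (1 - t) * bexp E t (\<lambda>S. f (insert e' S) - f (S - {e'}))" if "e' \<in> E" for e'
  proof -
    have "e \<noteq> e'" using that insert by auto
    then have "insert e' (insert e S) = insert e (insert e' S)" "insert e S - {e'} = insert e (S - {e'})" for S
      by auto
    then show ?thesis using insert by (simp add: bexp_insert)
  qed
  have "(\<Sum>e'\<in>insert e E. bexp (insert e E) t (\<lambda>S. f (insert e' S) - f (S - {e'})))
     = bexp E t (\<lambda>S. f (insert e S)) - bexp E t f + (t * ?D (\<lambda>S. f (insert e S)) + (1 - t) * ?D f)"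
    using insert.hyps e e' by (simp add: sum.distrib sum_distrib_left)
  then show ?case using D by metis
qed simp

lemma bexp_mono_p:
  assumes "finite E" "incr f" "0 \<le> p" "p \<le> q" "q \<le> 1"
  shows "bexp E p f \<le> bexp E q f"
proof (rule DERIV_nonneg_imp_nondecreasing[OF assms(4)])
  fix t assume t: "p \<le> t" "t \<le> q"
  have "0 \<le> (\<Sum>e\<in>E. bexp E t (\<lambda>S. f (insert e S) - f (S - {e})))"
    using t assms by (intro sum_nonneg bexp_nonneg) (auto intro!: incrD[of f])
  with bexp_has_derivative[OF assms(1)]
  show "\<exists>y. ((\<lambda>t. bexp E t f) has_real_derivative y) (at t) \<and> 0 \<le> y" by blast
qed

lemma bprob_nonneg: "0 \<le> p \<Longrightarrow> p \<le> 1 \<Longrightarrow> 0 \<le> bprob E p A"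
  unfolding bprob_def by (rule bexp_nonneg) auto

lemma bprob_mono:
  assumes "0 \<le> p" "p \<le> 1" "\<And>S. S \<subseteq> E \<Longrightarrow> A S \<Longrightarrow> B S"
  shows "bprob E p A \<le> bprob E p B"
  unfolding bprob_def by (rule bexp_mono) (use assms in auto)

lemma bprob_le_1: "finite E \<Longrightarrow> 0 \<le> p \<Longrightarrow> p \<le> 1 \<Longrightarrow> bprob E p A \<le> 1"
  using bexp_mono[of p E "\<lambda>S. of_bool (A S)" "\<lambda>_. 1"] by (simp add: bprob_def bexp_const)

lemma bprob_cong: "(\<And>S. S \<subseteq> E \<Longrightarrow> A S = B S) \<Longrightarrow> bprob E p A = bprob E p B"
  unfolding bprob_def by (rule bexp_cong) simp

lemma bprob_mono_set:
  assumes "0 \<le> p" "p \<le> 1" "finite F" "E \<subseteq> F" "incr A"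
  shows "bprob E p A \<le> bprob F p A"
proof -
  have "bprob E p A = bexp F p (\<lambda>S. of_bool (A (S \<inter> E)))"
    unfolding bprob_def using bexp_restrict[OF assms(3,4), of p "\<lambda>S. of_bool (A S)"] by simp
  also have "\<dots> \<le> bprob F p A"
    unfolding bprob_def
  proof (rule bexp_mono)
    fix S show "of_bool (A (S \<inter> E)) \<le> (of_bool (A S) :: real)"
      using incrD[OF assms(5), of "S \<inter> E" S] by auto
  qed (use assms in auto)
  finally show ?thesis .
qed

lemma bprob_Bex:
  assumes "0 \<le> p" "p \<le> 1" "finite I"
  shows "bprob E p (\<lambda>S. \<exists>i\<in>I. A i S) \<le> (\<Sum>i\<in>I. bprob E p (A i))"
proof -
  have "bprob E p (\<lambda>S. \<exists>i\<in>I. A i S) \<le> bexp E p (\<lambda>S. \<Sum>i\<in>I. of_bool (A i S))"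
    unfolding bprob_def
  proof (rule bexp_mono)
    fix S
    show "of_bool (\<exists>i\<in>I. A i S) \<le> (\<Sum>i\<in>I. of_bool (A i S) :: real)"
    proof (cases "\<exists>i\<in>I. A i S")
      case True
      then obtain i where i: "i \<in> I" "A i S" by auto
      have "of_bool (A i S) \<le> (\<Sum>i\<in>I. of_bool (A i S) :: real)"
        by (rule member_le_sum) (use i assms in auto)
      then show ?thesis using i by auto
    qed (simp add: sum_nonneg)
  qed (use assms in auto)
  then show ?thesis by (simp add: bexp_sum bprob_def)
qed

lemma bprob_disj:
  assumes "0 \<le> p" "p \<le> 1"
  shows "bprob E p (\<lambda>S. A S \<or> B S) \<le> bprob E p A + bprob E p B"
  unfolding bprob_def bexp_add[symmetric] by (rule bexp_mono) (use assms in auto)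

lemma bprob_harris:
  assumes "0 \<le> p" "p \<le> 1" "finite E" "incr A" "incr B"
  shows "bprob E p A * bprob E p B \<le> bprob E p (\<lambda>S. A S \<and> B S)"
  using harris[OF assms(1-3) incr_of_bool[OF assms(4)] incr_of_bool[OF assms(5)]]
  by (simp add: bprob_def of_bool_conj)

section \<open>The van den Berg-Kesten inequality\<close>

text \<open>Resample the second member of each pair of witnesses, one element of \<open>E\<close> at a time; once
  an element is resampled, the two witnesses may both use it.\<close>

lemma bk_pairs:
  assumes "0 \<le> p" "p \<le> 1" "finite E"
  shows "bprob E p (\<lambda>S. \<exists>(J, K)\<in>\<D>. J \<inter> K = {} \<and> J \<subseteq> S \<and> K \<subseteq> S)
    \<le> bexp E p (\<lambda>S. bprob E p (\<lambda>T. \<exists>(J, K)\<in>\<D>. J \<subseteq> S \<and> K \<subseteq> T))"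
  using assms(3)
proof (induction E arbitrary: \<D> rule: finite_induct)
  case empty
  show ?case by (auto simp: bprob_def)
next
  case (insert e E)
  \<comment> \<open>\<open>i\<close> and \<open>j\<close> are the revealed states of
    \<open>e\<close> in the first and in the second configuration. A pair survives if it asks for
    \<open>e\<close> only where \<open>e\<close> is open; its demands on the other elements are
    kept.\<close>
  define D where "D i j = {(J - {e}, K - {e}) | J K. (J, K) \<in> \<D> \<and> (e \<in> J \<longrightarrow> i) \<and> (e \<in> K \<longrightarrow> j)}" for i j
  define F where "F \<D> = bprob E p (\<lambda>S. \<exists>(J, K)\<in>\<D>. J \<inter> K = {} \<and> J \<subseteq> S \<and> K \<subseteq> S)" for \<D>
  define F2 where "F2 \<D> = bexp E p (\<lambda>S. bprob E p (\<lambda>T. \<exists>(J, K)\<in>\<D>. J \<subseteq> S \<and> K \<subseteq> T))" for \<D>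
  have IH: "F \<D> \<le> F2 \<D>" for \<D> unfolding F_def F2_def by (rule insert.IH)
  have pair: "(\<exists>(J, K)\<in>\<D>. J \<subseteq> S' \<and> K \<subseteq> T') = (\<exists>(J, K)\<in>D i j. J \<subseteq> S \<and> K \<subseteq> T)"
    if "S' = (if i then insert e S else S)" "T' = (if j then insert e T else T)" "e \<notin> S" "e \<notin> T" for i j S T S' T'
  proof -
    have "(J \<subseteq> S' \<and> K \<subseteq> T') \<longleftrightarrow> (e \<in> J \<longrightarrow> i) \<and> (e \<in> K \<longrightarrow> j) \<and> J - {e} \<subseteq> S \<and> K - {e} \<subseteq> T" for J K
      using that by (auto split: if_splits)
    then have "(\<exists>(J, K)\<in>\<D>. J \<subseteq> S' \<and> K \<subseteq> T') \<longleftrightarrow>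
        (\<exists>J K. (J, K) \<in> \<D> \<and> (e \<in> J \<longrightarrow> i) \<and> (e \<in> K \<longrightarrow> j) \<and> J - {e} \<subseteq> S \<and> K - {e} \<subseteq> T)"
      by (auto simp only: split_paired_Bex_Sigma Bex_def split_paired_Ex prod.case)
    also have "\<dots> \<longleftrightarrow> (\<exists>(J, K)\<in>D i j. J \<subseteq> S \<and> K \<subseteq> T)"
      unfolding D_def by (auto simp only: Bex_def split_paired_Ex prod.case mem_Collect_eq prod.inject)
    finally show ?thesis .
  qed
  have eS: "e \<notin> S" if "S \<subseteq> E" for S using that insert by auto
  have F2_eq: "bexp (insert e E) p (\<lambda>S. bprob (insert e E) p (\<lambda>T. \<exists>(J, K)\<in>\<D>. J \<subseteq> S \<and> K \<subseteq> T))
     = p * (p * F2 (D True True) + (1 - p) * F2 (D True False))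
       + (1 - p) * (p * F2 (D False True) + (1 - p) * F2 (D False False))"
  proof -
    have *: "bexp E p (\<lambda>S. bprob E p (\<lambda>T. \<exists>(J, K)\<in>\<D>. J \<subseteq> (if i then insert e S else S)
       \<and> K \<subseteq> (if j then insert e T else T))) = F2 (D i j)" for i j
      unfolding F2_def by (intro bexp_cong bprob_cong) (rule pair, use eS in auto)
    show ?thesis
      using *[of True True] *[of True False] *[of False True] *[of False False]
      by (simp add: bexp_insert insert.hyps bprob_def bexp_add bexp_cmult)
        (simp add: algebra_simps)
  qed
  \<comment> \<open>Here both witnesses read the same copy of \<open>e\<close>, and disjointness
    lets at most one of them use it; hence the union when \<open>e\<close> is open.\<close>
  have F_eq: "bprob (insert e E) p (\<lambda>S. \<exists>(J, K)\<in>\<D>. J \<inter> K = {} \<and> J \<subseteq> S \<and> K \<subseteq> S)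
     \<le> p * F (D True False \<union> D False True) + (1 - p) * F (D False False)"
  proof -
    have "bexp E p (\<lambda>S. of_bool (\<exists>(J, K)\<in>\<D>. J \<inter> K = {} \<and> J \<subseteq> insert e S \<and> K \<subseteq> insert e S))
        \<le> F (D True False \<union> D False True)"
      unfolding F_def bprob_def[symmetric]
    proof (rule bprob_mono[OF assms(1,2)])
      fix S assume "S \<subseteq> E" and "\<exists>(J, K)\<in>\<D>. J \<inter> K = {} \<and> J \<subseteq> insert e S \<and> K \<subseteq> insert e S"
      then obtain J K where JK: "(J, K) \<in> \<D>" "J \<inter> K = {}" "J \<subseteq> insert e S" "K \<subseteq> insert e S" by auto
      then have "e \<notin> J \<or> e \<notin> K" by auto
      then have "(J - {e}, K - {e}) \<in> D True False \<union> D False True"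
        unfolding D_def using JK(1) by blast
      moreover have "(J - {e}) \<inter> (K - {e}) = {}" "J - {e} \<subseteq> S" "K - {e} \<subseteq> S" using JK by auto
      ultimately show "\<exists>(J, K)\<in>D True False \<union> D False True. J \<inter> K = {} \<and> J \<subseteq> S \<and> K \<subseteq> S"
        by blast
    qed
    moreover have "bexp E p (\<lambda>S. of_bool (\<exists>(J, K)\<in>\<D>. J \<inter> K = {} \<and> J \<subseteq> S \<and> K \<subseteq> S))
        \<le> F (D False False)"
      unfolding F_def bprob_def[symmetric]
    proof (rule bprob_mono[OF assms(1,2)])
      fix S assume "S \<subseteq> E" and "\<exists>(J, K)\<in>\<D>. J \<inter> K = {} \<and> J \<subseteq> S \<and> K \<subseteq> S"
      then obtain J K where JK: "(J, K) \<in> \<D>" "J \<inter> K = {}" "J \<subseteq> S" "K \<subseteq> S" by auto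
      moreover from this have "e \<notin> J" "e \<notin> K" using eS[OF \<open>S \<subseteq> E\<close>] by auto
      ultimately have "(J - {e}, K - {e}) \<in> D False False" unfolding D_def by blast
      moreover have "(J - {e}) \<inter> (K - {e}) = {}" "J - {e} \<subseteq> S" "K - {e} \<subseteq> S" using JK by auto
      ultimately show "\<exists>(J, K)\<in>D False False. J \<inter> K = {} \<and> J \<subseteq> S \<and> K \<subseteq> S" by blast
    qed
    ultimately show ?thesis
      using assms(1,2) by (auto simp: bprob_def bexp_insert insert.hyps intro!: add_mono mult_left_mono)
  qed
  have F2_mono: "F2 A \<le> F2 B" if "A \<subseteq> B" for A B
    unfolding F2_def by (intro bexp_mono bprob_mono assms) (use that in blast)
  have sub: "D False False \<subseteq> D True False" "D False False \<subseteq> D False True"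
    "D True False \<union> D False True \<subseteq> D True True" unfolding D_def by blast+
  \<comment> \<open>Submodularity: an indicator for a union of pair sets is the maximum of the two,
    and a common subset is witnessed only when both are.\<close>
  have F2_Un: "F2 (A \<union> B) + F2 C \<le> F2 A + F2 B" if "C \<subseteq> A" "C \<subseteq> B" for A B C
    unfolding F2_def bexp_add[symmetric] bprob_def
  proof (intro bexp_mono assms)
    fix S T
    let ?Q = "\<lambda>A :: ('a set \<times> 'a set) set. \<exists>(J, K)\<in>A. J \<subseteq> S \<and> K \<subseteq> T"
    have "?Q (A \<union> B) \<longleftrightarrow> ?Q A \<or> ?Q B" by blast
    moreover have "?Q C \<Longrightarrow> ?Q A \<and> ?Q B" using that by blast
    ultimately show "of_bool (?Q (A \<union> B)) + of_bool (?Q C) \<le> (of_bool (?Q A) + of_bool (?Q B) :: real)"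
      by auto
  qed
  let ?U = "F2 (D True False \<union> D False True)" and ?Z = "F2 (D False False)"
  have "p * F (D True False \<union> D False True) + (1 - p) * F (D False False) \<le> p * ?U + (1 - p) * ?Z"
    using IH assms(1,2) by (intro add_mono mult_left_mono) auto
  \<comment> \<open>Splitting \<open>p\<close> and \<open>1 - p\<close> in this way produces the
    weights of the four joint states of two independent copies of \<open>e\<close>, so the terms can
    be compared one by one.\<close>
  also have "\<dots> = p * p * ?U + p * (1 - p) * (?U + ?Z) + (1 - p) * (1 - p) * ?Z"
    by (simp add: algebra_simps)
  also have "\<dots> \<le> p * p * F2 (D True True) + p * (1 - p) * (F2 (D True False) + F2 (D False True))
      + (1 - p) * (1 - p) * ?Z"
    using mult_left_mono[OF F2_mono[OF sub(3)], of "p * p"]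
      mult_left_mono[OF F2_Un[OF sub(1,2)], of "p * (1 - p)"] assms(1,2) by simp
  also have "\<dots> = p * (p * F2 (D True True) + (1 - p) * F2 (D True False))
       + (1 - p) * (p * F2 (D False True) + (1 - p) * F2 (D False False))"
    by (simp add: algebra_simps)
  finally show ?case using F_eq F2_eq by linarith
qed

text \<open>For an increasing event a set of open elements is a witness exactly when the event holds
  on that set, so this is the usual disjoint occurrence.\<close>

definition disj_occ :: "('e set \<Rightarrow> bool) \<Rightarrow> ('e set \<Rightarrow> bool) \<Rightarrow> 'e set \<Rightarrow> bool" where
  "disj_occ A B S \<longleftrightarrow> (\<exists>J K. J \<inter> K = {} \<and> J \<subseteq> S \<and> K \<subseteq> S \<and> A J \<and> B K)"

lemma disj_occI: "J \<inter> K = {} \<Longrightarrow> J \<subseteq> S \<Longrightarrow> K \<subseteq> S \<Longrightarrow> A J \<Longrightarrow> B K \<Longrightarrow> disj_occ A B S"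
  by (auto simp: disj_occ_def)

lemma incr_disj_occ: "incr (disj_occ A B)"
  unfolding incr_def disj_occ_def le_bool_def by (meson subset_trans)

text \<open>On the right side of \<open>bk_pairs\<close> the two witnesses live in independent
  copies. Taking all pairs of witnesses turns that side into the product, since an increasing event
  has a witness inside \<open>S\<close> exactly when it holds on \<open>S\<close>.\<close>

lemma bk:
  assumes "0 \<le> p" "p \<le> 1" "finite E" "incr A" "incr B"
  shows "bprob E p (disj_occ A B) \<le> bprob E p A * bprob E p B"
proof -
  define \<D> where "\<D> = {(J, K). A J \<and> B K}"
  have eq: "(\<exists>(J, K)\<in>\<D>. J \<subseteq> S \<and> K \<subseteq> T) \<longleftrightarrow> A S \<and> B T" for S T
    unfolding \<D>_def using assms(4,5) by (auto simp: incr_def le_bool_def)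
  have "bprob E p (disj_occ A B) = bprob E p (\<lambda>S. \<exists>(J, K)\<in>\<D>. J \<inter> K = {} \<and> J \<subseteq> S \<and> K \<subseteq> S)"
    by (rule bprob_cong) (auto simp: \<D>_def disj_occ_def)
  also have "\<dots> \<le> bexp E p (\<lambda>S. bprob E p (\<lambda>T. A S \<and> B T))"
    using bk_pairs[OF assms(1-3), of \<D>] by (simp add: eq)
  also have "\<dots> = bexp E p (\<lambda>S. bprob E p B * of_bool (A S))"
    unfolding bprob_def by (rule bexp_cong) (simp add: of_bool_conj bexp_cmult)
  also have "\<dots> = bprob E p A * bprob E p B"
    by (simp add: bexp_cmult bprob_def)
  finally show ?thesis .
qed

lemma bk3:
  assumes "0 \<le> p" "p \<le> 1" "finite E" "incr A" "incr B" "incr C"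
  shows "bprob E p (disj_occ A (disj_occ B C)) \<le> bprob E p A * bprob E p B * bprob E p C"
proof -
  have "bprob E p (disj_occ A (disj_occ B C)) \<le> bprob E p A * bprob E p (disj_occ B C)"
    by (intro bk assms incr_disj_occ)
  also have "\<dots> \<le> bprob E p A * (bprob E p B * bprob E p C)"
    by (intro mult_left_mono bk bprob_nonneg assms)
  finally show ?thesis by (simp add: mult.assoc)
qed

section \<open>Increasing events in infinite volume\<close>

text \<open>For an increasing event that is witnessed by finitely many edges of \<open>X\<close>, this supremum over
  finite volumes is its probability when every edge of the infinite set \<open>X\<close> is open with
  probability \<open>p\<close>.\<close>

definition lprob :: "real \<Rightarrow> 'e set \<Rightarrow> ('e set \<Rightarrow> bool) \<Rightarrow> real" where
  "lprob p X A = (SUP F\<in>{F. finite F \<and> F \<subseteq> X}. bprob F p A)"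

lemma lprob_ge:
  assumes "0 \<le> p" "p \<le> 1" "finite F" "F \<subseteq> X"
  shows "bprob F p A \<le> lprob p X A"
  unfolding lprob_def
  by (rule cSUP_upper) (use assms in \<open>auto intro!: bdd_aboveI2[of _ _ 1] bprob_le_1\<close>)

lemma lprob_le:
  assumes "\<And>F. finite F \<Longrightarrow> F \<subseteq> X \<Longrightarrow> bprob F p A \<le> c"
  shows "lprob p X A \<le> c"
  unfolding lprob_def by (rule cSUP_least) (use assms in auto)

lemma lprob_nonneg: "0 \<le> p \<Longrightarrow> p \<le> 1 \<Longrightarrow> 0 \<le> lprob p X A"
  using bprob_nonneg[of p "{}" A] lprob_ge[of p "{}" X A] by simp

lemma lprob_le_1: "0 \<le> p \<Longrightarrow> p \<le> 1 \<Longrightarrow> lprob p X A \<le> 1"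
  by (intro lprob_le bprob_le_1)

text \<open>Enlarging the volume does not lower the probability of an increasing event, so the union
  of separate approximating volumes serves all \<open>i\<close> at once.\<close>

lemma lprob_approx:
  assumes "0 \<le> p" "p \<le> 1" "finite I" "\<And>i. i \<in> I \<Longrightarrow> incr (A i)" "0 < \<epsilon>"
  shows "\<exists>F. finite F \<and> F \<subseteq> X \<and> (\<forall>i\<in>I. lprob p X (A i) - \<epsilon> < bprob F p (A i))"
proof -
  have "\<exists>F. finite F \<and> F \<subseteq> X \<and> lprob p X (A i) - \<epsilon> < bprob F p (A i)" for i
  proof (rule ccontr)
    assume "\<not> ?thesis"
    then have "lprob p X (A i) \<le> lprob p X (A i) - \<epsilon>"
      by (intro lprob_le) (auto simp: not_less)
    with assms show False by simp
  qed
  then obtain F where F: "finite (F i)" "F i \<subseteq> X" "lprob p X (A i) - \<epsilon> < bprob (F i) p (A i)" for i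
    by metis
  have "lprob p X (A i) - \<epsilon> < bprob (\<Union>i\<in>I. F i) p (A i)" if "i \<in> I" for i
    using F(3)[of i] bprob_mono_set[of p "\<Union>i\<in>I. F i" "F i" "A i"] F(1) that assms
    by (fastforce intro: less_le_trans)
  then show ?thesis using F(1,2) assms(3) by (intro exI[of _ "\<Union>i\<in>I. F i"]) auto
qed

lemma lprob_approx1:
  assumes "0 \<le> p" "p \<le> 1" "0 < \<epsilon>"
  shows "\<exists>F. finite F \<and> F \<subseteq> X \<and> lprob p X A - \<epsilon> < bprob F p A"
proof (rule ccontr)
  assume "\<not> ?thesis"
  then have "lprob p X A \<le> lprob p X A - \<epsilon>"
    by (intro lprob_le) (auto simp: not_less)
  with assms show False by simp
qed

lemma lprob_mult_le:
  assumes p: "0 \<le> p" "p \<le> 1"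
    and le: "\<And>F G. finite F \<Longrightarrow> F \<subseteq> X \<Longrightarrow> finite G \<Longrightarrow> G \<subseteq> Y \<Longrightarrow> bprob F p A * bprob G p B \<le> c"
  shows "lprob p X A * lprob p Y B \<le> c"
proof (rule field_le_epsilon)
  fix e :: real assume "0 < e"
  define \<epsilon> where "\<epsilon> = e / 2"
  have \<epsilon>: "\<epsilon> > 0" using \<open>0 < e\<close> by (simp add: \<epsilon>_def)
  obtain F where F: "finite F" "F \<subseteq> X" "lprob p X A - \<epsilon> < bprob F p A"
    using lprob_approx1[OF p \<epsilon>, of X A] by auto
  obtain G where G: "finite G" "G \<subseteq> Y" "lprob p Y B - \<epsilon> < bprob G p B"
    using lprob_approx1[OF p \<epsilon>, of Y B] by auto
  have "lprob p X A * lprob p Y B \<le> (bprob F p A + \<epsilon>) * lprob p Y B"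
    using F lprob_nonneg[OF p] by (intro mult_right_mono) auto
  also have "\<dots> \<le> bprob F p A * lprob p Y B + \<epsilon>"
    using lprob_le_1[OF p, of Y B] \<epsilon> by (simp add: algebra_simps mult_left_le)
  also have "\<dots> \<le> bprob F p A * (bprob G p B + \<epsilon>) + \<epsilon>"
    using G bprob_nonneg[OF p] by (intro add_right_mono mult_left_mono) auto
  also have "\<dots> \<le> bprob F p A * bprob G p B + \<epsilon> + \<epsilon>"
    using bprob_le_1[OF F(1) p, of A] \<epsilon> by (simp add: algebra_simps mult_left_le)
  also have "\<dots> \<le> c + e" using le[OF F(1,2) G(1,2)] by (simp add: \<epsilon>_def)
  finally show "lprob p X A * lprob p Y B \<le> c + e" .
qed

lemma lprob_harris:
  assumes "0 \<le> p" "p \<le> 1" "incr A" "incr B" "\<And>S. A S \<Longrightarrow> B S \<Longrightarrow> C S"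
  shows "lprob p X A * lprob p X B \<le> lprob p X C"
proof (rule lprob_mult_le[OF assms(1,2)])
  fix F G assume FG: "finite F" "F \<subseteq> X" "finite G" "G \<subseteq> X"
  have "bprob F p A * bprob G p B \<le> bprob (F \<union> G) p A * bprob (F \<union> G) p B"
    using FG assms by (intro mult_mono bprob_mono_set bprob_nonneg) auto
  also have "\<dots> \<le> bprob (F \<union> G) p (\<lambda>S. A S \<and> B S)"
    using FG assms by (intro bprob_harris) auto
  also have "\<dots> \<le> bprob (F \<union> G) p C"
    using assms by (intro bprob_mono) auto
  also have "\<dots> \<le> lprob p X C"
    using FG assms by (intro lprob_ge) auto
  finally show "bprob F p A * bprob G p B \<le> lprob p X C" .
qed

text \<open>Translations, reflections, coordinate swaps and inclusions of volumes all enter through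
  this lemma: an injection of edges carries the law on a finite volume to the law on its
  image.\<close>

lemma lprob_image:
  assumes "0 \<le> p" "p \<le> 1" "inj_on h X" "h ` X \<subseteq> Y" "\<And>S. S \<subseteq> X \<Longrightarrow> A S \<Longrightarrow> B (h ` S)"
  shows "lprob p X A \<le> lprob p Y B"
proof (rule lprob_le)
  fix F assume F: "finite F" "F \<subseteq> X"
  then have inj: "inj_on h F" using assms(3) inj_on_subset by blast
  have "bprob F p A \<le> bprob F p (\<lambda>S. B (h ` S))"
    using F assms by (intro bprob_mono) auto
  also have "\<dots> = bprob (h ` F) p B"
    unfolding bprob_def by (rule bexp_image[OF F(1) inj, symmetric])
  also have "\<dots> \<le> lprob p Y B"
    using F assms by (intro lprob_ge) auto
  finally show "bprob F p A \<le> lprob p Y B" .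
qed

lemma lprob_mono:
  assumes "0 \<le> p" "p \<le> 1" "X \<subseteq> Y" "\<And>S. S \<subseteq> X \<Longrightarrow> A S \<Longrightarrow> B S"
  shows "lprob p X A \<le> lprob p Y B"
  by (rule lprob_image[of p id]) (use assms in auto)

section \<open>Open paths\<close>

text \<open>Every vertex is connected to itself, even one that no edge of \<open>S\<close> meets.
  This is why vertex sets appear below as \<open>insert x (\<Union>F)\<close> rather than
  \<open>\<Union>F\<close>.\<close>

definition conn :: "'v set set \<Rightarrow> 'v \<Rightarrow> 'v \<Rightarrow> bool" where
  "conn S x y \<longleftrightarrow> (x, y) \<in> {(u, v). {u, v} \<in> S}\<^sup>*"

lemma conn_refl [simp]: "conn S x x"
  by (simp add: conn_def)

lemma conn_trans: "conn S x y \<Longrightarrow> conn S y z \<Longrightarrow> conn S x z"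
  by (simp add: conn_def)

lemma conn_edge: "{x, y} \<in> S \<Longrightarrow> conn S x y"
  by (auto simp: conn_def)

lemma conn_sym: "conn S x y \<Longrightarrow> conn S y x"
proof -
  have "sym {(u, v). {u, v} \<in> S}" by (auto simp: sym_def insert_commute)
  then have "sym ({(u, v). {u, v} \<in> S}\<^sup>*)" by (rule sym_rtrancl)
  then show "conn S x y \<Longrightarrow> conn S y x" by (auto simp: conn_def dest: symD)
qed

lemma conn_mono: "conn S x y \<Longrightarrow> S \<subseteq> T \<Longrightarrow> conn T x y"
  unfolding conn_def by (erule rtrancl_mono[THEN subsetD, rotated]) auto

lemma conn_induct [consumes 1, case_names refl step]:
  assumes "conn S x y" "P x" "\<And>y z. conn S x y \<Longrightarrow> {y, z} \<in> S \<Longrightarrow> P y \<Longrightarrow> P z"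
  shows "P y"
  using assms(1) unfolding conn_def
  by (induction rule: rtrancl_induct) (use assms(2,3) in \<open>auto simp: conn_def\<close>)

lemma conn_converse_induct [consumes 1, case_names refl step]:
  assumes "conn S x y" "P y" "\<And>x z. {x, z} \<in> S \<Longrightarrow> conn S z y \<Longrightarrow> P z \<Longrightarrow> P x"
  shows "P x"
  using assms(1) unfolding conn_def
  by (induction rule: converse_rtrancl_induct) (use assms(2,3) in \<open>auto simp: conn_def\<close>)

lemma incr_conn [intro!]: "incr (\<lambda>S. conn S x y)"
  by (rule incrI) (auto intro: conn_mono)

lemma incr_conn_Int [intro!]: "incr (\<lambda>S. conn (S \<inter> X) x y)"
  by (rule incrI) (auto intro: conn_mono)

lemma incr_Bex_conn [intro!]: "incr (\<lambda>S. \<exists>y\<in>Y. conn S x y)"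
  by (rule incrI) (auto intro: conn_mono)

lemma incr_member [intro!]: "incr (\<lambda>S. e \<in> S)"
  by (rule incrI) auto

lemma conn_image: "conn S x y \<Longrightarrow> conn ((`) h ` S) (h x) (h y)"
proof (induction rule: conn_induct)
  case (step y z)
  then have "{h y, h z} \<in> (`) h ` S" by (auto intro!: image_eqI[of _ _ "{y, z}"])
  then show ?case using step conn_trans conn_edge by metis
qed simp

lemma conn_mem: "conn S x y \<Longrightarrow> x = y \<or> y \<in> \<Union>S"
  by (induction rule: conn_induct) auto

section \<open>Self-avoiding paths and their decompositions into disjoint pieces\<close>

fun pedges :: "'v list \<Rightarrow> 'v set set" where
  "pedges (x # y # xs) = insert {x, y} (pedges (y # xs))"
| "pedges _ = {}"

lemma pedges_append: "pedges (xs @ w # ys) = pedges (xs @ [w]) \<union> pedges (w # ys)"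
  by (induction xs rule: pedges.induct) auto

lemma pedges_set: "e \<in> pedges xs \<Longrightarrow> e \<subseteq> set xs"
  by (induction xs rule: pedges.induct) auto

lemma pedges_pair: "distinct xs \<Longrightarrow> e \<in> pedges xs \<Longrightarrow> \<exists>u v. e = {u, v} \<and> u \<noteq> v"
  by (induction xs rule: pedges.induct) auto

text \<open>A common edge would have all its endpoints in \<open>{w}\<close>, while an edge of a
  distinct list joins two different vertices. This is the reason for working with self-avoiding
  paths: cutting one at a vertex yields disjoint witnesses for \<open>disj_occ\<close>.\<close>

lemma pedges_disjoint:
  assumes "distinct (xs @ w # ys)"
  shows "pedges (xs @ [w]) \<inter> pedges (w # ys) = {}"
proof (rule ccontr)
  assume "\<not> ?thesis"
  then obtain e where e: "e \<in> pedges (xs @ [w])" "e \<in> pedges (w # ys)" by auto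
  then have "e \<subseteq> {w}" using assms pedges_set[OF e(1)] pedges_set[OF e(2)] by auto
  moreover have "\<exists>u v. e = {u, v} \<and> u \<noteq> v"
    by (rule pedges_pair[OF _ e(1)]) (use assms in auto)
  ultimately show False by auto
qed

lemma conn_pedges: "xs \<noteq> [] \<Longrightarrow> conn (pedges xs) (hd xs) (last xs)"
proof (induction xs rule: pedges.induct)
  case (1 x y xs)
  have "conn (pedges (x # y # xs)) x y" by (intro conn_edge) simp
  moreover have "conn (pedges (x # y # xs)) y (last (y # xs))"
    using 1 by (auto intro: conn_mono)
  ultimately show ?case using conn_trans by auto
qed auto

lemma conn_path:
  assumes "conn S x y"
  obtains xs where "distinct xs" "xs \<noteq> []" "hd xs = x" "last xs = y" "pedges xs \<subseteq> S"
proof -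
  have "\<exists>xs. distinct xs \<and> xs \<noteq> [] \<and> hd xs = x \<and> last xs = y \<and> pedges xs \<subseteq> S"
    using assms
  proof (induction rule: conn_converse_induct)
    case refl
    show ?case by (intro exI[of _ "[y]"]) simp
  next
    case (step x z)
    then obtain xs where xs: "distinct xs" "xs \<noteq> []" "hd xs = z" "last xs = y" "pedges xs \<subseteq> S" by blast
    \<comment> \<open>Loop erasure: if \<open>x\<close> already occurs on the path, the path is
      restarted at that occurrence.\<close>
    show ?case
    proof (cases "x \<in> set xs")
      case True
      then obtain us vs where "xs = us @ x # vs" by (meson split_list)
      then show ?thesis using xs pedges_append[of us x vs] by (intro exI[of _ "x # vs"]) auto
    next
      case False
      obtain zs where "xs = z # zs" using xs by (cases xs) auto
      then show ?thesis using xs step False by (intro exI[of _ "x # xs"]) auto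
    qed
  qed
  then show thesis using that by blast
qed

lemma path_split:
  assumes "distinct xs" "xs = us @ w # vs" "hd xs = x" "last xs = y"
  shows "conn (pedges (us @ [w])) x w" "conn (pedges (w # vs)) w y"
    "pedges (us @ [w]) \<inter> pedges (w # vs) = {}" "pedges xs = pedges (us @ [w]) \<union> pedges (w # vs)"
proof -
  have "hd (us @ [w]) = x" using assms by (cases us) auto
  then show "conn (pedges (us @ [w])) x w" using conn_pedges[of "us @ [w]"] by simp
  show "conn (pedges (w # vs)) w y" using conn_pedges[of "w # vs"] assms by simp
  show "pedges (us @ [w]) \<inter> pedges (w # vs) = {}" using pedges_disjoint[of us w vs] assms by simp
  show "pedges xs = pedges (us @ [w]) \<union> pedges (w # vs)" using pedges_append[of us w vs] assms by simp
qed

text \<open>A discrete intermediate value theorem: an integer function that changes by at most one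
  along each edge cannot jump over \<open>k\<close>.\<close>

lemma first_entry:
  fixes f :: "'v \<Rightarrow> int"
  assumes "\<And>u v. {u, v} \<in> pedges xs \<Longrightarrow> \<bar>f u - f v\<bar> \<le> 1"
    and "xs \<noteq> []" "f (hd xs) \<le> k" "k \<le> f (last xs)"
  shows "\<exists>us w vs. xs = us @ w # vs \<and> f w = k \<and> (\<forall>u\<in>set us. f u < k)"
  using assms
proof (induction xs)
  case (Cons x xs)
  show ?case
  proof (cases "f x = k")
    case True
    then show ?thesis by (intro exI[of _ "[]"] exI[of _ x] exI[of _ xs]) simp
  next
    case False
    with Cons.prems obtain y ys where xs: "xs = y # ys" by (cases xs) auto
    have "\<bar>f x - f y\<bar> \<le> 1" using Cons.prems(1)[of x y] xs by simp
    then have "f (hd xs) \<le> k" using Cons.prems(3) False xs by simp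
    then obtain us w vs where "xs = us @ w # vs \<and> f w = k \<and> (\<forall>u\<in>set us. f u < k)"
      using Cons.IH Cons.prems xs by auto
    then show ?thesis using False Cons.prems(3)
      by (intro exI[of _ "x # us"] exI[of _ w] exI[of _ vs]) auto
  qed
qed simp

text \<open>The counterpart of \<open>first_entry\<close> from the other end. The hypothesis asks
  for some vertex at or below \<open>k\<close>, not for the head, so that the induction can pass to
  the tail as long as such a vertex remains there.\<close>

lemma last_exit:
  fixes f :: "'v \<Rightarrow> int"
  assumes "\<And>u v. {u, v} \<in> pedges xs \<Longrightarrow> \<bar>f u - f v\<bar> \<le> 1"
    and "\<exists>x\<in>set xs. f x \<le> k" "k \<le> f (last xs)"
  shows "\<exists>us w vs. xs = us @ w # vs \<and> f w = k \<and> (\<forall>v\<in>set vs. k < f v)"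
  using assms
proof (induction xs)
  case (Cons x xs)
  show ?case
  proof (cases "\<exists>x\<in>set xs. f x \<le> k")
    case True
    then have "xs \<noteq> []" by auto
    moreover have "\<bar>f u - f v\<bar> \<le> 1" if "{u, v} \<in> pedges xs" for u v
      using Cons.prems(1) that by (cases xs) auto
    ultimately obtain us w vs where "xs = us @ w # vs \<and> f w = k \<and> (\<forall>v\<in>set vs. k < f v)"
      using Cons.IH Cons.prems True by auto
    then show ?thesis by (intro exI[of _ "x # us"] exI[of _ w] exI[of _ vs]) auto
  next
    case False
    then have x: "f x \<le> k" using Cons.prems by auto
    have "f x = k"
    proof (cases xs)
      case (Cons y ys)
      then have "\<bar>f x - f y\<bar> \<le> 1" using Cons.prems(1)[of x y] by simp
      then show ?thesis using False x Cons by auto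
    qed (use Cons.prems x in auto)
    then show ?thesis using False by (intro exI[of _ "[]"] exI[of _ x] exI[of _ xs]) auto
  qed
qed simp

text \<open>\<open>f\<close> is left abstract so that every coordinate, with either sign, can serve
  as the height.\<close>

lemma conn_through_level:
  fixes f :: "'v \<Rightarrow> int"
  assumes "conn S x y" "\<And>u v. {u, v} \<in> S \<Longrightarrow> \<bar>f u - f v\<bar> \<le> 1" "f x \<le> k" "k \<le> f y"
  shows "\<exists>w. f w = k \<and> disj_occ (\<lambda>S. conn S x w) (\<lambda>S. conn S w y) S"
proof -
  obtain xs where xs: "distinct xs" "xs \<noteq> []" "hd xs = x" "last xs = y" "pedges xs \<subseteq> S"
    using conn_path[OF assms(1)] .
  obtain us w vs where w: "xs = us @ w # vs" "f w = k"
    using first_entry[of xs f k] xs assms(2-4) by blast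
  show ?thesis
    using path_split[OF xs(1) w(1) xs(3,4)] w(2) xs(5)
    by (intro exI[of _ w] conjI disj_occI[of "pedges (us @ [w])" "pedges (w # vs)"]) auto
qed

text \<open>\<open>u\<close> is the last visit to level 0 and \<open>v\<close> the first later visit
  to level \<open>n\<close>. Choosing them in this order confines the piece between them to the
  slab.\<close>

lemma conn_through_slab:
  fixes f :: "'v \<Rightarrow> int"
  assumes "conn S x y" "\<And>u v. {u, v} \<in> S \<Longrightarrow> \<bar>f u - f v\<bar> \<le> 1" "f x = 0" "f y = n" "0 \<le> n"
  shows "\<exists>u v. f u = 0 \<and> f v = n \<and> disj_occ (\<lambda>S. conn S x u)
    (disj_occ (\<lambda>S. conn (S \<inter> {e. f ` e \<subseteq> {0..n}}) u v) (\<lambda>S. conn S v y)) S"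
proof -
  obtain xs where xs: "distinct xs" "xs \<noteq> []" "hd xs = x" "last xs = y" "pedges xs \<subseteq> S"
    using conn_path[OF assms(1)] .
  have "\<exists>x\<in>set xs. f x \<le> 0" using xs(2,3) assms(3) by (intro bexI[of _ x]) auto
  then obtain us u vs where u: "xs = us @ u # vs" "f u = 0" "\<forall>v\<in>set vs. 0 < f v"
    using last_exit[of xs f 0] xs assms by blast
  note s = path_split[OF xs(1) u(1) xs(3,4)]
  have vs: "distinct (u # vs)" "last (u # vs) = y" "pedges (u # vs) \<subseteq> S"
    using xs u s(4) by auto
  obtain us' v vs' where v: "u # vs = us' @ v # vs'" "f v = n" "\<forall>v\<in>set us'. f v < n"
    using first_entry[of "u # vs" f n] u(2) vs assms by fastforce
  have hdl: "hd (u # vs) = u" by simp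
  note t = path_split[OF vs(1) v(1) hdl vs(2)]
  have "set (us' @ [v]) \<subseteq> set (u # vs)" using v(1) by (metis Un_upper1 append.assoc append_Cons append_Nil set_append)
  then have "0 \<le> f z \<and> f z \<le> n" if "z \<in> set (us' @ [v])" for z
    using that u(2,3) v(2,3) by fastforce
  then have "pedges (us' @ [v]) \<subseteq> {e. f ` e \<subseteq> {0..n}}"
    using pedges_set[of _ "us' @ [v]"] by fastforce
  then have "conn (pedges (us' @ [v]) \<inter> {e. f ` e \<subseteq> {0..n}}) u v"
    using t(1) by (metis Int_absorb2)
  then have "disj_occ (\<lambda>S. conn (S \<inter> {e. f ` e \<subseteq> {0..n}}) u v) (\<lambda>S. conn S v y) (pedges (u # vs))"
    using t by (intro disj_occI[of "pedges (us' @ [v])" "pedges (v # vs')"]) auto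
  then have "disj_occ (\<lambda>S. conn S x u)
      (disj_occ (\<lambda>S. conn (S \<inter> {e. f ` e \<subseteq> {0..n}}) u v) (\<lambda>S. conn S v y)) S"
    using s xs(5) by (rule_tac disj_occI[of "pedges (us @ [u])" "pedges (u # vs)"]) auto
  then show ?thesis using u(2) v(2) by blast
qed

text \<open>Stopping at the first vertex of \<open>W\<close> uses only edges with an endpoint
  outside \<open>W\<close>. Such edges cannot belong to a path whose vertex set is
  \<open>W\<close>.\<close>

lemma conn_first_hit:
  assumes "conn S z x" "x \<in> W"
  shows "\<exists>w\<in>W. conn {e \<in> S. \<not> e \<subseteq> W} z w"
  using assms(1)
proof (induction rule: conn_converse_induct)
  case (step z z')
  then show ?case
  proof (cases "z \<in> W")
    case False
    then have "conn {e \<in> S. \<not> e \<subseteq> W} z z'" using step(1) by (intro conn_edge) auto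
    then show ?thesis using step(3) conn_trans by fast
  qed (auto intro!: bexI[of _ z])
qed (use assms in \<open>auto intro!: bexI[of _ x]\<close>)

text \<open>Fix a self-avoiding path from \<open>x\<close> to \<open>y\<close> and follow a
  connection from \<open>z\<close> until it first meets this path, at \<open>w\<close>. The three
  arms are edge-disjoint, because the third uses no edge with both endpoints on the path.\<close>

lemma conn_tree:
  assumes "conn S x y" "conn S x z"
  shows "\<exists>w. (w = x \<or> w \<in> \<Union>S) \<and>
    disj_occ (\<lambda>S. conn S x w) (disj_occ (\<lambda>S. conn S w y) (\<lambda>S. conn S w z)) S"
proof -
  obtain xs where xs: "distinct xs" "xs \<noteq> []" "hd xs = x" "last xs = y" "pedges xs \<subseteq> S"
    using conn_path[OF assms(1)] .
  let ?K = "{e \<in> S. \<not> e \<subseteq> set xs}"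
  have "x \<in> set xs" using xs by auto
  then obtain w where w: "w \<in> set xs" "conn ?K z w"
    using conn_first_hit[OF conn_sym[OF assms(2)]] by blast
  obtain us vs where s: "xs = us @ w # vs" using w(1) by (meson split_list)
  note t = path_split[OF xs(1) s xs(3,4)]
  have K: "?K \<inter> pedges xs = {}" using pedges_set by fastforce
  have "disj_occ (\<lambda>S. conn S w y) (\<lambda>S. conn S w z) (pedges (w # vs) \<union> ?K)"
    by (rule disj_occI[of "pedges (w # vs)" ?K]) (use K t conn_sym[OF w(2)] in auto)
  then have "disj_occ (\<lambda>S. conn S x w) (disj_occ (\<lambda>S. conn S w y) (\<lambda>S. conn S w z)) S"
    by (rule disj_occI[rotated 4]) (use K t xs(5) in auto)
  moreover have "conn S x w" using t(1,4) xs(5) by (auto intro: conn_mono)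
  ultimately show ?thesis using conn_mem by metis
qed

text \<open>Cut a self-avoiding path at its first vertex outside \<open>T\<close>. The exit edge
  does not recur later, since \<open>u\<close> is not visited again.\<close>

lemma conn_exit:
  assumes "conn S x y" "x \<in> T" "y \<notin> T"
  shows "\<exists>u\<in>T. \<exists>v. v \<notin> T \<and> {u, v} \<in> S \<and> disj_occ (\<lambda>S. conn (S \<inter> Pow T) x u)
    (disj_occ (\<lambda>S. {u, v} \<in> S) (\<lambda>S. conn S v y)) S"
proof -
  obtain xs where xs: "distinct xs" "xs \<noteq> []" "hd xs = x" "last xs = y" "pedges xs \<subseteq> S"
    using conn_path[OF assms(1)] .
  have "\<exists>v\<in>set xs. v \<notin> T" using xs(2,4) assms(3) by (intro bexI[of _ y]) auto
  then obtain us v vs where v: "xs = us @ v # vs" "v \<notin> T" "\<forall>u\<in>set us. u \<in> T"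
    using split_list_first_prop[of xs "\<lambda>v. v \<notin> T"] by blast
  have "us \<noteq> []" using v xs(3) assms(2) by auto
  then obtain as u where us: "us = as @ [u]" by (metis rev_exhaust)
  have e: "xs = as @ u # (v # vs)" using v us by simp
  note s = path_split[OF xs(1) v(1) xs(3,4)] and t = path_split[OF xs(1) e xs(3,4)]
  have u: "u \<in> T" using v us by auto
  have sub: "pedges (as @ [u]) \<subseteq> Pow T" using pedges_set[of _ "as @ [u]"] v(3) us by blast
  have dist: "distinct (u # v # vs)" using xs(1) e by auto
  have "{u, v} \<notin> pedges (v # vs)" using pedges_set[of "{u,v}" "v # vs"] dist by auto
  moreover have "conn (pedges (v # vs)) v y" by (rule s(2))
  ultimately have "disj_occ (\<lambda>S. {u, v} \<in> S) (\<lambda>S. conn S v y) (pedges (u # v # vs))"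
    by (intro disj_occI[of "{{u, v}}" "pedges (v # vs)"]) auto
  then have "disj_occ (\<lambda>S. conn (S \<inter> Pow T) x u)
    (disj_occ (\<lambda>S. {u, v} \<in> S) (\<lambda>S. conn S v y)) S"
    using t sub xs(5) by (rule_tac disj_occI[of "pedges (as @ [u])" "pedges (u # v # vs)"])
      (simp_all add: Int_absorb2 del: pedges.simps)
  moreover have "{u, v} \<in> S" using t(4) xs(5) by auto
  ultimately show ?thesis using u v(2) by blast
qed

lemma conn_within_cluster: "conn S x y \<Longrightarrow> conn {e \<in> S. \<forall>v\<in>e. conn S x v} x y"
proof (induction rule: conn_induct)
  case (step y z)
  have "conn S x z" by (rule conn_trans[OF step(1) conn_edge[OF step(2)]])
  then have "{y, z} \<in> {e \<in> S. \<forall>v\<in>e. conn S x v}" using step by auto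
  then show ?case using step(3) by (blast intro: conn_trans conn_edge)
qed simp

text \<open>Different clusters have no edge in common, so the edges of each cluster serve as a
  witness. The condition \<open>{} \<notin> S\<close> matters: the empty set would vacuously count
  as an edge of both clusters.\<close>

lemma conn_disjoint_clusters:
  assumes "\<exists>y\<in>Y. conn S x y" "\<exists>y\<in>Y. conn S x' y" "\<not> conn S x x'" "{} \<notin> S"
  shows "disj_occ (\<lambda>S. \<exists>y\<in>Y. conn S x y) (\<lambda>S. \<exists>y\<in>Y. conn S x' y) S"
proof (rule disj_occI[of "{e \<in> S. \<forall>v\<in>e. conn S x v}" "{e \<in> S. \<forall>v\<in>e. conn S x' v}"])
  show "{e \<in> S. \<forall>v\<in>e. conn S x v} \<inter> {e \<in> S. \<forall>v\<in>e. conn S x' v} = {}"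
  proof (rule ccontr)
    assume "\<not> ?thesis"
    then obtain e where e: "e \<in> S" "\<forall>v\<in>e. conn S x v" "\<forall>v\<in>e. conn S x' v" by auto
    then obtain v where "v \<in> e" using assms(4) by (metis all_not_in_conv)
    then have "conn S x v" "conn S x' v" using e by auto
    then show False using assms(3) conn_trans conn_sym by metis
  qed
  show "\<exists>y\<in>Y. conn {e \<in> S. \<forall>v\<in>e. conn S x v} x y"
    using assms(1) conn_within_cluster[of S x] by blast
  show "\<exists>y\<in>Y. conn {e \<in> S. \<forall>v\<in>e. conn S x' v} x' y"
    using assms(2) conn_within_cluster[of S x'] by blast
qed auto

lemma sum_lprob_le:
  assumes "0 \<le> p" "p \<le> 1" "finite Y" "\<And>y. y \<in> Y \<Longrightarrow> incr (A y)"
    and "\<And>F. finite F \<Longrightarrow> F \<subseteq> X \<Longrightarrow> (\<Sum>y\<in>Y. bprob F p (A y)) \<le> c"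
  shows "(\<Sum>y\<in>Y. lprob p X (A y)) \<le> c"
proof (rule field_le_epsilon)
  fix e :: real assume e: "0 < e"
  define \<epsilon> where "\<epsilon> = e / (real (card Y) + 1)"
  have \<epsilon>: "0 < \<epsilon>" using e by (simp add: \<epsilon>_def add_nonneg_pos)
  obtain F where F: "finite F" "F \<subseteq> X" "\<forall>y\<in>Y. lprob p X (A y) - \<epsilon> < bprob F p (A y)"
    using lprob_approx[OF assms(1-3) _ \<epsilon>, of A X] assms(4) by auto
  have "(\<Sum>y\<in>Y. lprob p X (A y)) \<le> (\<Sum>y\<in>Y. bprob F p (A y) + \<epsilon>)"
    using F(3) by (intro sum_mono) (auto simp: algebra_simps less_imp_le)
  also have "\<dots> \<le> c + real (card Y) * \<epsilon>"
    using assms(5)[OF F(1,2)] by (simp add: sum.distrib)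
  also have "real (card Y) * \<epsilon> \<le> e"
    using e by (simp add: \<epsilon>_def field_simps)
  finally show "(\<Sum>y\<in>Y. lprob p X (A y)) \<le> c + e" by simp
qed

section \<open>Subadditive sequences\<close>

text \<open>Fekete's lemma; nonnegativity keeps the infimum finite. Besides the limit, the bound
  \<open>L * real n \<le> f n\<close> for every single \<open>n\<close> is used: it carries no
  subexponential correction.\<close>

lemma fekete:
  fixes f :: "nat \<Rightarrow> real"
  assumes sub: "\<And>m n. f (m + n) \<le> f m + f n" and nonneg: "\<And>n. 0 \<le> f n"
  defines "L \<equiv> INF n\<in>{1..}. f n / real n"
  shows "(\<lambda>n. f n / real n) \<longlonglongrightarrow> L" and "\<And>n. L * real n \<le> f n" and "0 \<le> L"
proof -
  have bdd: "bdd_below ((\<lambda>n. f n / real n) ` {1..})"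
    using nonneg by (auto intro!: bdd_belowI2[of _ 0])
  have L: "L \<le> f n / real n" if "n \<ge> 1" for n
    unfolding L_def by (rule cINF_lower[OF bdd]) (use that in auto)
  then show Ln: "L * real n \<le> f n" for n
    using nonneg[of 0] by (cases "n = 0") (auto simp: field_simps Suc_le_eq)
  show "0 \<le> L" unfolding L_def by (rule cINF_greatest) (use nonneg in auto)
  \<comment> \<open>For \<open>k = 0\<close> the left side is \<open>f 0\<close>, which need not
    vanish; the last term covers this case.\<close>
  have mult: "f (k * n) \<le> real k * f n + (if k = 0 then f 0 else 0)" for k n
  proof (induction k)
    case (Suc k)
    show ?case
    proof (cases k)
      case (Suc j)
      then show ?thesis using Suc.IH sub[of n "k * n"] by (simp add: algebra_simps)
    qed simp
  qed simp
  show "(\<lambda>n. f n / real n) \<longlonglongrightarrow> L"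
  proof (rule LIMSEQ_I)
    fix e :: real assume e: "0 < e"
    have "\<not> (\<forall>n\<in>{1..}. L + e / 2 \<le> f n / real n)"
    proof
      assume "\<forall>n\<in>{1..}. L + e / 2 \<le> f n / real n"
      then have "L + e / 2 \<le> L" unfolding L_def by (intro cINF_greatest) auto
      with e show False by simp
    qed
    then obtain n where n: "n \<ge> 1" "f n / real n < L + e / 2" by (auto simp: not_le)
    \<comment> \<open>The sum of nonnegative terms dominates every remainder
      \<open>f (k mod n)\<close>; divided by a large \<open>k\<close> it becomes negligible.\<close>
    define B where "B = (\<Sum>r<n. f r) + f 0"
    have B: "f r \<le> B" if "r < n" for r
      unfolding B_def using that nonneg by (intro order_trans[OF member_le_sum[of r "{..<n}" f]]) auto
    have B0: "0 \<le> B" unfolding B_def using nonneg by (simp add: sum_nonneg)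
    obtain N where N: "2 * (B + f 0) / e < real N" using reals_Archimedean2 by blast
    have "\<bar>f k / real k - L\<bar> < e" if k: "k \<ge> max N 1" for k
    proof -
      have kpos: "0 < real k" using k by simp
      have "f k \<le> f (k div n * n) + f (k mod n)" using sub[of "k div n * n" "k mod n"] by simp
      also have "\<dots> \<le> real (k div n) * f n + f 0 + B"
        using mult[of "k div n" n] B[of "k mod n"] n nonneg[of 0] by (auto split: if_splits)
      also have "real (k div n) * f n \<le> (real k / real n) * f n"
        using n nonneg by (intro mult_right_mono of_nat_div_le_of_nat)
      also have "(real k / real n) * f n = real k * (f n / real n)" by simp
      also have "\<dots> < real k * (L + e / 2)"
        using n(2) kpos by (intro mult_strict_left_mono) auto
      finally have "f k < real k * (L + e / 2) + f 0 + B" by simp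
      moreover have "f 0 + B \<le> real k * (e / 2)"
      proof -
        have "2 * (B + f 0) / e < real k" using N k by linarith
        then show ?thesis using e by (simp add: field_simps)
      qed
      ultimately have "f k < real k * (L + e)" by (simp add: algebra_simps)
      then have "f k / real k < L + e" using kpos by (simp add: field_simps)
      moreover have "L \<le> f k / real k" using L k by auto
      ultimately show ?thesis by simp
    qed
    then show "\<exists>no. \<forall>n\<ge>no. norm (f n / real n - L) < e"
      by (intro exI[of _ "max N 1"] allI impI) (simp only: real_norm_def)
  qed
qed

section \<open>The lattice and its symmetries\<close>

lemma edges_iff: "{x, y} \<in> edges d \<longleftrightarrow> x \<in> lattice d \<and> y \<in> lattice d \<and> (\<Sum>i<d. \<bar>x i - y i\<bar>) = 1"
proof
  assume "{x, y} \<in> edges d"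
  then obtain u v where uv: "{x, y} = {u, v}" "u \<in> lattice d" "v \<in> lattice d" "(\<Sum>i<d. \<bar>u i - v i\<bar>) = 1"
    by (auto simp: edges_def)
  moreover have "(\<Sum>i<d. \<bar>v i - u i\<bar>) = (\<Sum>i<d. \<bar>u i - v i\<bar>)"
    by (simp add: abs_minus_commute)
  ultimately show "x \<in> lattice d \<and> y \<in> lattice d \<and> (\<Sum>i<d. \<bar>x i - y i\<bar>) = 1"
    by (auto simp: doubleton_eq_iff)
qed (auto simp: edges_def)

lemma edgesE:
  assumes "e \<in> edges d"
  obtains x y where "e = {x, y}" "x \<in> lattice d" "y \<in> lattice d" "(\<Sum>i<d. \<bar>x i - y i\<bar>) = 1"
  using assms by (auto simp: edges_def)

lemma edges_lattice: "e \<in> edges d \<Longrightarrow> e \<subseteq> lattice d"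
  by (auto elim!: edgesE)

lemma edges_finite: "e \<in> edges d \<Longrightarrow> finite e"
  by (auto elim!: edgesE)

lemma empty_notin_edges: "{} \<notin> edges d"
  by (auto elim!: edgesE)

lemma edges_coord:
  assumes "{x, y} \<in> edges d" "i < d"
  shows "\<bar>x i - y i\<bar> \<le> 1"
proof -
  have "\<bar>x i - y i\<bar> \<le> (\<Sum>i<d. \<bar>x i - y i\<bar>)"
    by (rule member_le_sum) (use assms in auto)
  then show ?thesis using assms by (simp add: edges_iff)
qed

lemma finite_Union_edges: "finite F \<Longrightarrow> F \<subseteq> edges d \<Longrightarrow> finite (\<Union>F)"
  using edges_finite by auto

lemma origin_apply: "i < d \<Longrightarrow> origin d i = 0"
  by (simp add: axis_point_def)

lemma axis_point_lattice [simp]: "axis_point d n \<in> lattice d"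
  by (simp add: axis_point_def lattice_def)

lemma lattice_eqI: "x \<in> lattice d \<Longrightarrow> y \<in> lattice d \<Longrightarrow> (\<And>i. i < d \<Longrightarrow> x i = y i) \<Longrightarrow> x = y"
  unfolding lattice_def by (rule PiE_ext) auto

text \<open>A coordinate permutation with sign changes \<open>s\<close>, followed by the translation
  by \<open>a\<close>: one format for the shifts, reflections and axis swaps below.\<close>

definition lattice_sym ::
    "nat \<Rightarrow> (nat \<Rightarrow> nat) \<Rightarrow> (nat \<Rightarrow> int) \<Rightarrow> (nat \<Rightarrow> int) \<Rightarrow> (nat \<Rightarrow> int) \<Rightarrow> nat \<Rightarrow> int" where
  "lattice_sym d \<pi> s a x = (\<lambda>i\<in>{..<d}. s i * x (\<pi> i) + a i)"

lemma lattice_sym_in [simp]: "lattice_sym d \<pi> s a x \<in> lattice d"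
  by (simp add: lattice_sym_def lattice_def)

lemma lattice_sym_inj:
  assumes "\<pi> permutes {..<d}" "\<And>i. i < d \<Longrightarrow> \<bar>s i\<bar> = 1"
  shows "inj_on (lattice_sym d \<pi> s a) (lattice d)"
proof (rule inj_onI, rule lattice_eqI)
  fix x y j assume xy: "lattice_sym d \<pi> s a x = lattice_sym d \<pi> s a y" "j < d"
  obtain i where i: "i < d" "\<pi> i = j"
    using permutes_image[OF assms(1)] xy(2) by (metis imageE lessThan_iff)
  have "s i * x (\<pi> i) = s i * y (\<pi> i)"
    using fun_cong[OF xy(1), of i] i by (simp add: lattice_sym_def)
  then show "x j = y j" using assms(2)[OF i(1)] i by auto
qed

lemma lattice_sym_edges:
  assumes "\<pi> permutes {..<d}" "\<And>i. i < d \<Longrightarrow> \<bar>s i\<bar> = 1" "e \<in> edges d"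
  shows "lattice_sym d \<pi> s a ` e \<in> edges d"
proof -
  obtain x y where e: "e = {x, y}" "(\<Sum>i<d. \<bar>x i - y i\<bar>) = 1" using assms(3) by (auto elim!: edgesE)
  have "(\<Sum>i<d. \<bar>lattice_sym d \<pi> s a x i - lattice_sym d \<pi> s a y i\<bar>) = (\<Sum>i<d. \<bar>x (\<pi> i) - y (\<pi> i)\<bar>)"
  proof (rule sum.cong[OF refl])
    fix i assume "i \<in> {..<d}"
    then have "lattice_sym d \<pi> s a x i - lattice_sym d \<pi> s a y i = s i * (x (\<pi> i) - y (\<pi> i))" "\<bar>s i\<bar> = 1"
      using assms(2) by (auto simp: lattice_sym_def algebra_simps)
    then show "\<bar>lattice_sym d \<pi> s a x i - lattice_sym d \<pi> s a y i\<bar> = \<bar>x (\<pi> i) - y (\<pi> i)\<bar>"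
      by (simp add: abs_mult)
  qed
  also have "\<dots> = (\<Sum>i<d. \<bar>x i - y i\<bar>)"
    using sum.permute[OF assms(1), of "\<lambda>i. \<bar>x i - y i\<bar>"] by (simp add: o_def)
  finally show ?thesis using e by (simp add: edges_iff)
qed

section \<open>The two-point function and its symmetries\<close>

definition tau :: "nat \<Rightarrow> real \<Rightarrow> (nat \<Rightarrow> int) \<Rightarrow> (nat \<Rightarrow> int) \<Rightarrow> real" where
  "tau d p x y = lprob p (edges d) (\<lambda>S. conn S x y)"

lemma lprob_sym:
  assumes "0 \<le> p" "p \<le> 1" "\<pi> permutes {..<d}" "\<And>i. i < d \<Longrightarrow> \<bar>s i\<bar> = 1"
    and "X \<subseteq> edges d" "\<And>e. e \<in> X \<Longrightarrow> lattice_sym d \<pi> s a ` e \<in> Y"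
    and "\<And>S. S \<subseteq> X \<Longrightarrow> A S \<Longrightarrow> B ((`) (lattice_sym d \<pi> s a) ` S)"
  shows "lprob p X A \<le> lprob p Y B"
proof (rule lprob_image[of p "(`) (lattice_sym d \<pi> s a)"])
  have "\<Union>X \<subseteq> lattice d" using assms(5) edges_lattice by blast
  then show "inj_on ((`) (lattice_sym d \<pi> s a)) X"
    by (intro inj_on_image inj_on_subset[OF lattice_sym_inj] assms)
qed (use assms in auto)

lemma tau_sym_map:
  assumes "0 \<le> p" "p \<le> 1" "\<pi> permutes {..<d}" "\<And>i. i < d \<Longrightarrow> \<bar>s i\<bar> = 1"
  shows "tau d p x y \<le> tau d p (lattice_sym d \<pi> s a x) (lattice_sym d \<pi> s a y)"
  unfolding tau_def
  by (rule lprob_sym[OF assms(1-4)]) (auto intro: lattice_sym_edges assms conn_image)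

definition shift :: "nat \<Rightarrow> (nat \<Rightarrow> int) \<Rightarrow> (nat \<Rightarrow> int) \<Rightarrow> nat \<Rightarrow> int" where
  "shift d a = lattice_sym d id (\<lambda>_. 1) a"

lemma shift_apply: "i < d \<Longrightarrow> shift d a x i = x i + a i"
  by (simp add: shift_def lattice_sym_def)

lemma shift_lattice [simp]: "shift d a x \<in> lattice d"
  by (simp add: shift_def)

lemma shift_origin [simp]: "x \<in> lattice d \<Longrightarrow> shift d x (origin d) = x"
  by (rule lattice_eqI[of _ d]) (auto simp: shift_apply origin_apply)

lemma shift_neg: "shift d (\<lambda>i. - u i) u = origin d"
  by (rule lattice_eqI[of _ d]) (auto simp: shift_apply origin_apply)

lemma shift_edges: "e \<in> edges d \<Longrightarrow> shift d a ` e \<in> edges d"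
  unfolding shift_def by (rule lattice_sym_edges) (auto simp: permutes_id)

lemma shift_inj: "X \<subseteq> edges d \<Longrightarrow> inj_on ((`) (shift d a)) X"
proof -
  assume "X \<subseteq> edges d"
  then have "\<Union>X \<subseteq> lattice d" using edges_lattice by blast
  then show ?thesis unfolding shift_def
    by (intro inj_on_image inj_on_subset[OF lattice_sym_inj]) (auto simp: permutes_id)
qed

lemma tau_shift: "0 \<le> p \<Longrightarrow> p \<le> 1 \<Longrightarrow> tau d p x y \<le> tau d p (shift d a x) (shift d a y)"
  unfolding shift_def by (rule tau_sym_map) (auto simp: permutes_id)

lemma tau_nonneg: "0 \<le> p \<Longrightarrow> p \<le> 1 \<Longrightarrow> 0 \<le> tau d p x y"
  unfolding tau_def by (rule lprob_nonneg)

lemma tau_le_1: "0 \<le> p \<Longrightarrow> p \<le> 1 \<Longrightarrow> tau d p x y \<le> 1"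
  unfolding tau_def by (rule lprob_le_1)

lemma tau_mult: "0 \<le> p \<Longrightarrow> p \<le> 1 \<Longrightarrow> tau d p x y * tau d p y z \<le> tau d p x z"
  unfolding tau_def by (rule lprob_harris) (auto intro: conn_trans)

lemma tau_ge: "0 \<le> p \<Longrightarrow> p \<le> 1 \<Longrightarrow> finite F \<Longrightarrow> F \<subseteq> edges d \<Longrightarrow>
    bprob F p (\<lambda>S. conn S x y) \<le> tau d p x y"
  unfolding tau_def by (rule lprob_ge)

lemma bprob_edge: "bprob {e} p (\<lambda>S. e \<in> S) = p"
  unfolding bprob_def by (subst bexp_insert) auto

lemma tau_edge:
  assumes "0 \<le> p" "p \<le> 1" "{x, y} \<in> edges d"
  shows "p \<le> tau d p x y"
proof -
  have "p = bprob {{x, y}} p (\<lambda>S. {x, y} \<in> S)" by (simp add: bprob_edge)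
  also have "\<dots> \<le> bprob {{x, y}} p (\<lambda>S. conn S x y)"
    using assms by (intro bprob_mono) (auto intro: conn_edge)
  also have "\<dots> \<le> tau d p x y" using assms by (intro tau_ge) auto
  finally show ?thesis .
qed

definition axis_tau :: "nat \<Rightarrow> real \<Rightarrow> nat \<Rightarrow> real" where
  "axis_tau d p n = tau d p (origin d) (axis_point d n)"

lemma axis_tau_mult:
  assumes "0 \<le> p" "p \<le> 1"
  shows "axis_tau d p m * axis_tau d p n \<le> axis_tau d p (m + n)"
proof -
  have "shift d (axis_point d m) (axis_point d n) = axis_point d (m + n)"
    by (rule lattice_eqI[of _ d]) (simp, simp, simp add: shift_apply axis_point_def)
  then have "axis_tau d p n \<le> tau d p (axis_point d m) (axis_point d (m + n))"
    using tau_shift[OF assms, of d "origin d" "axis_point d n" "axis_point d m"]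
    by (simp add: axis_tau_def)
  then have "axis_tau d p m * axis_tau d p n
      \<le> tau d p (origin d) (axis_point d m) * tau d p (axis_point d m) (axis_point d (m + n))"
    unfolding axis_tau_def using tau_nonneg[OF assms] by (intro mult_left_mono) auto
  also have "\<dots> \<le> axis_tau d p (m + n)" unfolding axis_tau_def by (rule tau_mult[OF assms])
  finally show ?thesis .
qed

lemma axis_edge: "0 < d \<Longrightarrow> {axis_point d n, axis_point d (Suc n)} \<in> edges d"
proof -
  assume d: "0 < d"
  have "(\<Sum>i<d. \<bar>axis_point d n i - axis_point d (Suc n) i\<bar>) = (\<Sum>i<d. if i = 0 then 1 else 0)"
    by (rule sum.cong) (auto simp: axis_point_def)
  also have "\<dots> = 1" using d by simp
  finally show ?thesis by (simp add: edges_iff)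
qed

lemma axis_tau_ge:
  assumes "0 \<le> p" "p \<le> 1" "0 < d"
  shows "p ^ n \<le> axis_tau d p n"
proof (induction n)
  case 0
  have "bprob {} p (\<lambda>S. conn S (origin d) (origin d)) = 1" by (simp add: bprob_def)
  then show ?case using tau_ge[OF assms(1,2), of "{}" d "origin d" "origin d"] by (simp add: axis_tau_def)
next
  case (Suc n)
  have "p ^ Suc n \<le> axis_tau d p n * tau d p (axis_point d n) (axis_point d (Suc n))"
    using Suc assms tau_edge[OF assms(1,2) axis_edge[OF assms(3), of n]] tau_nonneg[OF assms(1,2)]
    unfolding power_Suc2 by (intro mult_mono) (auto simp: axis_tau_def)
  also have "\<dots> \<le> axis_tau d p (Suc n)" unfolding axis_tau_def by (rule tau_mult[OF assms(1,2)])
  finally show ?case .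
qed

text \<open>Reflecting the second half of a path in all coordinates but the \<open>i\<close>-th.\<close>

lemma tau_square_le:
  assumes "0 \<le> p" "p \<le> 1" "y \<in> lattice d" "i < d"
  shows "(tau d p (origin d) y)\<^sup>2 \<le> axis_tau d p (2 * nat \<bar>y i\<bar>)"
proof -
  define R where "R = lattice_sym d id (\<lambda>j. if j = i then 1 else -1) (\<lambda>_. 0)"
  \<comment> \<open>\<open>z\<close> is \<open>y + R y\<close>, whose only nonzero coordinate can be
    the \<open>i\<close>-th, equal to \<open>2 * y i\<close>: after the reflected second half the
    path ends on a coordinate axis.\<close>
  define z where "z = shift d y (R y)"
  have R0: "R (origin d) = origin d"
    unfolding R_def by (rule lattice_eqI[of _ d]) (simp, simp, simp add: lattice_sym_def origin_apply)
  have "tau d p (origin d) y \<le> tau d p (R (origin d)) (R y)"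
    unfolding R_def by (rule tau_sym_map) (use assms in \<open>auto simp: permutes_id\<close>)
  also have "\<dots> \<le> tau d p (shift d y (origin d)) z"
    unfolding R0 z_def by (rule tau_shift[OF assms(1,2)])
  finally have "tau d p (origin d) y \<le> tau d p y z" using assms by simp
  then have "(tau d p (origin d) y)\<^sup>2 \<le> tau d p (origin d) y * tau d p y z"
    unfolding power2_eq_square using tau_nonneg assms by (intro mult_left_mono) auto
  also have "\<dots> \<le> tau d p (origin d) z" by (rule tau_mult[OF assms(1,2)])
  also have "\<dots> \<le> axis_tau d p (2 * nat \<bar>y i\<bar>)"
  proof -
    \<comment> \<open>Moves the \<open>i\<close>-th axis to the first one and, if \<open>y i\<close>
      is negative, reverses its direction.\<close>
    define g where "g = lattice_sym d (Transposition.transpose 0 i) (\<lambda>j. if y i < 0 then -1 else 1) (\<lambda>_. 0)"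
    have perm: "Transposition.transpose 0 i permutes {..<d}"
      using assms(4) by (intro permutes_swap_id) auto
    have dom: "Transposition.transpose 0 i j < d" if "j < d" for j
      using that assms(4) unfolding Transposition.transpose_def by (auto split: if_splits)
    have zi: "z j = (if j = i then 2 * y i else 0)" if "j < d" for j
      using that by (simp add: z_def shift_apply R_def lattice_sym_def)
    have g0: "g (origin d) = origin d"
      unfolding g_def by (rule lattice_eqI[of _ d]) (simp, simp, simp add: lattice_sym_def dom origin_apply)
    have gz: "g z = axis_point d (2 * nat \<bar>y i\<bar>)"
      unfolding g_def by (rule lattice_eqI[of _ d])
        (simp, simp, auto simp: lattice_sym_def zi dom axis_point_def Transposition.transpose_def assms(4))
    have "tau d p (origin d) z \<le> tau d p (g (origin d)) (g z)"
      unfolding g_def by (rule tau_sym_map) (use assms perm in auto)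
    then show ?thesis by (simp add: g0 gz axis_tau_def)
  qed
  finally show ?thesis .
qed

section \<open>Connections to hyperplanes\<close>

definition level :: "nat \<Rightarrow> int \<Rightarrow> (nat \<Rightarrow> int) set" where
  "level d k = {y \<in> lattice d. y 0 = k}"

text \<open>The inverse correlation length. Written as an infimum it bounds \<open>axis_tau\<close>
  for every \<open>n\<close>, and Fekete's lemma identifies it with the limit.\<close>

definition decay_rate :: "nat \<Rightarrow> real \<Rightarrow> real" where
  "decay_rate d p = (INF n\<in>{1..}. - ln (axis_tau d p n) / real n)"

locale perc =
  fixes d :: nat and p :: real
  assumes d2: "2 \<le> d" and p_pos: "0 < p" and p_le_1: "p \<le> 1"
begin

lemma d_pos: "0 < d" using d2 by simp

lemma p_nonneg: "0 \<le> p" using p_pos by simp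

lemmas p01 = p_nonneg p_le_1

abbreviation r where "r \<equiv> decay_rate d p"

abbreviation org where "org \<equiv> origin d"

lemma axis_tau_pos: "0 < axis_tau d p n"
  by (rule less_le_trans[OF zero_less_power[OF p_pos] axis_tau_ge[OF p01 d_pos]])

lemma axis_tau_le_1: "axis_tau d p n \<le> 1"
  unfolding axis_tau_def by (rule tau_le_1[OF p01])

lemma neg_ln_axis_tau_subadd:
  "- ln (axis_tau d p (m + n)) \<le> - ln (axis_tau d p m) + - ln (axis_tau d p n)"
proof -
  have "ln (axis_tau d p m * axis_tau d p n) \<le> ln (axis_tau d p (m + n))"
    using axis_tau_mult[OF p01, of d m n] axis_tau_pos by (subst ln_le_cancel_iff) auto
  then show ?thesis using axis_tau_pos[of m] axis_tau_pos[of n] by (simp add: ln_mult_pos)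
qed

lemma neg_ln_axis_tau_nonneg: "0 \<le> - ln (axis_tau d p n)"
  using axis_tau_le_1 axis_tau_pos by (simp add: ln_le_zero_iff)

lemmas axis_tau_fekete = fekete[of "\<lambda>n. - ln (axis_tau d p n)",
  OF neg_ln_axis_tau_subadd neg_ln_axis_tau_nonneg, folded decay_rate_def]

lemma axis_tau_limit: "(\<lambda>n. - ln (axis_tau d p n) / real n) \<longlonglongrightarrow> r"
  by (rule axis_tau_fekete(1))

lemma axis_tau_le: "axis_tau d p n \<le> exp (- r * real n)"
proof -
  have "ln (axis_tau d p n) \<le> - r * real n" using axis_tau_fekete(2)[of n] by simp
  then have "exp (ln (axis_tau d p n)) \<le> exp (- r * real n)" by simp
  then show ?thesis using axis_tau_pos by simp
qed

lemma rate_nonneg: "0 \<le> r"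
  by (rule axis_tau_fekete(3))

lemma tau_le_exp_coord:
  assumes "y \<in> lattice d" "i < d"
  shows "tau d p org y \<le> exp (- r * real_of_int \<bar>y i\<bar>)"
proof -
  have "(tau d p org y)\<^sup>2 \<le> exp (- r * real (2 * nat \<bar>y i\<bar>))"
    using tau_square_le[OF p01 assms] axis_tau_le order_trans by blast
  also have "\<dots> = (exp (- r * real_of_int \<bar>y i\<bar>))\<^sup>2"
    by (simp add: power2_eq_square exp_add[symmetric])
  finally show ?thesis by (rule power2_le_imp_le) simp
qed

text \<open>\<open>tau\<close> decays at rate \<open>r\<close> in the largest coordinate, which
  dominates every weighted sum of the \<open>\<bar>y i\<bar>\<close> with total weight at most one.
  Weight \<open>1 - \<epsilon>\<close> on the first coordinate gives up little of the rate, and the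
  small weights on the others make sums over hyperplanes converge.\<close>

lemma tau_le_prod:
  assumes "y \<in> lattice d" "0 < \<epsilon>" "\<epsilon> \<le> 1"
  shows "tau d p org y \<le> (\<Prod>i<d. exp (- r * (if i = 0 then 1 - \<epsilon> else \<epsilon> / real d) * real_of_int \<bar>y i\<bar>))"
proof -
  define w where "w i = (if (i::nat) = 0 then 1 - \<epsilon> else \<epsilon> / real d)" for i
  have w0: "0 \<le> w i" for i using assms by (simp add: w_def)
  have "(\<Sum>i<d. w i) = 1 - \<epsilon> + (\<Sum>i\<in>{..<d} - {0}. w i)"
    using d_pos by (subst sum.remove[of _ 0]) (auto simp: w_def)
  also have "(\<Sum>i\<in>{..<d} - {0}. w i) = (real d - 1) * (\<epsilon> / real d)"
    using d_pos by (simp add: w_def of_nat_diff)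
  also have "1 - \<epsilon> + (real d - 1) * (\<epsilon> / real d) \<le> 1"
    using d_pos assms by (simp add: field_simps)
  finally have w1: "(\<Sum>i<d. w i) \<le> 1" .
  have "Max ((\<lambda>i. \<bar>y i\<bar>) ` {..<d}) \<in> (\<lambda>i. \<bar>y i\<bar>) ` {..<d}"
    using d_pos by (intro Max_in) auto
  then obtain j where j: "j < d" "\<bar>y j\<bar> = Max ((\<lambda>i. \<bar>y i\<bar>) ` {..<d})" by auto
  have "\<bar>y i\<bar> \<le> \<bar>y j\<bar>" if "i < d" for i
    unfolding j(2) by (rule Max_ge) (use that in auto)
  then have max: "real_of_int \<bar>y i\<bar> \<le> real_of_int \<bar>y j\<bar>" if "i < d" for i
    unfolding of_int_le_iff using that by blast
  have "(\<Sum>i<d. w i * real_of_int \<bar>y i\<bar>) \<le> (\<Sum>i<d. w i * real_of_int \<bar>y j\<bar>)"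
    by (intro sum_mono mult_left_mono max w0) auto
  also have "\<dots> \<le> real_of_int \<bar>y j\<bar>"
    unfolding sum_distrib_right[symmetric] using w1 by (intro mult_left_le_one_le sum_nonneg w0) auto
  finally have "r * (\<Sum>i<d. w i * real_of_int \<bar>y i\<bar>) \<le> r * real_of_int \<bar>y j\<bar>"
    using rate_nonneg by (rule mult_left_mono)
  then have "exp (- r * real_of_int \<bar>y j\<bar>) \<le> exp (- (r * (\<Sum>i<d. w i * real_of_int \<bar>y i\<bar>)))" by simp
  also have "- (r * (\<Sum>i<d. w i * real_of_int \<bar>y i\<bar>)) = (\<Sum>i<d. - r * w i * real_of_int \<bar>y i\<bar>)"
    by (simp add: sum_distrib_left sum_negf mult.assoc)
  finally show ?thesis
    using tau_le_exp_coord[OF assms(1) j(1)] by (simp add: exp_sum w_def)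
qed

section \<open>Hyperplane sums and slab crossings\<close>

definition G :: "nat \<Rightarrow> real" where
  "G n = (SUP Y\<in>{Y. finite Y \<and> Y \<subseteq> level d (int n)}. \<Sum>y\<in>Y. tau d p org y)"

definition slab :: "nat \<Rightarrow> (nat \<Rightarrow> int) set set" where
  "slab n = edges d \<inter> {e. (\<lambda>v. v 0) ` e \<subseteq> {0..int n}}"

text \<open>The mediator between \<open>G\<close> and \<open>cross\<close>: it dominates
  \<open>G\<close> up to a constant factor (\<open>G_le_H\<close>), and its square is controlled
  through \<open>cross\<close> (\<open>H_square_le\<close>).\<close>

definition H :: "nat \<Rightarrow> real" where
  "H n = (SUP Y\<in>{Y. finite Y \<and> Y \<subseteq> level d (int n)}. \<Sum>y\<in>Y. lprob p (slab n) (\<lambda>S. conn S org y))"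

definition cross :: "nat \<Rightarrow> real" where
  "cross n = lprob p (slab n) (\<lambda>S. \<exists>y\<in>level d (int n). conn S org y)"

lemma slab_edges: "slab n \<subseteq> edges d" by (simp add: slab_def)

lemma slab_coord:
  assumes "F \<subseteq> slab n" "x 0 \<in> {0..int n}" "w \<in> insert x (\<Union>F)"
  shows "w 0 \<in> {0..int n}"
proof (cases "w = x")
  case False
  then obtain e where e: "e \<in> F" "w \<in> e" using assms(3) by auto
  then have "(\<lambda>v. v 0) ` e \<subseteq> {0..int n}" using assms(1) by (auto simp: slab_def)
  then show ?thesis using e(2) by blast
qed (use assms in simp)

lemma lprob_slab_shift:
  assumes "u \<in> level d 0" "\<And>S. A S \<Longrightarrow> B ((`) (shift d (\<lambda>i. - u i)) ` S)"
  shows "lprob p (slab n) A \<le> lprob p (slab n) B"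
proof (rule lprob_image[OF p01 shift_inj[OF slab_edges]])
  let ?g = "shift d (\<lambda>i. - u i)"
  have "?g v 0 = v 0" for v using assms(1) d_pos by (simp add: shift_apply level_def)
  then show "(`) ?g ` slab n \<subseteq> slab n"
    by (auto simp: slab_def image_image shift_edges)
qed (rule assms(2))

lemma tau_through_level:
  assumes "finite F" "F \<subseteq> edges d" "x 0 \<le> k" "k \<le> y 0"
  shows "bprob F p (\<lambda>S. conn S x y) \<le> (\<Sum>w\<in>{w \<in> insert x (\<Union>F). w 0 = k}. tau d p x w * tau d p w y)"
proof -
  let ?W = "{w \<in> insert x (\<Union>F). w 0 = k}"
  have finW: "finite ?W"
    by (rule finite_subset[of _ "insert x (\<Union>F)"]) (use finite_Union_edges[OF assms(1,2)] in auto)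
  have "bprob F p (\<lambda>S. conn S x y) \<le> bprob F p (\<lambda>S. \<exists>w\<in>?W. disj_occ (\<lambda>S. conn S x w) (\<lambda>S. conn S w y) S)"
  proof (rule bprob_mono[OF p01])
    fix S assume S: "S \<subseteq> F" "conn S x y"
    obtain w where w: "w 0 = k" "disj_occ (\<lambda>S. conn S x w) (\<lambda>S. conn S w y) S"
      using conn_through_level[OF S(2), of "\<lambda>v. v 0" k] assms S(1) edges_coord[OF _ d_pos] by blast
    then have "conn S x w" by (auto simp: disj_occ_def intro: conn_mono)
    then have "w \<in> insert x (\<Union>F)" using conn_mem[of S x w] S(1) by auto
    with w show "\<exists>w\<in>?W. disj_occ (\<lambda>S. conn S x w) (\<lambda>S. conn S w y) S" by blast
  qed
  also have "\<dots> \<le> (\<Sum>w\<in>?W. bprob F p (disj_occ (\<lambda>S. conn S x w) (\<lambda>S. conn S w y)))"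
    by (rule bprob_Bex[OF p01 finW])
  also have "\<dots> \<le> (\<Sum>w\<in>?W. bprob F p (\<lambda>S. conn S x w) * bprob F p (\<lambda>S. conn S w y))"
    by (intro sum_mono bk[OF p01 assms(1)]) auto
  also have "\<dots> \<le> (\<Sum>w\<in>?W. tau d p x w * tau d p w y)"
    by (intro sum_mono mult_mono tau_ge p01 assms bprob_nonneg tau_nonneg)
  finally show ?thesis .
qed

text \<open>The tree-graph inequality of Aizenman and Newman, with \<open>w\<close> the branching
  vertex of \<open>conn_tree\<close> and BK applied to its three arms.\<close>

lemma tau_tree:
  assumes "finite F" "F \<subseteq> edges d"
  shows "bprob F p (\<lambda>S. conn S x y \<and> conn S x z)
    \<le> (\<Sum>w\<in>insert x (\<Union>F). tau d p x w * tau d p w y * tau d p w z)"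
proof -
  let ?W = "insert x (\<Union>F)"
  let ?D = "\<lambda>w. disj_occ (\<lambda>S. conn S x w) (disj_occ (\<lambda>S. conn S w y) (\<lambda>S. conn S w z))"
  have finW: "finite ?W" using finite_Union_edges[OF assms] by simp
  have "bprob F p (\<lambda>S. conn S x y \<and> conn S x z) \<le> bprob F p (\<lambda>S. \<exists>w\<in>?W. ?D w S)"
  proof (rule bprob_mono[OF p01])
    fix S assume S: "S \<subseteq> F" "conn S x y \<and> conn S x z"
    then obtain w where "w = x \<or> w \<in> \<Union>S" "?D w S" using conn_tree[of S x y z] by blast
    then show "\<exists>w\<in>?W. ?D w S" using S(1) by blast
  qed
  also have "\<dots> \<le> (\<Sum>w\<in>?W. bprob F p (?D w))"
    by (rule bprob_Bex[OF p01 finW])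
  also have "\<dots> \<le> (\<Sum>w\<in>?W. bprob F p (\<lambda>S. conn S x w) * bprob F p (\<lambda>S. conn S w y) * bprob F p (\<lambda>S. conn S w z))"
    by (intro sum_mono bk3[OF p01 assms(1)]) auto
  also have "\<dots> \<le> (\<Sum>w\<in>?W. tau d p x w * tau d p w y * tau d p w z)"
    by (intro sum_mono mult_mono tau_ge p01 assms bprob_nonneg tau_nonneg mult_nonneg_nonneg)
  finally show ?thesis .
qed

lemma bprob_Int:
  assumes "finite F"
  shows "bprob F p (\<lambda>S. A (S \<inter> X)) = bprob (F \<inter> X) p A"
proof -
  have "S \<inter> X = S \<inter> (F \<inter> X)" if "S \<subseteq> F" for S using that by auto
  then have "bprob F p (\<lambda>S. A (S \<inter> X)) = bprob F p (\<lambda>S. A (S \<inter> (F \<inter> X)))"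
    by (intro bprob_cong) metis
  also have "\<dots> = bprob (F \<inter> X) p A"
    unfolding bprob_def using bexp_restrict[of F "F \<inter> X" p "\<lambda>S. of_bool (A S)"] assms by auto
  finally show ?thesis .
qed

lemma tau_through_slab:
  assumes "finite F" "F \<subseteq> edges d" "y \<in> level d (int n)"
  shows "bprob F p (\<lambda>S. conn S org y) \<le>
    (\<Sum>u\<in>insert org (\<Union>F) \<inter> level d 0. \<Sum>v\<in>insert org (\<Union>F) \<inter> level d (int n).
      tau d p org u * lprob p (slab n) (\<lambda>S. conn S u v) * tau d p v y)"
proof -
  let ?V = "insert org (\<Union>F)"
  let ?X = "{e. (\<lambda>v. v 0) ` e \<subseteq> {0..int n}}"
  let ?D = "\<lambda>u v. disj_occ (\<lambda>S. conn S org u) (disj_occ (\<lambda>S. conn (S \<inter> ?X) u v) (\<lambda>S. conn S v y))"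
  have fin: "finite ?V" using finite_Union_edges[OF assms(1,2)] by simp
  have V: "?V \<subseteq> lattice d" using assms(2) edges_lattice by auto
  have "bprob F p (\<lambda>S. conn S org y) \<le> bprob F p (\<lambda>S. \<exists>u\<in>?V \<inter> level d 0. \<exists>v\<in>?V \<inter> level d (int n). ?D u v S)"
  proof (rule bprob_mono[OF p01])
    fix S assume S: "S \<subseteq> F" "conn S org y"
    have step: "\<bar>u 0 - v 0\<bar> \<le> 1" if "{u, v} \<in> S" for u v
      using that S(1) assms(2) edges_coord[OF _ d_pos] by blast
    have "org 0 = 0" using d_pos by (simp add: origin_apply)
    moreover have "y 0 = int n" using assms(3) by (simp add: level_def)
    ultimately obtain u v where uv: "u 0 = 0" "v 0 = int n" "?D u v S"
      using conn_through_slab[OF S(2), of "\<lambda>v. v 0" "int n"] step by auto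
    then have "conn S org u" "conn S org v"
      unfolding disj_occ_def by (meson conn_mono conn_trans inf_le1 subset_trans)+
    then have "u \<in> ?V" "v \<in> ?V" using conn_mem[of S org] S(1) by auto
    then show "\<exists>u\<in>?V \<inter> level d 0. \<exists>v\<in>?V \<inter> level d (int n). ?D u v S"
      using uv V unfolding level_def by blast
  qed
  also have "\<dots> \<le> (\<Sum>u\<in>?V \<inter> level d 0. bprob F p (\<lambda>S. \<exists>v\<in>?V \<inter> level d (int n). ?D u v S))"
    by (rule bprob_Bex[OF p01]) (use fin in auto)
  also have "\<dots> \<le> (\<Sum>u\<in>?V \<inter> level d 0. \<Sum>v\<in>?V \<inter> level d (int n). bprob F p (?D u v))"
    by (intro sum_mono bprob_Bex[OF p01]) (use fin in auto)
  also have "\<dots> \<le> (\<Sum>u\<in>?V \<inter> level d 0. \<Sum>v\<in>?V \<inter> level d (int n).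
      bprob F p (\<lambda>S. conn S org u) * bprob F p (\<lambda>S. conn (S \<inter> ?X) u v) * bprob F p (\<lambda>S. conn S v y))"
    by (intro sum_mono bk3[OF p01 assms(1)]) auto
  also have "\<dots> \<le> (\<Sum>u\<in>?V \<inter> level d 0. \<Sum>v\<in>?V \<inter> level d (int n).
      tau d p org u * lprob p (slab n) (\<lambda>S. conn S u v) * tau d p v y)"
  proof (intro sum_mono mult_mono tau_ge p01 assms bprob_nonneg tau_nonneg mult_nonneg_nonneg lprob_nonneg)
    fix u v
    have "bprob F p (\<lambda>S. conn (S \<inter> ?X) u v) = bprob (F \<inter> ?X) p (\<lambda>S. conn S u v)"
      by (rule bprob_Int[OF assms(1)])
    also have "\<dots> \<le> lprob p (slab n) (\<lambda>S. conn S u v)"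
      by (rule lprob_ge[OF p01]) (use assms in \<open>auto simp: slab_def\<close>)
    finally show "bprob F p (\<lambda>S. conn (S \<inter> ?X) u v) \<le> lprob p (slab n) (\<lambda>S. conn S u v)" .
  qed
  finally show ?thesis .
qed

text \<open>Reveal the edges of the slab up to level \<open>n\<close> and pick one vertex \<open>z\<close> of that level reached from the
  origin. The bridging edge from \<open>z\<close> to level \<open>n + 1\<close> and the translated slab beyond it are then
  still fresh.\<close>

lemma cross_supermult: "p * (cross n * cross m) \<le> cross (n + m + 1)"
proof -
  have "cross n * cross m \<le> cross (n + m + 1) / p"
    unfolding cross_def[of n] cross_def[of m]
  proof (rule lprob_mult_le[OF p01])
    fix F F' assume F: "finite F" "F \<subseteq> slab n" and F': "finite F'" "F' \<subseteq> slab m"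
    define Z where "Z = insert org (\<Union>F) \<inter> level d (int n)"
    \<comment> \<open>A unit step in the first coordinate. The second slab cannot start at level
      \<open>n\<close> itself, since the edges inside that level are already explored; the step
      costs the factor \<open>p\<close> and the extra 1 in \<open>n + m + 1\<close>.\<close>
    define t where "t z = shift d (axis_point d 1) z" for z
    define g where "g z = shift d (t z)" for z
    define E2 where "E2 z = insert {z, t z} ((`) (g z) ` F')" for z
    define E where "E = F \<union> (\<Union>z\<in>Z. E2 z)"
    define A where "A k x S \<longleftrightarrow> (\<exists>y\<in>level d (int k). conn S x y)" for k x S
    \<comment> \<open>Selecting a single vertex makes the events \<open>B z\<close> mutually
      exclusive, so their probabilities add up exactly to that of the first crossing.\<close>
    define hit where "hit S = (SOME z. z \<in> Z \<and> conn S org z)" for S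
    define B where "B z S \<longleftrightarrow> z \<in> Z \<and> conn S org z \<and> hit S = z" for z S
    have Fe: "F \<subseteq> edges d" "F' \<subseteq> edges d" using F F' slab_edges by auto
    have finZ: "finite Z" unfolding Z_def using finite_Union_edges[OF F(1) Fe(1)] by simp
    have finE2: "finite (E2 z)" for z unfolding E2_def using F' by simp
    have finE: "finite E" unfolding E_def using F finZ finE2 by simp
    have Zl: "z \<in> lattice d" "z 0 = int n" if "z \<in> Z" for z
      using that by (auto simp: Z_def level_def)
    have t0: "t z 0 = int n + 1" if "z \<in> Z" for z
      using Zl[OF that] d_pos by (simp add: t_def shift_apply axis_point_def)
    have edge: "{z, t z} \<in> edges d" if "z \<in> Z" for z
    proof -
      have "(\<Sum>i<d. \<bar>z i - t z i\<bar>) = (\<Sum>i<d. if i = 0 then 1 else 0)"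
        by (rule sum.cong) (auto simp: t_def shift_apply axis_point_def)
      also have "\<dots> = 1" using d_pos by simp
      finally show ?thesis using Zl[OF that] by (simp add: edges_iff t_def)
    qed
    have E2_slab: "E2 z \<subseteq> slab (n + m + 1)" if z: "z \<in> Z" for z
    proof -
      have "g z ` e \<in> edges d" if "e \<in> F'" for e
        unfolding g_def using that Fe by (auto intro: shift_edges)
      moreover have "g z v 0 \<in> {0..int (n + m + 1)}" if "e \<in> F'" "v \<in> e" for e v
        using F' that t0[OF z] d_pos by (force simp: slab_def g_def shift_apply)
      ultimately show ?thesis
        using edge[OF z] t0[OF z] Zl[OF z] by (auto simp: E2_def slab_def)
    qed
    \<comment> \<open>Every edge of \<open>E2 z\<close> has an endpoint to the right of level
      \<open>n\<close>, and no edge of \<open>F\<close> does.\<close>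
    have disj: "F \<inter> E2 z = {}" if z: "z \<in> Z" for z
    proof -
      have *: "\<exists>v\<in>e. int n < v 0" if e: "e \<in> E2 z" for e
      proof (cases "e = {z, t z}")
        case False
        then obtain e' where e': "e' \<in> F'" "e = g z ` e'" using e by (auto simp: E2_def)
        then obtain v where v: "v \<in> e'" using Fe(2) empty_notin_edges by (metis all_not_in_conv subsetD)
        then have "0 \<le> v 0" using F' e' by (force simp: slab_def)
        then have "int n < g z v 0" using t0[OF z] d_pos by (simp add: g_def shift_apply)
        then show ?thesis using e' v by auto
      qed (use t0[OF z] in auto)
      have "\<not> int n < v 0" if "e \<in> F" "v \<in> e" for e v
        using F that by (force simp: slab_def)
      then show ?thesis using * by blast
    qed
    have Eslab: "E \<subseteq> slab (n + m + 1)"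
    proof -
      have "slab n \<subseteq> slab (n + m + 1)"
        unfolding slab_def by (intro Int_mono Collect_mono subset_refl impI) (erule order_trans, simp)
      then show ?thesis using F(2) E2_slab unfolding E_def by blast
    qed
    have A_eq: "bprob F p (A n org) = (\<Sum>z\<in>Z. bprob F p (B z))"
      unfolding bprob_def bexp_sum[symmetric]
    proof (rule bexp_cong)
      fix S assume S: "S \<subseteq> F"
      have AZ: "A n org S \<longleftrightarrow> (\<exists>z\<in>Z. conn S org z)"
        using conn_mem[of S org] S unfolding A_def Z_def by blast
      show "of_bool (A n org S) = (\<Sum>z\<in>Z. of_bool (B z S) :: real)"
      proof (cases "A n org S")
        case True
        then have h: "hit S \<in> Z \<and> conn S org (hit S)"
          unfolding AZ hit_def by (metis (mono_tags, lifting) someI)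
        have "(\<Sum>z\<in>Z. of_bool (B z S) :: real) = (\<Sum>z\<in>Z. if z = hit S then 1 else 0)"
          by (rule sum.cong) (use h in \<open>auto simp: B_def\<close>)
        then show ?thesis using True h finZ by simp
      next
        case False
        then show ?thesis using AZ by (auto simp: B_def)
      qed
    qed
    have A2: "p * bprob F' p (A m org) \<le> bprob (E2 z) p (\<lambda>S. {z, t z} \<in> S \<and> A (n + m + 1) (t z) S)" if z: "z \<in> Z" for z
    proof -
      have inj: "inj_on ((`) (g z)) F'" unfolding g_def by (rule shift_inj[OF Fe(2)])
      have "bprob F' p (A m org) \<le> bprob F' p (\<lambda>S. A (n + m + 1) (t z) ((`) (g z) ` S))"
      proof (rule bprob_mono[OF p01])
        fix S assume "A m org S"
        then obtain y where y: "y \<in> level d (int m)" "conn S org y" by (auto simp: A_def)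
        have "t z \<in> lattice d" by (simp add: t_def)
        then have "g z org = t z" by (simp add: g_def)
        moreover have "g z y \<in> level d (int (n + m + 1))"
          using y t0[OF z] d_pos by (simp add: level_def g_def shift_apply)
        ultimately show "A (n + m + 1) (t z) ((`) (g z) ` S)"
          using conn_image[OF y(2), of "g z"] unfolding A_def by auto
      qed
      also have "\<dots> = bprob ((`) (g z) ` F') p (A (n + m + 1) (t z))"
        unfolding bprob_def by (rule bexp_image[OF F'(1) inj, symmetric])
      also have "\<dots> \<le> bprob (E2 z) p (A (n + m + 1) (t z))"
        unfolding A_def by (rule bprob_mono_set[OF p01 finE2]) (auto simp: E2_def)
      finally have 1: "bprob F' p (A m org) \<le> bprob (E2 z) p (A (n + m + 1) (t z))" .
      have "bprob {{z, t z}} p (\<lambda>S. {z, t z} \<in> S) \<le> bprob (E2 z) p (\<lambda>S. {z, t z} \<in> S)"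
        by (rule bprob_mono_set[OF p01 finE2]) (auto simp: E2_def)
      then have "p \<le> bprob (E2 z) p (\<lambda>S. {z, t z} \<in> S)" by (simp add: bprob_edge)
      then have "p * bprob F' p (A m org) \<le> bprob (E2 z) p (\<lambda>S. {z, t z} \<in> S) * bprob (E2 z) p (A (n + m + 1) (t z))"
        using 1 p01 by (intro mult_mono bprob_nonneg) auto
      also have "\<dots> \<le> bprob (E2 z) p (\<lambda>S. {z, t z} \<in> S \<and> A (n + m + 1) (t z) S)"
        unfolding A_def by (rule bprob_harris[OF p01 finE2]) auto
      finally show ?thesis .
    qed
    have "bprob F p (A n org) * (p * bprob F' p (A m org)) = (\<Sum>z\<in>Z. bprob F p (B z) * (p * bprob F' p (A m org)))"
      by (simp add: A_eq sum_distrib_right)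
    also have "\<dots> \<le> (\<Sum>z\<in>Z. bprob F p (B z) * bprob (E2 z) p (\<lambda>S. {z, t z} \<in> S \<and> A (n + m + 1) (t z) S))"
      using A2 by (intro sum_mono mult_left_mono bprob_nonneg p01) auto
    also have "\<dots> = (\<Sum>z\<in>Z. bexp E p (\<lambda>S. of_bool (B z (S \<inter> F))
        * of_bool ({z, t z} \<in> S \<inter> E2 z \<and> A (n + m + 1) (t z) (S \<inter> E2 z))))"
      unfolding bprob_def
      by (intro sum.cong refl bexp_indep[symmetric] finE disj) (auto simp: E_def)
    also have "\<dots> \<le> bprob E p (A (n + m + 1) org)"
      unfolding bexp_sum[symmetric] bprob_def
    proof (rule bexp_mono[OF p01])
      fix S assume S: "S \<subseteq> E"
      let ?f = "\<lambda>z. of_bool (B z (S \<inter> F)) * of_bool ({z, t z} \<in> S \<inter> E2 z \<and> A (n + m + 1) (t z) (S \<inter> E2 z)) :: real"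
      show "(\<Sum>z\<in>Z. ?f z) \<le> of_bool (A (n + m + 1) org S)"
      proof (cases "\<exists>z\<in>Z. ?f z \<noteq> 0")
        case True
        then obtain z where z: "z \<in> Z" "B z (S \<inter> F)" "{z, t z} \<in> S \<inter> E2 z" "A (n + m + 1) (t z) (S \<inter> E2 z)"
          by (auto split: if_splits)
        obtain y where y: "y \<in> level d (int (n + m + 1))" "conn (S \<inter> E2 z) (t z) y"
          using z(4) by (auto simp: A_def)
        have "conn S org z" using z(2) by (auto simp: B_def intro: conn_mono)
        moreover have "conn S z (t z)" using z(3) by (auto intro: conn_edge)
        moreover have "conn S (t z) y" by (rule conn_mono[OF y(2)]) auto
        ultimately have "A (n + m + 1) org S" using y(1) conn_trans unfolding A_def by metis
        moreover have "(\<Sum>z\<in>Z. ?f z) \<le> (\<Sum>z\<in>Z. if z = hit (S \<inter> F) then 1 else 0)"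
          by (intro sum_mono) (auto simp: B_def)
        ultimately show ?thesis using finZ by (auto split: if_splits)
      next
        case False
        then have "(\<Sum>z\<in>Z. ?f z) = 0" by (intro sum.neutral) blast
        then show ?thesis by simp
      qed
    qed
    also have "\<dots> \<le> cross (n + m + 1)"
      unfolding cross_def A_def by (rule lprob_ge[OF p01 finE Eslab])
    finally show "bprob F p (\<lambda>S. \<exists>y\<in>level d (int n). conn S org y) * bprob F' p (\<lambda>S. \<exists>y\<in>level d (int m). conn S org y)
        \<le> cross (n + m + 1) / p"
      using p_pos by (simp add: A_def[abs_def] field_simps)
  qed
  then show ?thesis using p_pos by (simp add: field_simps)
qed

end

text \<open>Powers of a ratio above 1 outgrow any \<open>K\<close>; taking \<open>k\<close>-th roots
  thus removes a constant factor that is uniform in \<open>k\<close>.\<close>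

lemma power_le_imp_le_const:
  fixes x y K :: real
  assumes "0 \<le> x" "0 < y" "\<And>k. 1 \<le> k \<Longrightarrow> x ^ k \<le> K * y ^ k"
  shows "x \<le> y"
proof (rule ccontr)
  assume "\<not> x \<le> y"
  then have "1 < x / y" using assms by (simp add: field_simps)
  then obtain k where k: "max K 1 < (x / y) ^ k" using real_arch_pow by blast
  then have "1 \<le> k" by (cases k) auto
  have "(x / y) ^ k \<le> K"
    using assms(3)[OF \<open>1 \<le> k\<close>] assms(2) by (simp add: power_divide field_simps)
  with k show False by simp
qed

lemma sum_geometric_abs_le:
  fixes q :: real
  assumes "0 \<le> q" "q < 1"
  shows "(\<Sum>k\<in>{- int L..int L}. q ^ nat \<bar>k\<bar>) \<le> 2 / (1 - q)"
proof -
  have geo: "(\<Sum>k<n. q ^ k) \<le> 1 / (1 - q)" for n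
    using assms by (simp add: sum_gp_strict divide_right_mono)
  have "{- int L..int L} \<subseteq> int ` {..<Suc L} \<union> (\<lambda>k. - int k) ` {..<Suc L}"
  proof
    fix k assume "k \<in> {- int L..int L}"
    then have "k = int (nat k) \<and> nat k < Suc L \<or> k = - int (nat (- k)) \<and> nat (- k) < Suc L"
      by (cases "0 \<le> k") auto
    then show "k \<in> int ` {..<Suc L} \<union> (\<lambda>k. - int k) ` {..<Suc L}" by blast
  qed
  then have "(\<Sum>k\<in>{- int L..int L}. q ^ nat \<bar>k\<bar>)
      \<le> (\<Sum>k\<in>int ` {..<Suc L} \<union> (\<lambda>k. - int k) ` {..<Suc L}. q ^ nat \<bar>k\<bar>)"
    using assms by (intro sum_mono2) auto
  also have "\<dots> \<le> (\<Sum>k\<in>int ` {..<Suc L}. q ^ nat \<bar>k\<bar>) + (\<Sum>k\<in>(\<lambda>k. - int k) ` {..<Suc L}. q ^ nat \<bar>k\<bar>)"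
    using assms by (subst sum_Un) (auto intro!: sum_nonneg)
  also have "\<dots> = (\<Sum>k<Suc L. q ^ k) + (\<Sum>k<Suc L. q ^ k)"
    by (simp add: sum.reindex inj_on_def del: sum.lessThan_Suc)
  also have "\<dots> \<le> 1 / (1 - q) + 1 / (1 - q)" by (intro add_mono geo)
  finally show ?thesis by simp
qed

lemma finite_lattice_bound:
  fixes d :: nat
  assumes "finite Y"
  obtains L where "\<And>y i. y \<in> Y \<Longrightarrow> i < d \<Longrightarrow> (y i :: int) \<in> {- int L..int L}"
proof -
  let ?B = "(\<lambda>(y, i). nat \<bar>y i\<bar>) ` (Y \<times> {..<d})"
  have "nat \<bar>y i\<bar> \<le> Max (insert 0 ?B)" if "y \<in> Y" "i < d" for y i
    by (rule Max_ge) (use assms that in \<open>auto intro!: finite_imageI\<close>)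
  then have "y i \<in> {- int (Max (insert 0 ?B))..int (Max (insert 0 ?B))}" if "y \<in> Y" "i < d" for y i
    using that by (force simp: abs_le_iff nat_le_iff)
  then show thesis using that by blast
qed

text \<open>\<open>rate_pos\<close> is what makes the suprema in \<open>G\<close> and
  \<open>H\<close> finite here; \<open>subcritical_decay\<close> derives it below
  \<open>critical_prob\<close>.\<close>

locale perc_decay = perc +
  assumes rate_pos: "0 < decay_rate d p"
begin

section \<open>Summability over hyperplanes and submultiplicativity of \<open>G\<close>\<close>

definition level_const :: "real \<Rightarrow> real" where
  "level_const \<epsilon> = (2 / (1 - exp (- r * \<epsilon> / real d))) ^ d"

lemma q_less_1: "0 < \<epsilon> \<Longrightarrow> exp (- r * \<epsilon> / real d) < 1"
  using rate_pos d_pos by simp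

lemma level_const_pos: "0 < \<epsilon> \<Longrightarrow> 0 < level_const \<epsilon>"
  unfolding level_const_def using q_less_1 by simp

text \<open>Enclose \<open>Y\<close> in a box. The product bound for \<open>tau\<close> factors over
  the coordinates of the box into geometric series of ratio
  \<open>exp (- r * \<epsilon> / real d)\<close>, bounded uniformly in its size;
  \<open>level_const\<close> has one factor to spare, which is at least 1.\<close>

lemma level_sum_bound:
  assumes "0 < \<epsilon>" "\<epsilon> \<le> 1" "finite Y" "Y \<subseteq> level d (int n)"
  shows "(\<Sum>y\<in>Y. tau d p org y) \<le> level_const \<epsilon> * exp (- r * (1 - \<epsilon>) * real n)"
proof -
  let ?q = "exp (- r * \<epsilon> / real d)"
  let ?C = "exp (- r * (1 - \<epsilon>) * real n)"
  have q: "0 \<le> ?q" "?q < 1" using q_less_1[OF assms(1)] by auto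
  obtain L where L: "\<And>y i. y \<in> Y \<Longrightarrow> i < d \<Longrightarrow> y i \<in> {- int L..int L}"
    using finite_lattice_bound[OF assms(3)] by blast
  define B where "B i = (if i = 0 then {int n} else {- int L..int L})" for i :: nat
  define \<phi> where "\<phi> i k = exp (- r * (if i = 0 then 1 - \<epsilon> else \<epsilon> / real d) * real_of_int \<bar>k\<bar>)" for i :: nat and k :: int
  have "Y \<subseteq> PiE {..<d} B"
  proof
    fix y assume y: "y \<in> Y"
    then have "y \<in> lattice d" "y 0 = int n" using assms(4) by (auto simp: level_def)
    then show "y \<in> PiE {..<d} B"
      using L[OF y] by (auto simp: lattice_def PiE_iff B_def)
  qed
  moreover have fin: "finite (PiE {..<d} B)" by (intro finite_PiE) (auto simp: B_def)
  moreover have tau_le: "tau d p org y \<le> (\<Prod>i<d. \<phi> i (y i))" if "y \<in> Y" for y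
    using tau_le_prod[OF _ assms(1,2), of y] that assms(4) by (auto simp: \<phi>_def level_def)
  ultimately have "(\<Sum>y\<in>Y. tau d p org y) \<le> (\<Sum>y\<in>PiE {..<d} B. \<Prod>i<d. \<phi> i (y i))"
    by (intro order_trans[OF sum_mono[of Y] sum_mono2]) (auto intro!: prod_nonneg simp: \<phi>_def)
  also have "\<dots> = (\<Prod>i<d. \<Sum>k\<in>B i. \<phi> i k)"
    by (rule prod_sum_PiE[symmetric]) (auto simp: B_def)
  also have "\<dots> = ?C * (\<Prod>i\<in>{..<d} - {0}. \<Sum>k\<in>B i. \<phi> i k)"
    using d_pos by (subst prod.remove[of _ 0]) (auto simp: B_def \<phi>_def)
  also have "\<dots> \<le> ?C * (\<Prod>i\<in>{..<d} - {0}. 2 / (1 - ?q))"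
  proof (intro mult_left_mono prod_mono conjI)
    fix i assume i: "i \<in> {..<d} - {0}"
    have "(\<Sum>k\<in>B i. \<phi> i k) = (\<Sum>k\<in>{- int L..int L}. ?q ^ nat \<bar>k\<bar>)"
    proof (rule sum.cong)
      fix k
      have "?q ^ nat \<bar>k\<bar> = exp (real (nat \<bar>k\<bar>) * (- r * \<epsilon> / real d))" by (rule exp_of_nat_mult[symmetric])
      then show "\<phi> i k = ?q ^ nat \<bar>k\<bar>" using i by (simp add: \<phi>_def mult.commute)
    qed (use i in \<open>auto simp: B_def\<close>)
    then show "(\<Sum>k\<in>B i. \<phi> i k) \<le> 2 / (1 - ?q)" using sum_geometric_abs_le[OF q] by simp
  qed (auto simp: \<phi>_def intro!: sum_nonneg)
  also have "(\<Prod>i\<in>{..<d} - {0}. 2 / (1 - ?q)) \<le> level_const \<epsilon>"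
  proof -
    have "2 / (1 - ?q) \<ge> 1" using q using exp_gt_zero[of "- r * \<epsilon> / real d"] by (simp only: le_divide_eq_1) linarith
    then show ?thesis unfolding level_const_def using d_pos by (simp only: prod_constant) (intro power_increasing, auto)
  qed
  finally show ?thesis by (simp add: mult.commute)
qed

lemma G_bdd: "bdd_above ((\<lambda>Y. \<Sum>y\<in>Y. tau d p org y) ` {Y. finite Y \<and> Y \<subseteq> level d (int n)})"
  using level_sum_bound[of "1/2"] by (intro bdd_aboveI2) auto

lemma le_G: "finite Y \<Longrightarrow> Y \<subseteq> level d (int n) \<Longrightarrow> (\<Sum>y\<in>Y. tau d p org y) \<le> G n"
  unfolding G_def by (rule cSUP_upper[OF _ G_bdd]) auto

lemma G_le: "(\<And>Y. finite Y \<Longrightarrow> Y \<subseteq> level d (int n) \<Longrightarrow> (\<Sum>y\<in>Y. tau d p org y) \<le> c) \<Longrightarrow> G n \<le> c"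
  unfolding G_def by (rule cSUP_least) auto

lemma G_bound: "0 < \<epsilon> \<Longrightarrow> \<epsilon> \<le> 1 \<Longrightarrow> G n \<le> level_const \<epsilon> * exp (- r * (1 - \<epsilon>) * real n)"
  by (rule G_le) (rule level_sum_bound)

lemma axis_tau_le_G: "axis_tau d p n \<le> G n"
proof -
  have "axis_point d n \<in> level d (int n)"
    using axis_point_lattice[of d n] d_pos by (simp add: level_def) (simp add: axis_point_def)
  then show ?thesis using le_G[of "{axis_point d n}" n] by (simp add: axis_tau_def)
qed

lemma G_pos: "0 < G n"
  using axis_tau_le_G axis_tau_pos by (rule less_le_trans[rotated])

text \<open>Translate \<open>w\<close> to the origin, swap the coordinates 0 and \<open>i\<close>,
  and reflect if the hyperplane lies on the negative side. General \<open>i\<close> is needed for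
  the lateral sides of the tube in \<open>cross_le_tube_cross\<close>.\<close>

lemma sum_tau_le_G:
  assumes "w \<in> lattice d" "i < d" "finite Y" "Y \<subseteq> lattice d" "\<And>y. y \<in> Y \<Longrightarrow> y i = k"
  shows "(\<Sum>y\<in>Y. tau d p w y) \<le> G (nat \<bar>k - w i\<bar>)"
proof -
  define \<pi> where "\<pi> = Transposition.transpose 0 i"
  define s where "s j = (if j = 0 \<and> k < w i then -1 else 1 :: int)" for j :: nat
  define g where "g = lattice_sym d \<pi> s (\<lambda>j. - s j * w (\<pi> j))"
  have perm: "\<pi> permutes {..<d}"
    unfolding \<pi>_def using assms(2) d_pos by (intro permutes_swap_id) auto
  have s: "\<bar>s j\<bar> = 1" for j by (simp add: s_def)
  have gw: "g w = org"
    unfolding g_def by (rule lattice_eqI[of _ d]) (simp, simp, simp add: lattice_sym_def origin_apply)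
  have inj: "inj_on g Y"
    unfolding g_def using assms(4) by (rule inj_on_subset[OF lattice_sym_inj[OF perm s]])
  have "g y 0 = int (nat \<bar>k - w i\<bar>)" if "y \<in> Y" for y
    using assms(5)[OF that] d_pos by (auto simp: g_def lattice_sym_def \<pi>_def s_def)
  then have sub: "g ` Y \<subseteq> level d (int (nat \<bar>k - w i\<bar>))" by (auto simp: level_def g_def)
  have "(\<Sum>y\<in>Y. tau d p w y) \<le> (\<Sum>y\<in>Y. tau d p org (g y))"
    unfolding gw[symmetric] unfolding g_def by (intro sum_mono tau_sym_map p01 perm s)
  also have "\<dots> = (\<Sum>y\<in>g ` Y. tau d p org y)" by (simp add: sum.reindex[OF inj])
  also have "\<dots> \<le> G (nat \<bar>k - w i\<bar>)" using assms(3) sub by (intro le_G) auto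
  finally show ?thesis .
qed

lemma sum_tau_level_le_G:
  assumes "w \<in> lattice d" "finite Y" "Y \<subseteq> level d k"
  shows "(\<Sum>y\<in>Y. tau d p w y) \<le> G (nat \<bar>k - w 0\<bar>)"
  by (rule sum_tau_le_G) (use assms d_pos in \<open>auto simp: level_def\<close>)

lemma org_0: "org 0 = 0" using d_pos by (simp add: origin_apply)

lemma vertices_lattice: "F \<subseteq> edges d \<Longrightarrow> insert org (\<Union>F) \<subseteq> lattice d"
  using edges_lattice by auto

text \<open>A path to level \<open>n + m\<close> is cut at a vertex of level \<open>n\<close>; after
  BK the sum over the endpoints beyond that vertex is at most \<open>G m\<close>, uniformly in the
  vertex.\<close>

lemma G_submult: "G (n + m) \<le> G n * G m"
proof (rule G_le)
  fix Y assume Y: "finite Y" "Y \<subseteq> level d (int (n + m))"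
  show "(\<Sum>y\<in>Y. tau d p org y) \<le> G n * G m"
    unfolding tau_def
  proof (rule sum_lprob_le[OF p01 Y(1)])
    fix F assume F: "finite F" "F \<subseteq> edges d"
    let ?W = "{w \<in> insert org (\<Union>F). w 0 = int n}"
    have W: "finite ?W" "?W \<subseteq> level d (int n)"
      using vertices_lattice[OF F(2)]
      by (rule_tac finite_subset[of _ "insert org (\<Union>F)"]; use finite_Union_edges[OF F] in auto)
         (use vertices_lattice[OF F(2)] in \<open>auto simp: level_def\<close>)
    have "(\<Sum>y\<in>Y. bprob F p (\<lambda>S. conn S org y)) \<le> (\<Sum>y\<in>Y. \<Sum>w\<in>?W. tau d p org w * tau d p w y)"
      using Y(2) by (intro sum_mono tau_through_level F) (auto simp: org_0 level_def)
    also have "\<dots> = (\<Sum>w\<in>?W. tau d p org w * (\<Sum>y\<in>Y. tau d p w y))"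
      by (subst sum.swap) (simp add: sum_distrib_left)
    also have "\<dots> \<le> (\<Sum>w\<in>?W. tau d p org w * G m)"
    proof (intro sum_mono mult_left_mono tau_nonneg p01)
      fix w assume "w \<in> ?W"
      then have w: "w \<in> lattice d" "w 0 = int n" using W(2) by (auto simp: level_def)
      show "(\<Sum>y\<in>Y. tau d p w y) \<le> G m"
        using sum_tau_level_le_G[OF w(1) Y] w(2) by simp
    qed
    also have "\<dots> \<le> G n * G m"
      unfolding sum_distrib_right[symmetric]
      using le_G[OF W] G_pos[of m] by (intro mult_right_mono) auto
    finally show "(\<Sum>y\<in>Y. bprob F p (\<lambda>S. conn S org y)) \<le> G n * G m" .
  qed auto
qed

lemma G_power: "1 \<le> k \<Longrightarrow> G (n * k) \<le> G n ^ k"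
proof (induction k rule: nat_induct_at_least)
  case (Suc k)
  have "G (n * Suc k) \<le> G n * G (n * k)" using G_submult[of n "n * k"] by simp
  also have "\<dots> \<le> G n * G n ^ k" using Suc G_pos[of n] by (intro mult_left_mono) auto
  finally show ?case by simp
qed simp

text \<open>The chain \<open>axis_tau d p (n * k) \<le> G (n * k) \<le> G n ^ k\<close> compares
  \<open>G n\<close> with the axis connectivity at all multiples of \<open>n\<close>. The rate of
  the latter is \<open>r\<close>, so taking logarithms and letting \<open>k\<close> grow gives the
  bound.\<close>

lemma G_lower: "exp (- r * real n) \<le> G n"
proof (cases "n = 0")
  case True
  then show ?thesis using axis_tau_ge[OF p01 d_pos, of 0] axis_tau_le_G[of 0] by simp
next
  case False
  have lim: "(\<lambda>k. - ln (axis_tau d p (n * Suc k)) / real (n * Suc k)) \<longlonglongrightarrow> r"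
  proof (rule filterlim_compose[OF axis_tau_limit])
    have "strict_mono (\<lambda>k. n * Suc k)" using False by (intro strict_monoI) simp
    then show "filterlim (\<lambda>k. n * Suc k) sequentially sequentially" by (rule filterlim_subseq)
  qed
  have "- ln (G n) / real n \<le> - ln (axis_tau d p (n * Suc k)) / real (n * Suc k)" for k
  proof -
    have "axis_tau d p (n * Suc k) \<le> G n ^ Suc k"
      by (rule order_trans[OF axis_tau_le_G G_power]) simp
    then have "ln (axis_tau d p (n * Suc k)) \<le> ln (G n ^ Suc k)"
      using axis_tau_pos G_pos by (subst ln_le_cancel_iff) auto
    also have "\<dots> = real (Suc k) * ln (G n)" using G_pos by (simp only: ln_realpow)
    finally have "ln (axis_tau d p (n * Suc k)) \<le> real (Suc k) * ln (G n)" .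
    then have "- (real (Suc k) * ln (G n)) / real (n * Suc k) \<le> - ln (axis_tau d p (n * Suc k)) / real (n * Suc k)"
      by (intro divide_right_mono) auto
    moreover have "- (real (Suc k) * ln (G n)) / real (n * Suc k) = - ln (G n) / real n"
    proof -
      have "real (Suc k) \<noteq> 0" "real n \<noteq> 0" using False by auto
      then show ?thesis unfolding of_nat_mult by (metis mult.commute mult_minus_right nonzero_mult_divide_mult_cancel_left)
    qed
    ultimately show ?thesis by simp
  qed
  then have "- ln (G n) / real n \<le> r" by (intro LIMSEQ_le_const[OF lim]) auto
  then have "- r * real n \<le> ln (G n)" using False by (simp add: field_simps)
  then have "exp (- r * real n) \<le> exp (ln (G n))" by simp
  then show ?thesis using G_pos by simp
qed

section \<open>The exact exponential order of \<open>cross\<close> and \<open>G\<close>\<close>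

lemma cross_nonneg: "0 \<le> cross n"
  unfolding cross_def by (rule lprob_nonneg[OF p01])

lemma cross_le_G: "cross n \<le> G n"
  unfolding cross_def
proof (rule lprob_le)
  fix F assume F: "finite F" "F \<subseteq> slab n"
  have Fe: "F \<subseteq> edges d" using F slab_edges by auto
  let ?Y = "insert org (\<Union>F) \<inter> level d (int n)"
  have fin: "finite ?Y" using finite_Union_edges[OF F(1) Fe] by simp
  have "bprob F p (\<lambda>S. \<exists>y\<in>level d (int n). conn S org y) \<le> bprob F p (\<lambda>S. \<exists>y\<in>?Y. conn S org y)"
  proof (rule bprob_mono[OF p01])
    fix S assume S: "S \<subseteq> F" "\<exists>y\<in>level d (int n). conn S org y"
    then obtain y where "y \<in> level d (int n)" "conn S org y" by blast
    then show "\<exists>y\<in>?Y. conn S org y" using conn_mem[of S org y] S(1) by blast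
  qed
  also have "\<dots> \<le> (\<Sum>y\<in>?Y. bprob F p (\<lambda>S. conn S org y))" by (rule bprob_Bex[OF p01 fin])
  also have "\<dots> \<le> (\<Sum>y\<in>?Y. tau d p org y)" by (intro sum_mono tau_ge p01 F Fe)
  also have "\<dots> \<le> G n" by (rule le_G[OF fin]) simp
  finally show "bprob F p (\<lambda>S. \<exists>y\<in>level d (int n). conn S org y) \<le> G n" .
qed

text \<open>\<open>k\<close> slabs of width \<open>n\<close> and the \<open>k - 1\<close> bridging
  edges between them have total width \<open>k * (n + 1) - 1\<close>. With the normalisation
  \<open>p * cross\<close> no other constant remains.\<close>

lemma cross_power: "1 \<le> k \<Longrightarrow> (p * cross n) ^ k \<le> p * cross (k * (n + 1) - 1)"
proof (induction k rule: nat_induct_at_least)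
  case (Suc k)
  have eq: "n + (k * (n + 1) - 1) + 1 = Suc k * (n + 1) - 1"
    using Suc.hyps by (cases k) (auto simp: algebra_simps)
  have "(p * cross n) ^ Suc k \<le> (p * cross n) * (p * cross (k * (n + 1) - 1))"
    using Suc.IH p_nonneg cross_nonneg by (auto intro!: mult_left_mono)
  also have "\<dots> = p * (p * (cross n * cross (k * (n + 1) - 1)))" by simp
  also have "\<dots> \<le> p * cross (Suc k * (n + 1) - 1)"
    using cross_supermult[of n "k * (n + 1) - 1"] p_nonneg unfolding eq by (rule mult_left_mono)
  finally show ?case .
qed simp

text \<open>Since \<open>cross \<le> G\<close>, long slabs decay at rate at least
  \<open>r * (1 - \<epsilon>)\<close> up to a constant. \<open>cross_power\<close> transfers this to
  width \<open>n\<close>, the \<open>k\<close>-th root removes the constant, and finally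
  \<open>\<epsilon>\<close> tends to 0.\<close>

lemma cross_upper: "p * cross n \<le> exp (- r * real (n + 1))"
proof -
  have *: "p * cross n \<le> exp (- r * (1 - \<epsilon>) * real (n + 1))" if \<epsilon>: "0 < \<epsilon>" "\<epsilon> \<le> 1" for \<epsilon>
  proof (rule power_le_imp_le_const)
    fix k :: nat assume k: "1 \<le> k"
    let ?N = "k * (n + 1) - 1"
    have N: "real ?N = real k * real (n + 1) - 1"
      using k by (subst of_nat_diff) (auto simp: algebra_simps)
    have "(p * cross n) ^ k \<le> p * cross ?N" by (rule cross_power[OF k])
    also have "\<dots> \<le> G ?N"
      using cross_le_G[of ?N] p01 cross_nonneg[of ?N] by (meson mult_left_le_one_le order_trans)
    also have "\<dots> \<le> level_const \<epsilon> * exp (- r * (1 - \<epsilon>) * real ?N)" by (rule G_bound[OF \<epsilon>])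
    also have "exp (- r * (1 - \<epsilon>) * real ?N) = exp (r * (1 - \<epsilon>)) * exp (real k * (- r * (1 - \<epsilon>) * real (n + 1)))"
      unfolding N exp_add[symmetric] by (rule arg_cong[of _ _ exp]) (simp add: algebra_simps)
    finally show "(p * cross n) ^ k \<le> (level_const \<epsilon> * exp (r * (1 - \<epsilon>))) * exp (- r * (1 - \<epsilon>) * real (n + 1)) ^ k"
      unfolding exp_of_nat_mult[symmetric] by (simp add: mult.assoc)
  qed (use p_nonneg cross_nonneg in auto)
  have "((\<lambda>\<epsilon>. exp (- r * (1 - \<epsilon>) * real (n + 1))) \<longlongrightarrow> exp (- r * (1 - 0) * real (n + 1))) (at_right 0)"
    by (intro tendsto_intros)
  moreover have "\<forall>\<^sub>F \<epsilon> in at_right (0::real). p * cross n \<le> exp (- r * (1 - \<epsilon>) * real (n + 1))"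
    unfolding eventually_at_right_field using * by (intro exI[of _ 1]) auto
  ultimately have "p * cross n \<le> exp (- r * (1 - 0) * real (n + 1))"
    by (rule tendsto_lowerbound) simp
  then show ?thesis by simp
qed

lemma slab_tau_le: "lprob p (slab n) (\<lambda>S. conn S x y) \<le> tau d p x y"
  unfolding tau_def by (rule lprob_mono[OF p01 slab_edges])

lemma H_bdd: "bdd_above ((\<lambda>Y. \<Sum>y\<in>Y. lprob p (slab n) (\<lambda>S. conn S org y)) ` {Y. finite Y \<and> Y \<subseteq> level d (int n)})"
proof (rule bdd_aboveI2)
  fix Y assume "Y \<in> {Y. finite Y \<and> Y \<subseteq> level d (int n)}"
  then have Y: "finite Y" "Y \<subseteq> level d (int n)" by auto
  have "(\<Sum>y\<in>Y. lprob p (slab n) (\<lambda>S. conn S org y)) \<le> (\<Sum>y\<in>Y. tau d p org y)"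
    by (intro sum_mono slab_tau_le)
  also have "\<dots> \<le> G n" by (rule le_G[OF Y])
  finally show "(\<Sum>y\<in>Y. lprob p (slab n) (\<lambda>S. conn S org y)) \<le> G n" .
qed

lemma le_H: "finite Y \<Longrightarrow> Y \<subseteq> level d (int n) \<Longrightarrow> (\<Sum>y\<in>Y. lprob p (slab n) (\<lambda>S. conn S org y)) \<le> H n"
  unfolding H_def by (rule cSUP_upper[OF _ H_bdd]) auto

lemma H_le: "(\<And>Y. finite Y \<Longrightarrow> Y \<subseteq> level d (int n) \<Longrightarrow> (\<Sum>y\<in>Y. lprob p (slab n) (\<lambda>S. conn S org y)) \<le> c) \<Longrightarrow> H n \<le> c"
  unfolding H_def by (rule cSUP_least) auto

lemma H_nonneg: "0 \<le> H n"
  using le_H[of "{}" n] by simp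

lemma slab_shift:
  assumes "u \<in> level d 0" "finite V" "V \<subseteq> level d (int n)"
  shows "(\<Sum>v\<in>V. lprob p (slab n) (\<lambda>S. conn S u v)) \<le> H n"
proof -
  define g where "g = shift d (\<lambda>i. - u i)"
  have g0: "g v 0 = v 0" for v using assms(1) d_pos by (simp add: g_def shift_apply level_def)
  have "inj_on g V"
    unfolding g_def shift_def
    by (rule inj_on_subset[OF lattice_sym_inj]) (use assms(3) in \<open>auto simp: permutes_id level_def\<close>)
  note inj = sum.reindex[OF this, unfolded o_def]
  have "(\<Sum>v\<in>V. lprob p (slab n) (\<lambda>S. conn S u v)) \<le> (\<Sum>v\<in>V. lprob p (slab n) (\<lambda>S. conn S org (g v)))"
    using conn_image[where h = g] unfolding g_def
    by (intro sum_mono lprob_slab_shift[OF assms(1)]) (metis shift_neg)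
  also have "\<dots> = (\<Sum>v\<in>g ` V. lprob p (slab n) (\<lambda>S. conn S org v))" by (simp add: inj)
  also have "\<dots> \<le> H n"
    using assms(2,3) g0 by (intro le_H) (auto simp: level_def g_def)
  finally show ?thesis .
qed

text \<open>By \<open>conn_through_slab\<close> and BK a path splits into a slab piece and two outer
  pieces with no net displacement in the first coordinate; each outer piece sums to at most
  \<open>G 0\<close>.\<close>

lemma G_le_H: "G n \<le> G 0 * H n * G 0"
proof (rule G_le)
  fix Y assume Y: "finite Y" "Y \<subseteq> level d (int n)"
  show "(\<Sum>y\<in>Y. tau d p org y) \<le> G 0 * H n * G 0"
    unfolding tau_def
  proof (rule sum_lprob_le[OF p01 Y(1)])
    fix F assume F: "finite F" "F \<subseteq> edges d"
    let ?U = "insert org (\<Union>F) \<inter> level d 0" and ?V = "insert org (\<Union>F) \<inter> level d (int n)"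
    let ?s = "\<lambda>u v. lprob p (slab n) (\<lambda>S. conn S u v)"
    have fin: "finite ?U" "finite ?V" using finite_Union_edges[OF F] by auto
    have "(\<Sum>y\<in>Y. bprob F p (\<lambda>S. conn S org y)) \<le> (\<Sum>y\<in>Y. \<Sum>u\<in>?U. \<Sum>v\<in>?V. tau d p org u * ?s u v * tau d p v y)"
      using Y by (intro sum_mono tau_through_slab F) auto
    also have "\<dots> = (\<Sum>u\<in>?U. \<Sum>y\<in>Y. \<Sum>v\<in>?V. tau d p org u * ?s u v * tau d p v y)"
      by (rule sum.swap)
    also have "\<dots> = (\<Sum>u\<in>?U. \<Sum>v\<in>?V. \<Sum>y\<in>Y. tau d p org u * ?s u v * tau d p v y)"
      by (intro sum.cong refl sum.swap)
    also have "\<dots> = (\<Sum>u\<in>?U. \<Sum>v\<in>?V. tau d p org u * ?s u v * (\<Sum>y\<in>Y. tau d p v y))"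
      by (simp add: sum_distrib_left)
    also have "\<dots> \<le> (\<Sum>u\<in>?U. \<Sum>v\<in>?V. tau d p org u * ?s u v * G 0)"
    proof (intro sum_mono mult_left_mono mult_nonneg_nonneg tau_nonneg lprob_nonneg p01)
      fix v assume "v \<in> ?V"
      then have v: "v \<in> lattice d" "v 0 = int n" by (auto simp: level_def)
      show "(\<Sum>y\<in>Y. tau d p v y) \<le> G 0"
        using sum_tau_level_le_G[OF v(1) Y] v(2) by simp
    qed
    also have "\<dots> = (\<Sum>u\<in>?U. tau d p org u * (\<Sum>v\<in>?V. ?s u v) * G 0)"
      by (simp add: sum_distrib_left sum_distrib_right)
    also have "\<dots> \<le> (\<Sum>u\<in>?U. tau d p org u * H n * G 0)"
      using slab_shift fin G_pos[of 0]
      by (intro sum_mono mult_right_mono mult_left_mono tau_nonneg p01 slab_shift) auto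
    also have "\<dots> = (\<Sum>u\<in>?U. tau d p org u) * H n * G 0"
      by (simp add: sum_distrib_right)
    also have "\<dots> \<le> G 0 * H n * G 0"
      using G_pos[of 0] H_nonneg[of n] fin by (intro mult_right_mono le_G) auto
    finally show "(\<Sum>y\<in>Y. bprob F p (\<lambda>S. conn S org y)) \<le> G 0 * H n * G 0" .
  qed auto
qed

lemma sum_by_level_le:
  assumes x: "x \<in> level d 0" and F: "finite F" "F \<subseteq> slab n" and c: "\<And>k. 0 \<le> c k"
  shows "(\<Sum>w\<in>insert x (\<Union>F). tau d p x w * c (nat (w 0))) \<le> (\<Sum>k\<le>n. G k * c k)"
proof -
  have Fe: "F \<subseteq> edges d" using F slab_edges by auto
  have xl: "x \<in> lattice d" "x 0 = 0" using x by (auto simp: level_def)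
  define W where "W = insert x (\<Union>F)"
  have W: "finite W" "W \<subseteq> lattice d" unfolding W_def
    using finite_Union_edges[OF F(1) Fe] Fe edges_lattice xl by auto
  have W0: "w 0 \<in> {0..int n}" if "w \<in> W" for w
    using slab_coord[OF F(2), of x w] that xl by (simp add: W_def)
  have "(\<Sum>w\<in>W. tau d p x w * c (nat (w 0))) = (\<Sum>k\<le>n. \<Sum>w\<in>{w\<in>W. nat (w 0) = k}. tau d p x w * c (nat (w 0)))"
    by (rule sum.group[symmetric]) (use W W0 in \<open>auto simp: image_subset_iff nat_le_iff\<close>)
  also have "\<dots> = (\<Sum>k\<le>n. (\<Sum>w\<in>{w\<in>W. nat (w 0) = k}. tau d p x w) * c k)"
    by (intro sum.cong refl) (auto simp: sum_distrib_right)
  also have "\<dots> \<le> (\<Sum>k\<le>n. G k * c k)"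
  proof (intro sum_mono mult_right_mono c)
    fix k
    have "{w\<in>W. nat (w 0) = k} \<subseteq> level d (int k)"
      using W(2) W0 by (force simp: level_def)
    from sum_tau_level_le_G[OF xl(1) _ this]
    show "(\<Sum>w\<in>{w\<in>W. nat (w 0) = k}. tau d p x w) \<le> G k" using W xl(2) by simp
  qed
  finally show ?thesis by (simp add: W_def)
qed

lemma org_level: "org \<in> level d 0"
  using org_0 by (simp add: level_def)

text \<open>The tree-graph bound for the expected number of pairs of vertices of level
  \<open>n\<close> reached from the origin: one arm leads to a branching vertex at level
  \<open>k\<close>, two lead on to level \<open>n\<close>.\<close>

definition second_moment :: "nat \<Rightarrow> real" where
  "second_moment n = (\<Sum>k\<le>n. G k * (G (n - k))\<^sup>2)"

text \<open>The number \<open>X\<close> of vertices of \<open>Y\<close> reached vanishes unless the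
  slab is crossed, so Cauchy-Schwarz bounds the square of its mean by its second moment times the
  crossing probability. The tree-graph inequality bounds the second moment, sorted by the level of
  the branching vertex.\<close>

lemma H_square_le: "(H n)\<^sup>2 \<le> cross n * second_moment n"
proof -
  have sm: "0 \<le> second_moment n"
    unfolding second_moment_def using G_pos by (intro sum_nonneg mult_nonneg_nonneg) (auto simp: less_imp_le)
  have "H n \<le> sqrt (cross n * second_moment n)"
  proof (rule H_le, rule sum_lprob_le[OF p01])
    fix Y F assume Y: "finite Y" "Y \<subseteq> level d (int n)" and F: "finite F" "F \<subseteq> slab n"
    have Fe: "F \<subseteq> edges d" using F slab_edges by auto
    define W where "W = insert org (\<Union>F)"
    have W: "finite W" "W \<subseteq> lattice d" unfolding W_def
      using finite_Union_edges[OF F(1) Fe] vertices_lattice[OF Fe] by auto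
    have W0: "w 0 \<in> {0..int n}" if "w \<in> W" for w
      using slab_coord[OF F(2), of org w] that org_0 by (simp add: W_def)
    define X where "X S = (\<Sum>y\<in>Y. of_bool (conn S org y) :: real)" for S
    define A where "A S \<longleftrightarrow> (\<exists>y\<in>level d (int n). conn S org y)" for S
    have "(\<Sum>y\<in>Y. bprob F p (\<lambda>S. conn S org y)) = bexp F p (\<lambda>S. X S * of_bool (A S))"
      unfolding bprob_def bexp_sum[symmetric] X_def
      by (rule bexp_cong) (use Y in \<open>auto simp: A_def intro!: sum.neutral\<close>)
    then have "(\<Sum>y\<in>Y. bprob F p (\<lambda>S. conn S org y))\<^sup>2 \<le> bexp F p (\<lambda>S. (X S)\<^sup>2) * bexp F p (\<lambda>S. (of_bool (A S))\<^sup>2)"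
      using bexp_CS[OF p01] by simp
    also have "bexp F p (\<lambda>S. (of_bool (A S))\<^sup>2) = bprob F p A"
      unfolding bprob_def by (rule bexp_cong) simp
    also have "bexp F p (\<lambda>S. (X S)\<^sup>2) = (\<Sum>y\<in>Y. \<Sum>z\<in>Y. bprob F p (\<lambda>S. conn S org y \<and> conn S org z))"
      unfolding bprob_def bexp_sum[symmetric] X_def power2_eq_square sum_product
      by (simp add: of_bool_conj)
    also have "\<dots> \<le> (\<Sum>y\<in>Y. \<Sum>z\<in>Y. \<Sum>w\<in>W. tau d p org w * tau d p w y * tau d p w z)"
      unfolding W_def by (intro sum_mono tau_tree F Fe)
    also have "\<dots> = (\<Sum>w\<in>W. tau d p org w * (\<Sum>y\<in>Y. tau d p w y)\<^sup>2)"
    proof -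
      have "(\<Sum>y\<in>Y. \<Sum>z\<in>Y. \<Sum>w\<in>W. tau d p org w * tau d p w y * tau d p w z)
          = (\<Sum>y\<in>Y. \<Sum>w\<in>W. \<Sum>z\<in>Y. tau d p org w * tau d p w y * tau d p w z)"
        by (intro sum.cong refl sum.swap)
      also have "\<dots> = (\<Sum>w\<in>W. \<Sum>y\<in>Y. \<Sum>z\<in>Y. tau d p org w * tau d p w y * tau d p w z)"
        by (rule sum.swap)
      also have "\<dots> = (\<Sum>w\<in>W. tau d p org w * (\<Sum>y\<in>Y. tau d p w y)\<^sup>2)"
        unfolding power2_eq_square sum_product by (simp add: sum_distrib_left mult.assoc)
      finally show ?thesis .
    qed
    also have "\<dots> \<le> (\<Sum>w\<in>W. tau d p org w * (G (n - nat (w 0)))\<^sup>2)"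
    proof (intro sum_mono mult_left_mono power_mono tau_nonneg p01 sum_nonneg)
      fix w assume w: "w \<in> W"
      then have eq: "nat \<bar>int n - w 0\<bar> = n - nat (w 0)" using W0[OF w] by auto
      have "w \<in> lattice d" using w W(2) by blast
      then show "(\<Sum>y\<in>Y. tau d p w y) \<le> G (n - nat (w 0))"
        unfolding eq[symmetric] using Y by (rule sum_tau_level_le_G)
    qed
    also have "\<dots> \<le> second_moment n"
      unfolding second_moment_def W_def
      using sum_by_level_le[OF org_level F, of "\<lambda>k. (G (n - k))\<^sup>2"] by simp
    finally have "(\<Sum>y\<in>Y. bprob F p (\<lambda>S. conn S org y))\<^sup>2 \<le> second_moment n * bprob F p A"
      using bprob_nonneg[OF p01] by (auto intro: mult_right_mono)
    also have "\<dots> \<le> second_moment n * cross n"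
      unfolding cross_def A_def by (intro mult_left_mono lprob_ge p01 F sm)
    finally show "(\<Sum>y\<in>Y. bprob F p (\<lambda>S. conn S org y)) \<le> sqrt (cross n * second_moment n)"
      by (intro real_le_rsqrt) (simp add: mult.commute)
  qed auto
  then have "(H n)\<^sup>2 \<le> (sqrt (cross n * second_moment n))\<^sup>2" by (intro power_mono H_nonneg)
  then show ?thesis using sm cross_nonneg by simp
qed

text \<open>With \<open>g n = G n * exp (r * n)\<close>, the second moment bound reads
  \<open>(g n)\<^sup>2 \<le> C * Max {g k | k \<le> n}\<close>, so a new record of \<open>g\<close> cannot exceed \<open>C\<close>.\<close>

lemma G_upper: "\<exists>D>0. \<forall>n. G n \<le> D * exp (- r * real n)"
proof -
  define g where "g n = G n * exp (r * real n)" for n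
  \<comment> \<open>With \<open>\<epsilon> = 1/4\<close> the a priori growth of \<open>g j\<close>
    is \<open>exp (r * j / 4)\<close>. Its square uses up half of the available decay
    \<open>exp (- r * j)\<close> and leaves \<open>q ^ j\<close>, which is summable.\<close>
  define K where "K = level_const (1/4)"
  define q where "q = exp (- r / 2)"
  \<comment> \<open>Collects \<open>G 0 ^ 4\<close> from squaring \<open>G_le_H\<close> and the
    constant of \<open>cross_upper\<close>.\<close>
  define B where "B = G 0 ^ 4 * (exp (- r) / p)"
  define C where "C = B * K\<^sup>2 / (1 - q)"
  have q: "0 < q" "q < 1" using rate_pos by (auto simp: q_def)
  have K: "0 < K" unfolding K_def by (rule level_const_pos) simp
  have B: "0 < B" using G_pos[of 0] p_pos by (simp add: B_def)
  have C: "0 < C" using B K q by (simp add: C_def)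
  have gpos: "0 < g n" for n using G_pos by (simp add: g_def)
  have Gg: "G n = g n * exp (- r * real n)" for n by (simp add: g_def exp_minus)
  have gK: "g n \<le> K * exp (r / 4 * real n)" for n
  proof -
    have "g n \<le> K * exp (- r * (1 - 1/4) * real n) * exp (r * real n)"
      unfolding g_def K_def by (intro mult_right_mono G_bound) auto
    then show ?thesis by (simp add: mult.assoc exp_add[symmetric] algebra_simps)
  qed
  have key: "(g n)\<^sup>2 \<le> B * (\<Sum>k\<le>n. g k * (K\<^sup>2 * q ^ (n - k)))" for n
  proof -
    have "(G n)\<^sup>2 \<le> (G 0 * H n * G 0)\<^sup>2"
      using G_le_H[of n] G_pos[of n] by (intro power_mono) auto
    also have "\<dots> = G 0 ^ 4 * (H n)\<^sup>2" by (simp add: power2_eq_square power4_eq_xxxx)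
    also have "\<dots> \<le> G 0 ^ 4 * (cross n * second_moment n)"
      by (intro mult_left_mono H_square_le) auto
    also have "\<dots> \<le> G 0 ^ 4 * ((exp (- r) / p * exp (- r * real n)) * second_moment n)"
    proof -
      have "cross n \<le> exp (- r) / p * exp (- r * real n)"
        using cross_upper[of n] p_pos by (simp add: field_simps exp_add[symmetric])
      moreover have "0 \<le> second_moment n"
        unfolding second_moment_def using G_pos by (intro sum_nonneg mult_nonneg_nonneg) (auto simp: less_imp_le)
      ultimately show ?thesis by (intro mult_left_mono mult_right_mono) auto
    qed
    also have "\<dots> = B * (exp (- r * real n) * second_moment n)" by (simp add: B_def)
    finally have "(G n)\<^sup>2 \<le> B * (exp (- r * real n) * second_moment n)" .
    then have "(G n)\<^sup>2 * exp (2 * r * real n) \<le> B * (exp (- r * real n) * second_moment n) * exp (2 * r * real n)"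
      by (rule mult_right_mono) simp
    also have "\<dots> = B * (exp (r * real n) * second_moment n)"
      by (simp add: exp_add[symmetric] exp_minus field_simps)
    also have "exp (r * real n) * second_moment n \<le> (\<Sum>k\<le>n. g k * (K\<^sup>2 * q ^ (n - k)))"
      unfolding second_moment_def sum_distrib_left
    proof (rule sum_mono)
      fix k assume k: "k \<in> {..n}"
      define j where "j = n - k"
      have n: "real n = real k + real j" using k by (simp add: j_def)
      have "exp (r * real n) * (G k * (G j)\<^sup>2) = g k * ((g j)\<^sup>2 * exp (- r * real j))"
        unfolding Gg n by (simp add: power2_eq_square exp_add[symmetric] exp_minus field_simps)
      also have "\<dots> \<le> g k * ((K * exp (r / 4 * real j))\<^sup>2 * exp (- r * real j))"
        using gpos[of k] gpos[of j] gK[of j] by (intro mult_left_mono mult_right_mono power_mono) auto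
      also have "(K * exp (r / 4 * real j))\<^sup>2 * exp (- r * real j) = K\<^sup>2 * q ^ j"
      proof -
        have "q ^ j = exp (real j * (- r / 2))" unfolding q_def by (rule exp_of_nat_mult[symmetric])
        then show ?thesis
          by (simp add: power_mult_distrib exp_double[symmetric] exp_add[symmetric] algebra_simps)
      qed
      finally show "exp (r * real n) * (G k * (G (n - k))\<^sup>2) \<le> g k * (K\<^sup>2 * q ^ (n - k))"
        by (simp add: j_def)
    qed
    finally show ?thesis
      using B by (simp add: g_def power_mult_distrib exp_double[symmetric] mult.assoc)
  qed
  have geo: "(\<Sum>k\<le>n. q ^ (n - k)) \<le> 1 / (1 - q)" for n
  proof -
    have "(\<Sum>k\<le>n. q ^ (n - k)) = (\<Sum>k\<le>n. q ^ k)"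
      by (rule sum.reindex_bij_witness[of _ "\<lambda>k. n - k" "\<lambda>k. n - k"]) auto
    also have "\<dots> = (\<Sum>k<Suc n. q ^ k)" by (simp only: lessThan_Suc_atMost)
    also have "\<dots> \<le> 1 / (1 - q)" using q by (simp add: sum_gp_strict divide_right_mono del: sum.lessThan_Suc)
    finally show ?thesis .
  qed
  have gC: "g n \<le> C" for n
  proof (induction n rule: less_induct)
    case (less n)
    show ?case
    proof (rule ccontr)
      assume n: "\<not> g n \<le> C"
      have le: "g k \<le> g n" if "k \<le> n" for k
        using less[of k] n that by (cases "k = n") auto
      have "(g n)\<^sup>2 \<le> B * (\<Sum>k\<le>n. g n * (K\<^sup>2 * q ^ (n - k)))"
        using B q le by (intro order_trans[OF key] mult_left_mono sum_mono mult_right_mono) auto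
      also have "\<dots> = B * (g n * K\<^sup>2 * (\<Sum>k\<le>n. q ^ (n - k)))"
        by (simp add: sum_distrib_left mult.assoc)
      also have "\<dots> \<le> B * (g n * K\<^sup>2 * (1 / (1 - q)))"
        using B gpos[of n] geo by (intro mult_left_mono) auto
      also have "\<dots> = g n * C" by (simp add: C_def)
      finally have "g n \<le> C" using gpos[of n] by (simp add: power2_eq_square)
      with n show False by simp
    qed
  qed
  have "G n \<le> C * exp (- r * real n)" for n
    unfolding Gg by (intro mult_right_mono gC) auto
  then show ?thesis using C by blast
qed

lemma sum_exp_rate: "(\<Sum>k\<le>n. exp (- r * real (n - k))) \<le> 1 / (1 - exp (- r))"
proof -
  have "(\<Sum>k\<le>n. exp (- r * real (n - k))) = (\<Sum>k\<le>n. exp (- r * real k))"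
    by (rule sum.reindex_bij_witness[of _ "\<lambda>k. n - k" "\<lambda>k. n - k"]) auto
  also have "\<dots> = (\<Sum>k<Suc n. exp (- r) ^ k)"
    unfolding lessThan_Suc_atMost by (intro sum.cong refl) (simp add: exp_of_nat_mult[symmetric] mult.commute)
  also have "\<dots> \<le> 1 / (1 - exp (- r))"
    using rate_pos by (simp add: sum_gp_strict divide_right_mono del: sum.lessThan_Suc)
  finally show ?thesis .
qed

text \<open>Once \<open>G\<close> is of order \<open>exp (- r * n)\<close>, the \<open>k\<close>-th
  term is of order \<open>exp (- r * n) * exp (- r * (n - k))\<close>: branching far from the target
  level pays for a second arm, and the sum is geometric.\<close>

lemma second_moment_upper: "\<exists>M>0. \<forall>n. second_moment n \<le> M * exp (- r * real n)"
proof -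
  obtain D where D: "0 < D" "\<And>n. G n \<le> D * exp (- r * real n)" using G_upper by blast
  define E where "E = 1 / (1 - exp (- r))"
  have E: "0 < E" using rate_pos by (simp add: E_def)
  have "second_moment n \<le> D ^ 3 * E * exp (- r * real n)" for n
  proof -
    have "second_moment n \<le> (\<Sum>k\<le>n. (D ^ 3 * exp (- r * real n)) * exp (- r * real (n - k)))"
      unfolding second_moment_def
    proof (rule sum_mono)
      fix k assume "k \<in> {..n}"
      then have n: "real n = real k + real (n - k)" by auto
      have "G k * (G (n - k))\<^sup>2 \<le> (D * exp (- r * real k)) * (D * exp (- r * real (n - k)))\<^sup>2"
        using D G_pos by (intro mult_mono power_mono) (auto simp: less_imp_le)
      also have "\<dots> = D ^ 3 * exp (- r * (real k + real (n - k))) * exp (- r * real (n - k))"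
        by (simp add: power2_eq_square power3_eq_cube exp_add[symmetric] algebra_simps)
      finally show "G k * (G (n - k))\<^sup>2 \<le> D ^ 3 * exp (- r * real n) * exp (- r * real (n - k))"
        by (simp only: n[symmetric])
    qed
    also have "\<dots> \<le> (D ^ 3 * exp (- r * real n)) * E"
      unfolding sum_distrib_left[symmetric] E_def using D by (intro mult_left_mono sum_exp_rate) auto
    finally show ?thesis by (simp add: mult_ac)
  qed
  moreover have "0 < D ^ 3 * E" using D E by simp
  ultimately show ?thesis by blast
qed

text \<open>In \<open>exp (- r * n)\<^sup>2 \<le> (G n)\<^sup>2 \<le> G 0 ^ 4 * cross n *
  second_moment n\<close> the second moment cancels one of the two exponential factors.\<close>

lemma cross_lower: "\<exists>c>0. \<forall>n. c * exp (- r * real n) \<le> cross n"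
proof -
  obtain M where M: "0 < M" "\<And>n. second_moment n \<le> M * exp (- r * real n)"
    using second_moment_upper by blast
  define c where "c = 1 / (G 0 ^ 4 * M)"
  have "c * exp (- r * real n) \<le> cross n" for n
  proof -
    have "(exp (- r * real n))\<^sup>2 \<le> (G 0 * H n * G 0)\<^sup>2"
      using G_lower[of n] G_le_H[of n] by (intro power_mono) auto
    also have "\<dots> = G 0 ^ 4 * (H n)\<^sup>2" by (simp add: power2_eq_square power4_eq_xxxx)
    also have "\<dots> \<le> G 0 ^ 4 * (cross n * second_moment n)"
      by (intro mult_left_mono H_square_le) auto
    also have "\<dots> \<le> G 0 ^ 4 * (cross n * (M * exp (- r * real n)))"
      by (intro mult_left_mono M(2) cross_nonneg) auto
    finally have "exp (- r * real n) * exp (- r * real n) \<le> (G 0 ^ 4 * M * cross n) * exp (- r * real n)"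
      by (simp add: power2_eq_square mult_ac)
    then have "exp (- r * real n) \<le> G 0 ^ 4 * M * cross n"
      by (simp only: mult_le_cancel_right) simp
    then show ?thesis using M G_pos[of 0] by (simp add: c_def field_simps)
  qed
  moreover have "0 < c" using M G_pos[of 0] by (simp add: c_def)
  ultimately show ?thesis by blast
qed

end

section \<open>Crossings of rectangles\<close>

lemma bprob_pos:
  assumes "0 \<le> p" "p \<le> 1" "finite F" "A F"
  shows "p ^ card F \<le> bprob F p A"
proof -
  have "p ^ card F * (1 - p) ^ card (F - F) * of_bool (A F) \<le> bprob F p A"
    unfolding bprob_def bexp_def by (rule member_le_sum) (use assms in auto)
  then show ?thesis using assms by simp
qed

text \<open>Cauchy-Schwarz gives \<open>M\<^sup>2 / (M\<^sup>2 + m * K)\<close> with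
  \<open>M\<close> the mean number of events that occur. This increases with \<open>M\<close>, so
  \<open>M\<close> may be lowered to \<open>m\<close>. The outcome is
  \<open>Phi (m / K)\<close>.\<close>

lemma second_moment_method:
  assumes p: "0 \<le> p" "p \<le> 1" and fin: "finite E" "finite I"
    and cov: "(\<Sum>x\<in>I. \<Sum>x'\<in>I. bprob E p (\<lambda>S. A x S \<and> A x' S)) \<le> (\<Sum>x\<in>I. bprob E p (A x))\<^sup>2 + m * K"
    and m: "0 < m" "m \<le> (\<Sum>x\<in>I. bprob E p (A x))" and K: "0 < K"
  shows "m / (m + K) \<le> bprob E p (\<lambda>S. \<exists>x\<in>I. A x S)"
proof -
  define N where "N S = (\<Sum>x\<in>I. of_bool (A x S) :: real)" for S
  define M where "M = (\<Sum>x\<in>I. bprob E p (A x))"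
  let ?P = "bprob E p (\<lambda>S. \<exists>x\<in>I. A x S)"
  have M: "M = bexp E p (\<lambda>S. N S * of_bool (\<exists>x\<in>I. A x S))"
    unfolding M_def N_def bprob_def bexp_sum[symmetric]
    by (rule bexp_cong) (auto intro!: sum.neutral)
  have sq: "bexp E p (\<lambda>S. (N S)\<^sup>2) = (\<Sum>x\<in>I. \<Sum>x'\<in>I. bprob E p (\<lambda>S. A x S \<and> A x' S))"
    unfolding bprob_def bexp_sum[symmetric] N_def power2_eq_square sum_product
    by (simp add: of_bool_conj)
  have "M\<^sup>2 \<le> bexp E p (\<lambda>S. (N S)\<^sup>2) * bexp E p (\<lambda>S. (of_bool (\<exists>x\<in>I. A x S))\<^sup>2)"
    unfolding M by (rule bexp_CS[OF p])
  also have "bexp E p (\<lambda>S. (of_bool (\<exists>x\<in>I. A x S))\<^sup>2) = ?P"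
    unfolding bprob_def by (rule bexp_cong) simp
  finally have 1: "M\<^sup>2 \<le> (M\<^sup>2 + m * K) * ?P"
    using cov bprob_nonneg[OF p] unfolding sq M_def[symmetric]
    by (meson mult_right_mono order_trans)
  have mM: "m \<le> M" using m by (simp add: M_def)
  have pos: "0 < M\<^sup>2 + m * K" using m mM K by (intro add_pos_pos) auto
  have "m / (m + K) \<le> M\<^sup>2 / (M\<^sup>2 + m * K)"
  proof -
    have "m * (M\<^sup>2 + m * K) \<le> M\<^sup>2 * (m + K)"
      using mult_mono[OF mM mM] m K mM by (simp add: algebra_simps power2_eq_square mult_right_mono)
    then show ?thesis using m K pos by (simp add: divide_simps mult.commute)
  qed
  also have "\<dots> \<le> ?P" using 1 pos by (simp add: divide_simps mult.commute)
  finally show ?thesis .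
qed

definition box_edges :: "nat \<Rightarrow> (nat \<Rightarrow> int) set \<Rightarrow> (nat \<Rightarrow> int) set set" where
  "box_edges d V = edges d \<inter> Pow V"

lemma finite_box_edges: "finite V \<Longrightarrow> finite (box_edges d V)"
  by (simp add: box_edges_def)

lemma finite_rect: "finite (rect d n h)"
  unfolding rect_def by (intro finite_PiE) auto

definition crossing :: "nat \<Rightarrow> nat \<Rightarrow> nat \<Rightarrow> (nat \<Rightarrow> int) set set \<Rightarrow> bool" where
  "crossing d n h S \<longleftrightarrow> (\<exists>x\<in>rect d n h. \<exists>y\<in>rect d n h. x 0 = 0 \<and> y 0 = int n \<and> conn S x y)"

lemma rect_iff: "0 < d \<Longrightarrow> x \<in> rect d n h \<longleftrightarrow>
    x \<in> lattice d \<and> x 0 \<in> {0..int n} \<and> (\<forall>i\<in>{1..<d}. x i \<in> {0..int h})"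
  unfolding rect_def lattice_def PiE_iff by (auto split: if_splits)

definition side :: "nat \<Rightarrow> int \<Rightarrow> int \<Rightarrow> (nat \<Rightarrow> int) set" where
  "side d k l = (\<Pi>\<^sub>E i\<in>{..<d}. if i = 0 then {0} else {k..l})"

lemma finite_side: "finite (side d k l)"
  unfolding side_def by (intro finite_PiE) auto

lemma card_side: "0 < d \<Longrightarrow> card (side d k l) = nat (l - k + 1) ^ (d - 1)"
proof -
  assume d: "0 < d"
  have "card (side d k l) = (\<Prod>i<d. card (if i = 0 then {0} else {k..l}))"
    unfolding side_def by (rule card_PiE) simp
  also have "\<dots> = (\<Prod>i\<in>{..<d} - {0}. card (if i = 0 then {0} else {k..l}))"
    using d by (subst prod.remove[of _ 0]) auto
  also have "\<dots> = (\<Prod>i\<in>{..<d} - {0}. nat (l - k + 1))"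
    by (rule prod.cong) auto
  finally show ?thesis using d by simp
qed

lemma side_iff: "0 < d \<Longrightarrow> x \<in> side d k l \<longleftrightarrow> x \<in> level d 0 \<and> (\<forall>i\<in>{1..<d}. x i \<in> {k..l})"
  unfolding side_def level_def lattice_def PiE_iff by (auto split: if_splits)

section \<open>Crossings confined to a tube\<close>

context perc
begin

lemma rect_edges_slab: "box_edges d (rect d n h) \<subseteq> slab n"
  using rect_iff[OF d_pos] by (fastforce simp: box_edges_def slab_def)

text \<open>Half-width \<open>2 * n\<close> is chosen so that leaving the tube costs
  \<open>exp (- 2 * r * n)\<close>, negligible against the order \<open>exp (- r * n)\<close> of
  \<open>cross n\<close>; half-width \<open>n\<close> would only give the same order. The first
  coordinate is left to \<open>slab\<close>.\<close>

definition tube :: "nat \<Rightarrow> (nat \<Rightarrow> int) set" where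
  "tube n = {v. \<forall>i\<in>{1..<d}. \<bar>v i\<bar> \<le> 2 * int n}"

definition tube_cross :: "nat \<Rightarrow> real" where
  "tube_cross n = lprob p (slab n \<inter> Pow (tube n)) (\<lambda>S. \<exists>y\<in>level d (int n) \<inter> tube n. conn S org y)"

lemma slab_reach_le_cross:
  assumes "u \<in> level d 0"
  shows "lprob p (slab n) (\<lambda>S. \<exists>y\<in>level d (int n). conn S u y) \<le> cross n"
  unfolding cross_def
proof (rule lprob_slab_shift[OF assms])
  let ?g = "shift d (\<lambda>i. - u i)"
  fix S assume "\<exists>y\<in>level d (int n). conn S u y"
  then obtain y where y: "y \<in> level d (int n)" "conn S u y" by blast
  have "?g y \<in> level d (int n)" using y(1) assms d_pos by (simp add: level_def shift_apply)
  then show "\<exists>y\<in>level d (int n). conn ((`) ?g ` S) org y"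
    using conn_image[OF y(2), of ?g] by (auto simp: shift_neg)
qed

text \<open>A starting vertex at distance at least \<open>2 * n\<close> from the lateral sides keeps
  the translated tube inside the rectangle.\<close>

lemma tube_cross_le:
  assumes "x \<in> side d (2 * int n) (int h - 2 * int n)"
  shows "tube_cross n \<le> bprob (box_edges d (rect d n h)) p (\<lambda>S. \<exists>y\<in>level d (int n) \<inter> rect d n h. conn S x y)"
proof -
  define g where "g = shift d x"
  let ?E = "box_edges d (rect d n h)"
  have x: "x \<in> lattice d" "x 0 = 0" "\<And>i. i \<in> {1..<d} \<Longrightarrow> x i \<in> {2 * int n..int h - 2 * int n}"
    using assms by (auto simp: side_iff[OF d_pos] level_def)
  have gorg: "g org = x"
    using x(1) by (simp add: g_def)
  have g0: "g v 0 = v 0" for v using x d_pos by (simp add: g_def shift_apply)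
  have gi: "g v i = v i + x i" if "i < d" for v i using that by (simp add: g_def shift_apply)
  have grect: "g v \<in> rect d n h" if "v \<in> tube n" "v 0 \<in> {0..int n}" for v
  proof -
    have "g v i \<in> {0..int h}" if i: "i \<in> {1..<d}" for i
    proof -
      have "\<bar>v i\<bar> \<le> 2 * int n" using \<open>v \<in> tube n\<close> i by (simp add: tube_def)
      then show ?thesis using x(3)[OF i] gi[of i v] i by auto
    qed
    then show ?thesis using that(2) g0 by (simp add: rect_iff[OF d_pos]) (simp add: g_def)
  qed
  have "tube_cross n \<le> lprob p ?E (\<lambda>S. \<exists>y\<in>level d (int n) \<inter> rect d n h. conn S x y)"
    unfolding tube_cross_def
  proof (rule lprob_image[OF p01])
    show "inj_on ((`) g) (slab n \<inter> Pow (tube n))"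
      unfolding g_def using slab_edges by (intro shift_inj) auto
    have "g ` e \<in> ?E" if e: "e \<in> slab n \<inter> Pow (tube n)" for e
    proof -
      have "g ` e \<in> edges d" using e slab_edges unfolding g_def by (auto intro: shift_edges)
      moreover have "g ` e \<subseteq> rect d n h" using e by (auto simp: slab_def intro!: grect)
      ultimately show ?thesis by (simp add: box_edges_def)
    qed
    then show "(`) g ` (slab n \<inter> Pow (tube n)) \<subseteq> ?E" by blast
  next
    fix S assume "\<exists>y\<in>level d (int n) \<inter> tube n. conn S org y"
    then obtain y where y: "y \<in> level d (int n)" "y \<in> tube n" "conn S org y" by blast
    have "g y \<in> level d (int n) \<inter> rect d n h"
      using y g0 grect[of y] by (simp add: level_def) (simp add: g_def)
    then show "\<exists>y\<in>level d (int n) \<inter> rect d n h. conn ((`) g ` S) x y"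
      using conn_image[OF y(3), of g] gorg by auto
  qed
  also have "\<dots> \<le> bprob ?E p (\<lambda>S. \<exists>y\<in>level d (int n) \<inter> rect d n h. conn S x y)"
    by (rule lprob_le) (intro bprob_mono_set p01 finite_box_edges finite_rect, auto)
  finally show ?thesis .
qed

text \<open>The straight segment along the axis. The bound serves the finitely many small
  \<open>n\<close> in \<open>tube_cross_lower\<close>, where leaving the tube is not yet
  negligible.\<close>

lemma tube_cross_pos: "p ^ n \<le> tube_cross n"
proof -
  define F where "F = (\<lambda>k. {axis_point d k, axis_point d (Suc k)}) ` {..<n}"
  have conn: "k \<le> n \<Longrightarrow> conn F org (axis_point d k)" for k
  proof (induction k)
    case (Suc k)
    have "conn F (axis_point d k) (axis_point d (Suc k))"
      using Suc.prems by (intro conn_edge) (auto simp: F_def)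
    then show ?case using Suc conn_trans by auto
  qed simp
  have ax: "axis_point d k 0 = int k" "i \<in> {1..<d} \<Longrightarrow> axis_point d k i = 0" for k i
    using d_pos by (auto simp: axis_point_def)
  have axt: "axis_point d k \<in> tube n" for k by (simp add: tube_def ax del: atLeastLessThan_iff)
  have "F \<subseteq> slab n \<inter> Pow (tube n)"
    using axis_edge[OF d_pos] axt by (auto simp: F_def slab_def ax)
  moreover have finF: "finite F" by (simp add: F_def)
  moreover have "\<exists>y\<in>level d (int n) \<inter> tube n. conn F org y"
    using conn[of n] axt by (intro bexI[of _ "axis_point d n"]) (auto simp: level_def ax)
  ultimately have "p ^ card F \<le> tube_cross n"
    unfolding tube_cross_def by (intro order_trans[OF bprob_pos lprob_ge] p01) auto
  moreover have "p ^ n \<le> p ^ card F"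
    using card_image_le[of "{..<n}" "\<lambda>k. {axis_point d k, axis_point d (Suc k)}"] p01
    by (intro power_decreasing) (auto simp: F_def)
  ultimately show ?thesis by simp
qed

end

context perc_decay
begin

lemma crossing_upper:
  "bprob (box_edges d (rect d n h)) p (crossing d n h) \<le> real (h + 1) ^ (d - 1) * (exp (- r * real (n + 1)) / p)"
proof -
  let ?E = "box_edges d (rect d n h)" and ?L = "side d 0 (int h)"
  have "bprob ?E p (crossing d n h) \<le> bprob ?E p (\<lambda>S. \<exists>x\<in>?L. \<exists>y\<in>level d (int n). conn S x y)"
  proof (rule bprob_mono[OF p01])
    fix S assume "crossing d n h S"
    then obtain x y where "x \<in> rect d n h" "y \<in> rect d n h" "x 0 = 0" "y 0 = int n" "conn S x y"
      by (auto simp: crossing_def)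
    then show "\<exists>x\<in>?L. \<exists>y\<in>level d (int n). conn S x y"
      by (intro bexI[of _ x] bexI[of _ y]) (auto simp: rect_iff[OF d_pos] side_iff[OF d_pos] level_def)
  qed
  also have "\<dots> \<le> (\<Sum>x\<in>?L. bprob ?E p (\<lambda>S. \<exists>y\<in>level d (int n). conn S x y))"
    by (rule bprob_Bex[OF p01 finite_side])
  also have "\<dots> \<le> (\<Sum>x\<in>?L. exp (- r * real (n + 1)) / p)"
  proof (rule sum_mono)
    fix x assume "x \<in> ?L"
    then have x: "x \<in> level d 0" by (simp add: side_iff[OF d_pos])
    have "bprob ?E p (\<lambda>S. \<exists>y\<in>level d (int n). conn S x y) \<le> lprob p (slab n) (\<lambda>S. \<exists>y\<in>level d (int n). conn S x y)"
      by (rule lprob_ge[OF p01 finite_box_edges[OF finite_rect] rect_edges_slab])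
    also have "\<dots> \<le> cross n" by (rule slab_reach_le_cross[OF x])
    also have "\<dots> \<le> exp (- r * real (n + 1)) / p"
      using cross_upper[of n] p_pos by (simp add: field_simps)
    finally show "bprob ?E p (\<lambda>S. \<exists>y\<in>level d (int n). conn S x y) \<le> exp (- r * real (n + 1)) / p" .
  qed
  also have "\<dots> = real (h + 1) ^ (d - 1) * (exp (- r * real (n + 1)) / p)"
    using card_side[OF d_pos, of 0 "int h"] by (simp add: nat_add_distrib)
  finally show ?thesis .
qed

text \<open>Either the whole cluster of the origin stays in the tube, or it meets one of the at most
  \<open>2 * (d - 1)\<close> lateral hyperplanes at distance \<open>2 * n\<close>, each reached with
  probability at most \<open>G (2 * n)\<close>.\<close>

lemma cross_le_tube_cross: "cross n \<le> tube_cross n + 2 * real d * G (2 * n)"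
  unfolding cross_def
proof (rule lprob_le)
  fix F assume F: "finite F" "F \<subseteq> slab n"
  have Fe: "F \<subseteq> edges d" using F slab_edges by auto
  define V where "V = insert org (\<Union>F)"
  have V: "finite V" "V \<subseteq> lattice d" unfolding V_def
    using finite_Union_edges[OF F(1) Fe] vertices_lattice[OF Fe] by auto
  define I where "I = {1..<d} \<times> {2 * int n, - 2 * int n}"
  define W where "W q = {w \<in> V. w (fst q) = snd q}" for q :: "nat \<times> int"
  have finW: "finite (W q)" for q using V by (simp add: W_def)
  have "bprob F p (\<lambda>S. \<exists>y\<in>level d (int n). conn S org y)
    \<le> bprob F p (\<lambda>S. (\<exists>y\<in>level d (int n) \<inter> tube n. conn (S \<inter> Pow (tube n)) org y)
        \<or> (\<exists>q\<in>I. \<exists>w\<in>W q. conn S org w))"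
  proof (rule bprob_mono[OF p01])
    fix S assume S: "S \<subseteq> F" "\<exists>y\<in>level d (int n). conn S org y"
    then obtain y where y: "y \<in> level d (int n)" "conn S org y" by blast
    show "(\<exists>y\<in>level d (int n) \<inter> tube n. conn (S \<inter> Pow (tube n)) org y) \<or> (\<exists>q\<in>I. \<exists>w\<in>W q. conn S org w)"
    proof (cases "\<forall>v. conn S org v \<longrightarrow> v \<in> tube n")
      case True
      have "conn (S \<inter> Pow (tube n)) org y"
        using True by (intro conn_mono[OF conn_within_cluster[OF y(2)]]) auto
      then show ?thesis using y True by auto
    next
      case False
      then obtain v i where v: "conn S org v" "i \<in> {1..<d}" "2 * int n < \<bar>v i\<bar>"
        by (auto simp: tube_def not_le)
      \<comment> \<open>The sign makes the excursion an upward one, so that one application of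
        \<open>conn_through_level\<close> covers both lateral sides.\<close>
      define s :: int where "s = (if 0 \<le> v i then 1 else - 1)"
      have step: "\<bar>s * a i - s * b i\<bar> \<le> 1" if "{a, b} \<in> S" for a b
        using edges_coord[of a b d i] that S(1) Fe v(2) by (auto simp: s_def)
      have "s * org i \<le> 2 * int n" "2 * int n \<le> s * v i"
        using v by (auto simp: s_def origin_apply)
      then obtain w where w: "s * w i = 2 * int n" "disj_occ (\<lambda>S. conn S org w) (\<lambda>S. conn S w v) S"
        using conn_through_level[OF v(1), of "\<lambda>v. s * v i" "2 * int n"] step by blast
      then have "conn S org w" by (auto simp: disj_occ_def intro: conn_mono)
      moreover from this have "w \<in> V" using conn_mem[of S org w] S(1) by (auto simp: V_def)
      moreover have "w i = 2 * int n \<or> w i = - 2 * int n"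
        using w(1) by (auto simp: s_def split: if_splits)
      ultimately show ?thesis using v(2)
        by (intro disjI2 bexI[of _ "(i, w i)"] bexI[of _ w]) (auto simp: I_def W_def)
    qed
  qed
  also have "\<dots> \<le> bprob F p (\<lambda>S. \<exists>y\<in>level d (int n) \<inter> tube n. conn (S \<inter> Pow (tube n)) org y)
      + bprob F p (\<lambda>S. \<exists>q\<in>I. \<exists>w\<in>W q. conn S org w)"
    by (rule bprob_disj[OF p01])
  also have "bprob F p (\<lambda>S. \<exists>y\<in>level d (int n) \<inter> tube n. conn (S \<inter> Pow (tube n)) org y) \<le> tube_cross n"
  proof -
    have "bprob F p (\<lambda>S. \<exists>y\<in>level d (int n) \<inter> tube n. conn (S \<inter> Pow (tube n)) org y)
        = bprob (F \<inter> Pow (tube n)) p (\<lambda>S. \<exists>y\<in>level d (int n) \<inter> tube n. conn S org y)"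
      by (rule bprob_Int[OF F(1)])
    also have "\<dots> \<le> tube_cross n"
      unfolding tube_cross_def by (intro lprob_ge p01) (use F in auto)
    finally show ?thesis .
  qed
  also have "bprob F p (\<lambda>S. \<exists>q\<in>I. \<exists>w\<in>W q. conn S org w) \<le> 2 * real d * G (2 * n)"
  proof -
    have "bprob F p (\<lambda>S. \<exists>q\<in>I. \<exists>w\<in>W q. conn S org w) \<le> (\<Sum>q\<in>I. bprob F p (\<lambda>S. \<exists>w\<in>W q. conn S org w))"
      by (rule bprob_Bex[OF p01]) (simp add: I_def)
    also have "\<dots> \<le> (\<Sum>q\<in>I. G (2 * n))"
    proof (rule sum_mono)
      fix q assume q: "q \<in> I"
      then have i: "fst q < d" "nat \<bar>snd q - org (fst q)\<bar> = 2 * n" by (auto simp: I_def origin_apply)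
      have "bprob F p (\<lambda>S. \<exists>w\<in>W q. conn S org w) \<le> (\<Sum>w\<in>W q. bprob F p (\<lambda>S. conn S org w))"
        by (rule bprob_Bex[OF p01 finW])
      also have "\<dots> \<le> (\<Sum>w\<in>W q. tau d p org w)" by (intro sum_mono tau_ge p01 F Fe)
      also have "\<dots> \<le> G (nat \<bar>snd q - org (fst q)\<bar>)"
        by (rule sum_tau_le_G) (use i finW V in \<open>auto simp: W_def\<close>)
      finally show "bprob F p (\<lambda>S. \<exists>w\<in>W q. conn S org w) \<le> G (2 * n)" using i by simp
    qed
    also have "\<dots> = real (card I) * G (2 * n)" by simp
    also have "\<dots> \<le> 2 * real d * G (2 * n)"
    proof -
      have "card I \<le> (d - 1) * 2"
        unfolding I_def card_cartesian_product by (auto intro!: mult_le_mono card_insert_le_m1)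
      then have "real (card I) \<le> 2 * real d" by linarith
      then show ?thesis using G_pos[of "2 * n"] by (intro mult_right_mono) auto
    qed
    finally show ?thesis .
  qed
  finally show "bprob F p (\<lambda>S. \<exists>y\<in>level d (int n). conn S org y) \<le> tube_cross n + 2 * real d * G (2 * n)"
    by simp
qed

text \<open>For large \<open>n\<close> the error \<open>2 * d * G (2 * n)\<close> is at most half of
  the lower bound for \<open>cross n\<close>. The remaining \<open>n\<close> lie below a threshold
  \<open>N\<close>, where \<open>p ^ N\<close> is a lower bound.\<close>

lemma tube_cross_lower: "\<exists>c>0. \<forall>n. c * exp (- r * real n) \<le> tube_cross n"
proof -
  obtain D where D: "0 < D" "\<And>n. G n \<le> D * exp (- r * real n)" using G_upper by blast
  obtain c where c: "0 < c" "\<And>n. c * exp (- r * real n) \<le> cross n" using cross_lower by blast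
  have "(\<lambda>n. 2 * real d * D * exp (- r) ^ n) \<longlonglongrightarrow> 2 * real d * D * 0"
    using rate_pos by (intro tendsto_intros LIMSEQ_power_zero) auto
  then have "\<forall>\<^sub>F n in sequentially. 2 * real d * D * exp (- r) ^ n < c / 2"
    using c by (intro order_tendstoD) auto
  then obtain N where N: "\<And>n. N \<le> n \<Longrightarrow> 2 * real d * D * exp (- r) ^ n < c / 2"
    by (auto simp: eventually_sequentially)
  define c' where "c' = min (c / 2) (p ^ N)"
  have "c' * exp (- r * real n) \<le> tube_cross n" for n
  proof (cases "N \<le> n")
    case True
    have e: "exp (- r) ^ n = exp (- r * real n)" by (simp add: exp_of_nat_mult[symmetric] mult.commute)
    have "2 * real d * G (2 * n) \<le> 2 * real d * (D * exp (- r * real (2 * n)))"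
      by (intro mult_left_mono D) auto
    also have "\<dots> = (2 * real d * D * exp (- r) ^ n) * exp (- r * real n)"
      unfolding e by (simp add: exp_add[symmetric] mult.assoc)
    also have "\<dots> \<le> c / 2 * exp (- r * real n)"
      using N[OF True] by (intro mult_right_mono) auto
    finally have "c * exp (- r * real n) \<le> tube_cross n + c / 2 * exp (- r * real n)"
      using cross_le_tube_cross[of n] c(2)[of n] by linarith
    moreover have "c' * exp (- r * real n) \<le> c / 2 * exp (- r * real n)"
      by (intro mult_right_mono) (auto simp: c'_def)
    ultimately show ?thesis by linarith
  next
    case False
    have "c' * exp (- r * real n) \<le> p ^ N * 1"
      using rate_pos p_nonneg c by (intro mult_mono) (auto simp: c'_def)
    also have "\<dots> \<le> p ^ n" using False p01 by (simp add: power_decreasing)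
    also have "\<dots> \<le> tube_cross n" by (rule tube_cross_pos)
    finally show ?thesis .
  qed
  moreover have "0 < c'" using c p_pos by (simp add: c'_def)
  ultimately show ?thesis by blast
qed

text \<open>The tree-graph inequality with the faces exchanged: two ends, \<open>x\<close> and
  \<open>x'\<close>, lie at level 0 and one at level \<open>n\<close>. This bounds the part of the
  variance that comes from pairs in a common cluster.\<close>

lemma connected_pair_le:
  assumes x: "x \<in> level d 0" and I: "finite I" "I \<subseteq> level d 0"
    and Y: "finite Y" "Y \<subseteq> level d (int n)" and F: "finite F" "F \<subseteq> slab n"
  shows "(\<Sum>x'\<in>I. bprob F p (\<lambda>S. (\<exists>y\<in>Y. conn S x y) \<and> conn S x x')) \<le> second_moment n"
proof -
  have Fe: "F \<subseteq> edges d" using F slab_edges by auto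
  have xl: "x \<in> lattice d" "x 0 = 0" using x by (auto simp: level_def)
  define W where "W = insert x (\<Union>F)"
  have W: "finite W" "W \<subseteq> lattice d" unfolding W_def
    using finite_Union_edges[OF F(1) Fe] Fe edges_lattice xl by auto
  have W0: "w 0 \<in> {0..int n}" if "w \<in> W" for w
    using slab_coord[OF F(2), of x w] that xl by (simp add: W_def)
  have "(\<Sum>x'\<in>I. bprob F p (\<lambda>S. (\<exists>y\<in>Y. conn S x y) \<and> conn S x x'))
      \<le> (\<Sum>x'\<in>I. \<Sum>y\<in>Y. bprob F p (\<lambda>S. conn S x y \<and> conn S x x'))"
    using bprob_Bex[OF p01 Y(1), of F "\<lambda>y S. conn S x y \<and> conn S x x'" for x'] by (intro sum_mono) simp
  also have "\<dots> \<le> (\<Sum>x'\<in>I. \<Sum>y\<in>Y. \<Sum>w\<in>W. tau d p x w * tau d p w y * tau d p w x')"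
    unfolding W_def by (intro sum_mono tau_tree F Fe)
  also have "\<dots> = (\<Sum>x'\<in>I. \<Sum>w\<in>W. \<Sum>y\<in>Y. tau d p x w * tau d p w y * tau d p w x')"
    by (intro sum.cong refl sum.swap)
  also have "\<dots> = (\<Sum>w\<in>W. \<Sum>x'\<in>I. \<Sum>y\<in>Y. tau d p x w * tau d p w y * tau d p w x')"
    by (rule sum.swap)
  also have "\<dots> = (\<Sum>w\<in>W. tau d p x w * ((\<Sum>y\<in>Y. tau d p w y) * (\<Sum>x'\<in>I. tau d p w x')))"
    unfolding sum_product by (subst sum.swap[of _ I]) (simp add: sum_distrib_left mult.assoc sum.swap[of _ I])
  also have "\<dots> \<le> (\<Sum>w\<in>W. tau d p x w * (G (n - nat (w 0)) * G (nat (w 0))))"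
  proof (intro sum_mono mult_left_mono mult_mono tau_nonneg p01 sum_nonneg)
    fix w assume w: "w \<in> W"
    then have eq: "nat \<bar>int n - w 0\<bar> = n - nat (w 0)" "nat \<bar>0 - w 0\<bar> = nat (w 0)" using W0[OF w] by auto
    have wl: "w \<in> lattice d" using w W(2) by blast
    then show "(\<Sum>y\<in>Y. tau d p w y) \<le> G (n - nat (w 0))"
      unfolding eq(1)[symmetric] using Y by (rule sum_tau_level_le_G)
    show "(\<Sum>y\<in>I. tau d p w y) \<le> G (nat (w 0))"
      using sum_tau_level_le_G[OF wl I] unfolding eq(2) .
    show "0 \<le> G (n - nat (w 0))" using G_pos by (rule less_imp_le)
  qed
  also have "\<dots> \<le> (\<Sum>k\<le>n. G k * (G (n - k) * G k))"
    unfolding W_def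
    by (rule sum_by_level_le[OF x F, of "\<lambda>k. G (n - k) * G k"]) (simp add: G_pos less_imp_le)
  \<comment> \<open>Reversing the levels by \<open>n - k\<close> exchanges the two faces.\<close>
  also have "\<dots> = second_moment n"
    unfolding second_moment_def power2_eq_square
    by (rule sum.reindex_bij_witness[of _ "\<lambda>k. n - k" "\<lambda>k. n - k"]) auto
  finally show ?thesis .
qed

text \<open>Count the vertices of \<open>I\<close> joined to the right face. For a pair in different
  clusters the two events occur disjointly, and BK bounds their joint probability by the product.
  Only pairs in a common cluster add to the variance, in total at most
  \<open>real (card I) * second_moment n\<close>, which is of the order of \<open>m\<close>.\<close>

lemma crossing_lower: "\<exists>c>0. \<forall>n h. 0 < n \<longrightarrow> 6 * n \<le> h \<longrightarrow>
  Phi (c * real h ^ (d - 1) * exp (- r * real n)) \<le> bprob (box_edges d (rect d n h)) p (crossing d n h)"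
proof -
  obtain c where c: "0 < c" "\<And>n. c * exp (- r * real n) \<le> tube_cross n" using tube_cross_lower by blast
  obtain M where M: "0 < M" "\<And>n. second_moment n \<le> M * exp (- r * real n)" using second_moment_upper by blast
  \<comment> \<open>Chosen so that \<open>t * (M / c)\<close> below is
    \<open>c * exp (- r * n) * (h / 3) ^ (d - 1)\<close>, hence at most \<open>m\<close>.\<close>
  define c' where "c' = c\<^sup>2 / (M * 3 ^ (d - 1))"
  have c': "0 < c'" using c M by (simp add: c'_def)
  have "Phi (c' * real h ^ (d - 1) * exp (- r * real n)) \<le> bprob (box_edges d (rect d n h)) p (crossing d n h)"
    if n: "0 < n" and h: "6 * n \<le> h" for n h
  proof -
    let ?E = "box_edges d (rect d n h)"
    define I where "I = side d (2 * int n) (int h - 2 * int n)"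
    define Y where "Y = level d (int n) \<inter> rect d n h"
    define A where "A x S \<longleftrightarrow> (\<exists>y\<in>Y. conn S x y)" for x S
    have finE: "finite ?E" by (rule finite_box_edges[OF finite_rect])
    have Eslab: "?E \<subseteq> slab n" by (rule rect_edges_slab)
    have I: "finite I" "I \<subseteq> level d 0" "I \<subseteq> rect d n h"
      unfolding I_def by (simp_all add: finite_side) (fastforce simp: side_iff[OF d_pos] rect_iff[OF d_pos] level_def)+
    have Y: "finite Y" "Y \<subseteq> level d (int n)" unfolding Y_def using finite_rect by auto
    define m where "m = real (card I) * c * exp (- r * real n)"
    have cardI: "(real h / 3) ^ (d - 1) \<le> real (card I)"
    proof -
      have "card I = nat (int h - 2 * int n - 2 * int n + 1) ^ (d - 1)"
        unfolding I_def by (rule card_side[OF d_pos])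
      \<comment> \<open>\<open>6 * n \<le> h\<close> means that the two margins, together
        \<open>4 * n\<close>, take up at most two thirds of \<open>h\<close>.\<close>
      moreover have "real h / 3 \<le> real (nat (int h - 2 * int n - 2 * int n + 1))" using h by linarith
      ultimately show ?thesis by (simp add: power_mono)
    qed
    moreover have "0 < (real h / 3) ^ (d - 1)" using n h by simp
    ultimately have "0 < real (card I)" by linarith
    then have m: "0 < m" using c by (simp add: m_def)
    have EA: "c * exp (- r * real n) \<le> bprob ?E p (A x)" if "x \<in> I" for x
      using c(2)[of n] tube_cross_le[of x n h] that unfolding I_def A_def Y_def by linarith
    have mE: "m \<le> (\<Sum>x\<in>I. bprob ?E p (A x))"
      using sum_mono[of I "\<lambda>_. c * exp (- r * real n)", OF EA] by (simp add: m_def mult.assoc)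
    have pair: "bprob ?E p (\<lambda>S. A x S \<and> A x' S)
        \<le> bprob ?E p (A x) * bprob ?E p (A x') + bprob ?E p (\<lambda>S. A x S \<and> conn S x x')" for x x'
    proof -
      have "bprob ?E p (\<lambda>S. A x S \<and> A x' S)
          \<le> bprob ?E p (\<lambda>S. disj_occ (A x) (A x') S \<or> (A x S \<and> conn S x x'))"
      proof (rule bprob_mono[OF p01])
        fix S assume S: "S \<subseteq> ?E" "A x S \<and> A x' S"
        have "{} \<notin> S" using S(1) empty_notin_edges by (auto simp: box_edges_def)
        then show "disj_occ (A x) (A x') S \<or> (A x S \<and> conn S x x')"
          using conn_disjoint_clusters[of Y S x x'] S(2) unfolding A_def[abs_def] by blast
      qed
      also have "\<dots> \<le> bprob ?E p (disj_occ (A x) (A x')) + bprob ?E p (\<lambda>S. A x S \<and> conn S x x')"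
        by (rule bprob_disj[OF p01])
      also have "bprob ?E p (disj_occ (A x) (A x')) \<le> bprob ?E p (A x) * bprob ?E p (A x')"
        unfolding A_def[abs_def] by (rule bk[OF p01 finE]) auto
      finally show ?thesis by simp
    qed
    have "(\<Sum>x\<in>I. \<Sum>x'\<in>I. bprob ?E p (\<lambda>S. A x S \<and> A x' S))
        \<le> (\<Sum>x\<in>I. \<Sum>x'\<in>I. bprob ?E p (A x) * bprob ?E p (A x') + bprob ?E p (\<lambda>S. A x S \<and> conn S x x'))"
      by (intro sum_mono pair)
    also have "\<dots> = (\<Sum>x\<in>I. bprob ?E p (A x))\<^sup>2 + (\<Sum>x\<in>I. \<Sum>x'\<in>I. bprob ?E p (\<lambda>S. A x S \<and> conn S x x'))"
      by (simp add: sum.distrib power2_eq_square sum_product)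
    also have "(\<Sum>x\<in>I. \<Sum>x'\<in>I. bprob ?E p (\<lambda>S. A x S \<and> conn S x x')) \<le> (\<Sum>x\<in>I. second_moment n)"
      unfolding A_def using I(2) by (intro sum_mono connected_pair_le I Y finE Eslab) auto
    also have "\<dots> \<le> real (card I) * (M * exp (- r * real n))"
      using M(2)[of n] by (simp add: mult_left_mono)
    also have "\<dots> = m * (M / c)" using c by (simp add: m_def)
    finally have cov: "(\<Sum>x\<in>I. \<Sum>x'\<in>I. bprob ?E p (\<lambda>S. A x S \<and> A x' S))
        \<le> (\<Sum>x\<in>I. bprob ?E p (A x))\<^sup>2 + m * (M / c)" by simp
    have Mc: "0 < M / c" using M c by simp
    define t where "t = c' * real h ^ (d - 1) * exp (- r * real n)"
    have t0: "0 \<le> t" using c' by (simp add: t_def)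
    have tm: "t * (M / c) \<le> m"
    proof -
      have "t * (M / c) = c * exp (- r * real n) * (real h / 3) ^ (d - 1)"
        using c M by (simp add: t_def c'_def power_divide power2_eq_square)
      also have "\<dots> \<le> c * exp (- r * real n) * real (card I)"
        using cardI c by (intro mult_left_mono) auto
      finally show ?thesis by (simp add: m_def mult_ac)
    qed
    have "Phi t \<le> m / (m + M / c)"
    proof -
      have "t * (m + M / c) \<le> m * (t + 1)" using tm by (simp add: algebra_simps)
      moreover have "0 < t + 1" "0 < m + M / c" using t0 m Mc by linarith+
      ultimately show ?thesis unfolding Phi_def
        by (simp only: pos_divide_le_eq pos_le_divide_eq times_divide_eq_left)
    qed
    also have "\<dots> \<le> bprob ?E p (\<lambda>S. \<exists>x\<in>I. A x S)"
      by (rule second_moment_method[OF p01 finE I(1) cov m mE Mc])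
    also have "\<dots> \<le> bprob ?E p (crossing d n h)"
    proof (rule bprob_mono[OF p01])
      fix S assume "\<exists>x\<in>I. A x S"
      then obtain x y where "x \<in> I" "y \<in> Y" "conn S x y" by (auto simp: A_def)
      moreover from this have "x \<in> rect d n h" "x 0 = 0" "y \<in> rect d n h" "y 0 = int n"
        using I by (auto simp: Y_def level_def)
      ultimately show "crossing d n h S" unfolding crossing_def by blast
    qed
    finally show ?thesis by (simp add: t_def)
  qed
  then show ?thesis using c' by blast
qed

end

section \<open>Sharpness of the phase transition\<close>

definition boundary :: "nat \<Rightarrow> (nat \<Rightarrow> int) set \<Rightarrow> ((nat \<Rightarrow> int) \<times> (nat \<Rightarrow> int)) set" where
  "boundary d T = {(u, v). u \<in> T \<and> v \<notin> T \<and> {u, v} \<in> edges d}"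

text \<open>The functional of Duminil-Copin and Tassion without its factor \<open>p\<close>. That
  factor belongs to an open exit edge, as in \<open>simon_lieb\<close>; in the derivative of
  \<open>theta\<close> the boundary edge is only pivotal.\<close>

definition exit_sum :: "nat \<Rightarrow> real \<Rightarrow> (nat \<Rightarrow> int) set \<Rightarrow> real" where
  "exit_sum d p T = (\<Sum>(u, v)\<in>boundary d T. bprob (box_edges d T) p (\<lambda>S. conn S (origin d) u))"

lemma finite_neighbours: "finite {v. {u, v} \<in> edges d}"
proof (rule finite_subset)
  show "{v. {u, v} \<in> edges d} \<subseteq> (\<Pi>\<^sub>E i\<in>{..<d}. {u i - 1..u i + 1})"
  proof
    fix v assume v: "v \<in> {v. {u, v} \<in> edges d}"
    then have "v \<in> lattice d" using edges_lattice by auto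
    moreover have "v i \<in> {u i - 1..u i + 1}" if "i < d" for i
      using edges_coord[of u v d i] v that by auto
    ultimately show "v \<in> (\<Pi>\<^sub>E i\<in>{..<d}. {u i - 1..u i + 1})"
      by (auto simp: lattice_def PiE_iff)
  qed
qed (intro finite_PiE, auto)

lemma finite_boundary: "finite T \<Longrightarrow> finite (boundary d T)"
  by (rule finite_subset[of _ "Sigma T (\<lambda>u. {v. {u, v} \<in> edges d})"])
    (auto simp: boundary_def finite_neighbours)

lemma bprob_member_le:
  assumes "0 \<le> p" "finite F"
  shows "bprob F p (\<lambda>S. e \<in> S) \<le> p"
proof (cases "e \<in> F")
  case True
  have "bprob F p (\<lambda>S. e \<in> S) = bexp F p (\<lambda>S. of_bool (e \<in> S \<inter> {e}))"
    unfolding bprob_def by (rule bexp_cong) simp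
  also have "\<dots> = bprob {e} p (\<lambda>S. e \<in> S)"
    unfolding bprob_def using True assms by (intro bexp_restrict) auto
  finally show ?thesis by (simp add: bprob_edge)
next
  case False
  then have "bprob F p (\<lambda>S. e \<in> S) = bprob F p (\<lambda>S. False)" by (intro bprob_cong) auto
  then show ?thesis using assms by (simp add: bprob_def bexp_def)
qed

context perc
begin

text \<open>The Simon-Lieb inequality: BK separates the part of a path before its first exit from
  \<open>T\<close>, the exit edge and the rest.\<close>

lemma simon_lieb:
  assumes "finite T" "org \<in> T" "y \<notin> T"
  shows "tau d p org y \<le>
    (\<Sum>(u, v)\<in>boundary d T. bprob (box_edges d T) p (\<lambda>S. conn S org u) * p * tau d p v y)"
  unfolding tau_def[of d p org y]
proof (rule lprob_le)
  fix F assume F: "finite F" "F \<subseteq> edges d"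
  let ?D = "\<lambda>u v. disj_occ (\<lambda>S. conn (S \<inter> Pow T) org u) (disj_occ (\<lambda>S. {u, v} \<in> S) (\<lambda>S. conn S v y))"
  have "bprob F p (\<lambda>S. conn S org y) \<le> bprob F p (\<lambda>S. \<exists>q\<in>boundary d T. ?D (fst q) (snd q) S)"
  proof (rule bprob_mono[OF p01])
    fix S assume S: "S \<subseteq> F" "conn S org y"
    obtain u v where uv: "u \<in> T" "v \<notin> T" "{u, v} \<in> S" "?D u v S"
      using conn_exit[OF S(2) assms(2,3)] by blast
    then have "(u, v) \<in> boundary d T" using S(1) F(2) by (auto simp: boundary_def)
    then show "\<exists>q\<in>boundary d T. ?D (fst q) (snd q) S" using uv by force
  qed
  also have "\<dots> \<le> (\<Sum>q\<in>boundary d T. bprob F p (?D (fst q) (snd q)))"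
    by (rule bprob_Bex[OF p01 finite_boundary[OF assms(1)]])
  also have "\<dots> \<le> (\<Sum>q\<in>boundary d T. bprob F p (\<lambda>S. conn (S \<inter> Pow T) org (fst q))
      * bprob F p (\<lambda>S. {fst q, snd q} \<in> S) * bprob F p (\<lambda>S. conn S (snd q) y))"
    by (intro sum_mono bk3[OF p01 F(1)]) auto
  also have "\<dots> \<le> (\<Sum>q\<in>boundary d T. bprob (box_edges d T) p (\<lambda>S. conn S org (fst q)) * p * tau d p (snd q) y)"
  proof (intro sum_mono mult_mono mult_nonneg_nonneg bprob_nonneg tau_nonneg p01 tau_ge F bprob_member_le)
    fix q :: "(nat \<Rightarrow> int) \<times> (nat \<Rightarrow> int)"
    have "bprob F p (\<lambda>S. conn (S \<inter> Pow T) org (fst q)) = bprob (F \<inter> Pow T) p (\<lambda>S. conn S org (fst q))"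
      by (rule bprob_Int[OF F(1)])
    also have "\<dots> \<le> bprob (box_edges d T) p (\<lambda>S. conn S org (fst q))"
      using F(2) by (intro bprob_mono_set p01 finite_box_edges assms(1)) (auto simp: box_edges_def)
    finally show "bprob F p (\<lambda>S. conn (S \<inter> Pow T) org (fst q)) \<le> bprob (box_edges d T) p (\<lambda>S. conn S org (fst q))" .
  qed
  finally show "bprob F p (\<lambda>S. conn S org y) \<le>
    (\<Sum>(u, v)\<in>boundary d T. bprob (box_edges d T) p (\<lambda>S. conn S org u) * p * tau d p v y)"
    by (simp add: case_prod_beta)
qed

text \<open>Each use of \<open>simon_lieb\<close> gains the factor \<open>\<phi> < 1\<close> and
  consumes at most \<open>R + 1\<close> of the distance in the first coordinate, so iterating it
  yields exponential decay.\<close>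

lemma rate_pos_if_exit_sum:
  assumes T: "finite T" "org \<in> T" and less: "p * exit_sum d p T < 1"
  shows "0 < r"
proof -
  define \<phi> where "\<phi> = p * exit_sum d p T"
  have \<phi>0: "0 \<le> \<phi>" unfolding \<phi>_def exit_sum_def
    using p_nonneg by (intro mult_nonneg_nonneg sum_nonneg) (auto intro: bprob_nonneg p01)
  define R where "R = nat (Max ((\<lambda>v. \<bar>v 0\<bar>) ` T))"
  have R: "\<bar>v 0\<bar> \<le> int R" if "v \<in> T" for v
  proof -
    have "\<bar>v 0\<bar> \<le> Max ((\<lambda>v. \<bar>v 0\<bar>) ` T)" using T that by (intro Max_ge) auto
    then show ?thesis unfolding R_def by linarith
  qed
  have decay: "tau d p org y \<le> \<phi> ^ k" if "y \<in> lattice d" "int (k * (R + 1)) < \<bar>y 0\<bar>" for k y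
    using that
  proof (induction k arbitrary: y)
    case 0
    then show ?case using tau_le_1[OF p01] by simp
  next
    case (Suc k)
    have kR: "int (Suc k * (R + 1)) = int (k * (R + 1)) + int R + 1" by simp
    have "y \<notin> T" using R[of y] Suc.prems(2) kR by auto
    then have "tau d p org y \<le> (\<Sum>(u, v)\<in>boundary d T. bprob (box_edges d T) p (\<lambda>S. conn S org u) * p * tau d p v y)"
      by (rule simon_lieb[OF T])
    also have "\<dots> \<le> (\<Sum>(u, v)\<in>boundary d T. bprob (box_edges d T) p (\<lambda>S. conn S org u) * p * \<phi> ^ k)"
    proof (rule sum_mono, clarify)
      fix u v assume uv: "(u, v) \<in> boundary d T"
      then have v: "u \<in> T" "{u, v} \<in> edges d" "v \<in> lattice d"
        using edges_lattice[of "{u, v}" d] by (auto simp: boundary_def)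
      define g where "g = shift d (\<lambda>i. - v i)"
      have gv: "g v = org" by (simp add: g_def shift_neg)
      have gy: "g y 0 = y 0 - v 0" using d_pos by (simp add: g_def shift_apply)
      have "\<bar>v 0\<bar> \<le> int R + 1" using edges_coord[OF v(2) d_pos] R[OF v(1)] by linarith
      then have "int (k * (R + 1)) < \<bar>g y 0\<bar>" using Suc.prems(2) kR gy by linarith
      then have "tau d p org (g y) \<le> \<phi> ^ k" by (intro Suc.IH) (simp add: g_def)
      moreover have "tau d p v y \<le> tau d p (g v) (g y)"
        unfolding g_def by (rule tau_shift[OF p01])
      ultimately have "tau d p v y \<le> \<phi> ^ k" using gv by simp
      then show "bprob (box_edges d T) p (\<lambda>S. conn S org u) * p * tau d p v y
          \<le> bprob (box_edges d T) p (\<lambda>S. conn S org u) * p * \<phi> ^ k"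
        by (intro mult_left_mono mult_nonneg_nonneg bprob_nonneg p01)
    qed
    also have "\<dots> = \<phi> ^ Suc k"
      unfolding \<phi>_def exit_sum_def by (simp add: case_prod_beta sum_distrib_left sum_distrib_right mult_ac)
    finally show ?case .
  qed
  \<comment> \<open>\<open>R + 2\<close> in place of \<open>R + 1\<close>, because
    \<open>decay\<close> requires a strict inequality.\<close>
  have ax: "axis_tau d p (n * (R + 2)) \<le> \<phi> ^ n" if "1 \<le> n" for n
    unfolding axis_tau_def
    using that d_pos by (intro decay) (auto simp: axis_point_def[abs_def] intro: axis_point_lattice[unfolded axis_point_def[abs_def]])
  have \<phi>pos: "0 < \<phi>" using ax[of 1] axis_tau_pos[of "1 * (R + 2)"] by simp
  \<comment> \<open>The infimum needs a bound at every \<open>n\<close>, while \<open>ax\<close>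
    covers only multiples of \<open>R + 2\<close>. Subadditivity of
    \<open>- ln (axis_tau d p n)\<close> passes from \<open>n * (R + 2)\<close> back to
    \<open>n\<close>.\<close>
  have mult: "f \<le> - ln (axis_tau d p n) / real n" if n: "n \<in> {1..}" and f: "f = - ln \<phi> / real (R + 2)" for n f
  proof -
    have "- ln (axis_tau d p (k * n)) \<le> real k * (- ln (axis_tau d p n))" if "1 \<le> k" for k
      using that
    proof (induction k rule: nat_induct_at_least)
      case (Suc k)
      then show ?case using neg_ln_axis_tau_subadd[of n "k * n"] by (simp add: algebra_simps)
    qed simp
    from this[of "R + 2"] have "- ln (axis_tau d p (n * (R + 2))) \<le> real (R + 2) * (- ln (axis_tau d p n))"
      by (simp add: mult.commute)
    moreover have "ln (axis_tau d p (n * (R + 2))) \<le> ln (\<phi> ^ n)"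
      using ax[of n] n axis_tau_pos \<phi>pos by (subst ln_le_cancel_iff) auto
    moreover have "ln (\<phi> ^ n) = real n * ln \<phi>" by (rule ln_realpow)
    ultimately have "real n * (- ln \<phi>) \<le> real (R + 2) * (- ln (axis_tau d p n))" by linarith
    then show ?thesis unfolding f using n
      by (simp add: divide_le_eq pos_le_divide_eq mult.commute del: of_nat_add)
  qed
  have "0 < - ln \<phi> / real (R + 2)" using less \<phi>pos unfolding \<phi>_def[symmetric]
    by (intro divide_pos_pos) auto
  also have "\<dots> \<le> r"
    unfolding decay_rate_def by (rule cINF_greatest) (use mult in auto)
  finally show ?thesis .
qed

end

section \<open>The differential inequality for the one-arm probability\<close>

definition cube :: "nat \<Rightarrow> nat \<Rightarrow> (nat \<Rightarrow> int) set" where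
  "cube d n = {v \<in> lattice d. \<forall>i<d. \<bar>v i\<bar> \<le> int n}"

definition cube_boundary :: "nat \<Rightarrow> nat \<Rightarrow> (nat \<Rightarrow> int) set" where
  "cube_boundary d n = {v \<in> cube d n. \<exists>i<d. \<bar>v i\<bar> = int n}"

definition reach :: "nat \<Rightarrow> nat \<Rightarrow> (nat \<Rightarrow> int) set set \<Rightarrow> bool" where
  "reach d n S \<longleftrightarrow> (\<exists>y\<in>cube_boundary d n. conn S (origin d) y)"

text \<open>As a finite sum it is a polynomial in \<open>t\<close>, so Russo's formula applies; its
  limit in \<open>n\<close> is the probability of an infinite cluster.\<close>

definition theta :: "nat \<Rightarrow> nat \<Rightarrow> real \<Rightarrow> real" where
  "theta d n t = bprob (box_edges d (cube d n)) t (reach d n)"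

lemma finite_cube: "finite (cube d n)"
proof (rule finite_subset)
  show "cube d n \<subseteq> (\<Pi>\<^sub>E i\<in>{..<d}. {- int n..int n})"
    by (auto simp: cube_def lattice_def PiE_iff abs_le_iff extensional_def)
qed (intro finite_PiE, auto)

lemma origin_cube: "origin d \<in> cube d n"
  by (simp add: cube_def origin_apply)

text \<open>Whether \<open>screened d n S = T\<close> does not depend on the edges inside \<open>T\<close>; this independence is what
  drives the differential inequality for \<open>theta\<close>.\<close>

definition screened :: "nat \<Rightarrow> nat \<Rightarrow> (nat \<Rightarrow> int) set set \<Rightarrow> (nat \<Rightarrow> int) set" where
  "screened d n S = {v \<in> cube d n. \<not> (\<exists>y\<in>cube_boundary d n. conn S v y)}"

lemma screened_disjoint: "screened d n S \<inter> cube_boundary d n = {}"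
  using conn_refl[of S] by (force simp: screened_def)

text \<open>Forwards, every vertex on an open path to the boundary is itself joined to it, so such a
  path avoids \<open>T\<close> and survives the deletion. Backwards, no edge of \<open>S\<close>
  leads from \<open>T\<close> to the rest of the cube, since the vertex outside would pass on its
  connection to the boundary; hence restoring the edges inside \<open>T\<close> joins nothing in
  \<open>T\<close> to the boundary.\<close>

lemma screened_cong:
  assumes S: "S \<subseteq> box_edges d (cube d n)"
  shows "screened d n S = T \<longleftrightarrow> screened d n (S - Pow T) = T"
proof
  assume T: "screened d n S = T"
  have "conn (S - Pow T) v y" if "conn S v y" "y \<in> cube_boundary d n" for v y
    using that
  proof (induction rule: conn_converse_induct)
    case (step x z)
    have "x \<in> cube d n" using step(1) S by (auto simp: box_edges_def)
    moreover have "conn S x y" using step(1,2) by (blast intro: conn_trans conn_edge)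
    ultimately have "x \<notin> T" using T step.prems by (auto simp: screened_def)
    then have "conn (S - Pow T) x z" using step(1) by (intro conn_edge) auto
    then show ?case using step conn_trans by fast
  qed simp
  then show "screened d n (S - Pow T) = T"
    using T conn_mono[of "S - Pow T" _ _ S] unfolding screened_def by blast
next
  assume T: "screened d n (S - Pow T) = T"
  have out: "v \<in> T" if "conn S v y" "y \<in> T" for v y
    using that
  proof (induction rule: conn_converse_induct)
    case (step x z)
    then have z: "z \<in> T" by blast
    have x: "x \<in> cube d n" using step(1) S by (auto simp: box_edges_def)
    show ?case
    proof (rule ccontr)
      assume xT: "x \<notin> T"
      then obtain w where w: "w \<in> cube_boundary d n" "conn (S - Pow T) x w"
        using T x by (auto simp: screened_def)
      have "conn (S - Pow T) z x" using step(1) xT by (intro conn_edge) (auto simp: insert_commute)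
      then have "conn (S - Pow T) z w" using w(2) by (rule conn_trans)
      then show False using w(1) z T by (auto simp: screened_def)
    qed
  qed simp
  have disj: "T \<inter> cube_boundary d n = {}"
    using T screened_disjoint by metis
  show "screened d n S = T"
  proof
    show "screened d n S \<subseteq> T"
    proof
      fix v assume v: "v \<in> screened d n S"
      then have "\<not> (\<exists>y\<in>cube_boundary d n. conn (S - Pow T) v y)"
        using conn_mono[of "S - Pow T" v _ S] by (auto simp: screened_def)
      then have "v \<in> screened d n (S - Pow T)" using v by (simp add: screened_def)
      then show "v \<in> T" using T by simp
    qed
    show "T \<subseteq> screened d n S"
    proof
      fix v assume v: "v \<in> T"
      then have "v \<in> cube d n" using T by (auto simp: screened_def)
      moreover have "\<not> conn S v y" if "y \<in> cube_boundary d n" for y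
      proof
        assume "conn S v y"
        then have "y \<in> T" using out conn_sym v by metis
        then show False using that disj by auto
      qed
      ultimately show "v \<in> screened d n S" by (simp add: screened_def)
    qed
  qed
qed

text \<open>An open path from the origin to \<open>u\<close> inside the screened set \<open>T\<close>, followed by a boundary
  edge \<open>{u, v}\<close> of \<open>T\<close>, makes that edge pivotal.\<close>

lemma pivotal_edges:
  assumes S: "S \<subseteq> box_edges d (cube d n)" and T: "screened d n S = T" "origin d \<in> T"
  shows "(\<Sum>(u, v)\<in>boundary d T. of_bool (conn (S \<inter> Pow T) (origin d) u))
    \<le> (\<Sum>e\<in>box_edges d (cube d n). of_bool (reach d n (insert e S)) - of_bool (reach d n (S - {e})) :: real)"
proof -
  let ?E = "box_edges d (cube d n)"
  let ?f = "\<lambda>(u, v). {u, v :: nat \<Rightarrow> int}"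
  define B where "B = {(u, v) \<in> boundary d T. conn (S \<inter> Pow T) (origin d) u}"
  have Tc: "T \<subseteq> cube d n" using T by (auto simp: screened_def)
  then have finT: "finite T" using finite_cube finite_subset by blast
  have finB: "finite (boundary d T)" by (rule finite_boundary[OF finT])
  have disj: "T \<inter> cube_boundary d n = {}" using T(1) screened_disjoint by metis
  have nreach: "\<not> reach d n S" using T by (auto simp: reach_def screened_def)
  have inj: "inj_on ?f B"
    by (auto simp: inj_on_def B_def boundary_def doubleton_eq_iff)
  have uv: "?f q \<in> ?E \<and> reach d n (insert (?f q) S)" if q: "q \<in> B" for q
  proof -
    obtain u v where [simp]: "q = (u, v)" by (cases q)
    have u: "u \<in> T" "v \<notin> T" "{u, v} \<in> edges d" "conn (S \<inter> Pow T) (origin d) u"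
      using q by (auto simp: B_def boundary_def)
    \<comment> \<open>\<open>T\<close> avoids \<open>cube_boundary\<close>, so \<open>u\<close> lies
      strictly inside the cube and a unit step cannot leave it.\<close>
    have v: "v \<in> cube d n"
    proof -
      have "\<bar>v i\<bar> \<le> int n" if i: "i < d" for i
      proof -
        have uc: "u \<in> cube d n" "u \<notin> cube_boundary d n" using u(1) Tc disj by auto
        have "\<bar>u i\<bar> \<le> int n" using uc(1) i by (simp add: cube_def)
        moreover have "\<bar>u i\<bar> \<noteq> int n" using uc i unfolding cube_boundary_def by blast
        ultimately have "\<bar>u i\<bar> \<le> int n" "\<bar>u i\<bar> \<noteq> int n" by auto
        then show ?thesis using edges_coord[OF u(3) i] by linarith
      qed
      then show ?thesis using edges_lattice[OF u(3)] by (simp add: cube_def)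
    qed
    then obtain y where y: "y \<in> cube_boundary d n" "conn S v y"
      using u(2) T by (auto simp: screened_def)
    have "conn (insert {u, v} S) (origin d) u" using u(4) by (rule conn_mono) auto
    moreover have "conn (insert {u, v} S) u v" by (rule conn_edge) simp
    moreover have "conn (insert {u, v} S) v y" using y(2) by (rule conn_mono) auto
    ultimately have "conn (insert {u, v} S) (origin d) y" by (blast intro: conn_trans)
    then show ?thesis using y(1) u(1,3) v Tc by (auto simp: reach_def box_edges_def)
  qed
  have mono: "reach d n S''" if "S' \<subseteq> S''" "reach d n S'" for S' S''
    using conn_mono[OF _ that(1)] that(2) unfolding reach_def by blast
  have "(\<Sum>(u, v)\<in>boundary d T. of_bool (conn (S \<inter> Pow T) (origin d) u) :: real) = (\<Sum>q\<in>B. 1)"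
  proof -
    have "B = {q \<in> boundary d T. conn (S \<inter> Pow T) (origin d) (fst q)}" by (auto simp: B_def)
    then show ?thesis
      using sum.inter_filter[OF finB, of "\<lambda>_. 1 :: real"] by (simp add: case_prod_beta of_bool_def)
  qed
  also have "\<dots> = (\<Sum>e\<in>?f ` B. 1)"
    using sum.reindex[OF inj, of "\<lambda>_. 1::real"] by (simp add: o_def)
  also have "\<dots> = (\<Sum>e\<in>?f ` B. of_bool (reach d n (insert e S)) - of_bool (reach d n (S - {e})))"
  proof (rule sum.cong[OF refl])
    fix e assume "e \<in> ?f ` B"
    then have "reach d n (insert e S)" using uv by blast
    moreover have "\<not> reach d n (S - {e})" using nreach mono[of "S - {e}" S] by auto
    ultimately show "(1 :: real) = of_bool (reach d n (insert e S)) - of_bool (reach d n (S - {e}))" by simp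
  qed
  also have "\<dots> \<le> (\<Sum>e\<in>?E. of_bool (reach d n (insert e S)) - of_bool (reach d n (S - {e})))"
  proof (rule sum_mono2)
    show "finite ?E" by (rule finite_box_edges[OF finite_cube])
    show "?f ` B \<subseteq> ?E" using uv by blast
    show "0 \<le> (of_bool (reach d n (insert e S)) - of_bool (reach d n (S - {e})) :: real)" for e
      using mono[of "S - {e}" "insert e S"] by auto
  qed
  finally show ?thesis .
qed

text \<open>Partition the event that the boundary is not reached by the screened set
  \<open>T\<close>. The event \<open>screened d n S = T\<close> and connections inside
  \<open>T\<close> read disjoint sets of edges, so by independence multiplying the probability of
  the former by \<open>exit_sum d t T \<ge> 1\<close> gives an expected number of boundary edges.
  These are pivotal, and Russo's formula counts pivotal edges.\<close>

lemma theta_deriv: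
  assumes t: "0 \<le> t" "t \<le> 1"
    and exit: "\<And>T. finite T \<Longrightarrow> origin d \<in> T \<Longrightarrow> 1 \<le> exit_sum d t T"
  shows "\<exists>D. (theta d n has_real_derivative D) (at t) \<and> 1 - theta d n t \<le> D"
proof -
  let ?E = "box_edges d (cube d n)"
  let ?g = "\<lambda>S. of_bool (reach d n S) :: real"
  let ?D = "\<Sum>e\<in>?E. bexp ?E t (\<lambda>S. ?g (insert e S) - ?g (S - {e}))"
  have finE: "finite ?E" by (rule finite_box_edges[OF finite_cube])
  \<comment> \<open>The boundary is not reached exactly when the screened set contains the origin,
    so these \<open>T\<close> index the partition.\<close>
  define TT where "TT = {T \<in> Pow (cube d n). origin d \<in> T}"
  have finTT: "finite TT" unfolding TT_def using finite_cube by simp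
  have "1 - theta d n t = bexp ?E t (\<lambda>S. 1 - ?g S)"
    unfolding theta_def bprob_def bexp_diff using bexp_const[OF finE] by simp
  also have "\<dots> = bexp ?E t (\<lambda>S. \<Sum>T\<in>TT. of_bool (screened d n S = T))"
  proof (rule bexp_cong)
    fix S
    have "(\<Sum>T\<in>TT. of_bool (screened d n S = T) :: real) = of_bool (screened d n S \<in> TT)"
      using finTT by (simp add: of_bool_def sum.delta)
    moreover have "screened d n S \<in> TT \<longleftrightarrow> \<not> reach d n S"
      using origin_cube by (auto simp: TT_def screened_def reach_def)
    ultimately show "1 - ?g S = (\<Sum>T\<in>TT. of_bool (screened d n S = T))" by simp
  qed
  also have "\<dots> = (\<Sum>T\<in>TT. bprob ?E t (\<lambda>S. screened d n S = T))"
    by (simp add: bexp_sum bprob_def)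
  also have "\<dots> \<le> (\<Sum>T\<in>TT. bprob ?E t (\<lambda>S. screened d n S = T) * exit_sum d t T)"
  proof (rule sum_mono)
    fix T assume "T \<in> TT"
    then have "1 \<le> exit_sum d t T"
      using finite_subset[OF _ finite_cube] by (intro exit) (auto simp: TT_def)
    then show "bprob ?E t (\<lambda>S. screened d n S = T) \<le> bprob ?E t (\<lambda>S. screened d n S = T) * exit_sum d t T"
      using bprob_nonneg[OF t] by (metis mult.right_neutral mult_left_mono)
  qed
  also have "\<dots> = (\<Sum>T\<in>TT. \<Sum>(u, v)\<in>boundary d T.
      bexp ?E t (\<lambda>S. of_bool (screened d n S = T) * of_bool (conn (S \<inter> Pow T) (origin d) u)))"
  proof (rule sum.cong[OF refl])
    fix T assume "T \<in> TT"
    then have T: "T \<subseteq> cube d n" by (auto simp: TT_def)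
    let ?A = "?E - Pow T" and ?B = "?E \<inter> Pow T"
    have B: "?B = box_edges d T" using T by (auto simp: box_edges_def)
    have scr: "of_bool (screened d n S = T) = (of_bool (screened d n (S \<inter> ?A) = T) :: real)" if "S \<subseteq> ?E" for S
    proof -
      have "S - Pow T = S \<inter> ?A" using that by auto
      then show ?thesis using screened_cong[OF that, of T] by simp
    qed
    have P: "bprob ?E t (\<lambda>S. screened d n S = T) = bprob ?A t (\<lambda>S. screened d n S = T)"
      unfolding bprob_def using scr
      by (subst bexp_cong[where g = "\<lambda>S. of_bool (screened d n (S \<inter> ?A) = T)"])
        (auto intro!: bexp_restrict[where f = "\<lambda>S. of_bool (screened d n S = T)"] finE)
    have "bexp ?E t (\<lambda>S. of_bool (screened d n S = T) * of_bool (conn (S \<inter> Pow T) (origin d) u))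
      = bprob ?E t (\<lambda>S. screened d n S = T) * bprob (box_edges d T) t (\<lambda>S. conn S (origin d) u)" for u
    proof -
      have "bexp ?E t (\<lambda>S. of_bool (screened d n S = T) * of_bool (conn (S \<inter> Pow T) (origin d) u))
        = bexp ?E t (\<lambda>S. of_bool (screened d n (S \<inter> ?A) = T) * of_bool (conn (S \<inter> ?B) (origin d) u))"
      proof (rule bexp_cong)
        fix S assume S: "S \<subseteq> ?E"
        then have "S \<inter> Pow T = S \<inter> ?B" by auto
        then show "of_bool (screened d n S = T) * of_bool (conn (S \<inter> Pow T) (origin d) u)
          = (of_bool (screened d n (S \<inter> ?A) = T) * of_bool (conn (S \<inter> ?B) (origin d) u) :: real)"
          using scr[OF S] by simp
      qed
      also have "\<dots> = bprob ?A t (\<lambda>S. screened d n S = T) * bprob ?B t (\<lambda>S. conn S (origin d) u)"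
        unfolding bprob_def by (rule bexp_indep[OF finE]) auto
      finally show ?thesis unfolding P B .
    qed
    then show "bprob ?E t (\<lambda>S. screened d n S = T) * exit_sum d t T = (\<Sum>(u, v)\<in>boundary d T.
      bexp ?E t (\<lambda>S. of_bool (screened d n S = T) * of_bool (conn (S \<inter> Pow T) (origin d) u)))"
      by (simp add: exit_sum_def sum_distrib_left case_prod_beta)
  qed
  also have "\<dots> = bexp ?E t (\<lambda>S. \<Sum>T\<in>TT. \<Sum>(u, v)\<in>boundary d T.
      of_bool (screened d n S = T) * of_bool (conn (S \<inter> Pow T) (origin d) u))"
    by (simp add: bexp_sum case_prod_beta)
  also have "\<dots> \<le> bexp ?E t (\<lambda>S. \<Sum>e\<in>?E. ?g (insert e S) - ?g (S - {e}))"
  proof (rule bexp_mono[OF t])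
    fix S assume S: "S \<subseteq> ?E"
    let ?L = "\<Sum>e\<in>?E. ?g (insert e S) - ?g (S - {e})"
    let ?T = "screened d n S"
    have "(\<Sum>T\<in>TT. \<Sum>(u, v)\<in>boundary d T. of_bool (?T = T) * of_bool (conn (S \<inter> Pow T) (origin d) u))
      = (\<Sum>T\<in>TT. if T = ?T then \<Sum>(u, v)\<in>boundary d ?T. of_bool (conn (S \<inter> Pow ?T) (origin d) u) else (0::real))"
      by (intro sum.cong refl) (auto simp: case_prod_beta)
    also have "\<dots> = (if ?T \<in> TT then \<Sum>(u, v)\<in>boundary d ?T. of_bool (conn (S \<inter> Pow ?T) (origin d) u) else 0)"
      using finTT by simp
    also have "\<dots> \<le> ?L"
    proof (cases "?T \<in> TT")
      case True
      then show ?thesis using pivotal_edges[OF S refl] by (simp add: TT_def)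
    next
      case False
      have "reach d n (S - {e}) \<Longrightarrow> reach d n (insert e S)" for e
        using conn_mono[of "S - {e}" _ _ "insert e S"] unfolding reach_def by blast
      then have "0 \<le> ?L" by (intro sum_nonneg) auto
      then show ?thesis using False by simp
    qed
    finally show "(\<Sum>T\<in>TT. \<Sum>(u, v)\<in>boundary d T. of_bool (?T = T) * of_bool (conn (S \<inter> Pow T) (origin d) u)) \<le> ?L" .
  qed
  also have "\<dots> = ?D" by (rule bexp_sum)
  finally have "1 - theta d n t \<le> ?D" .
  moreover have "(theta d n has_real_derivative ?D) (at t)"
    unfolding theta_def[abs_def] bprob_def by (rule bexp_has_derivative[OF finE])
  ultimately show ?thesis by blast
qed

text \<open>By \<open>theta_deriv\<close> the function \<open>exp t * (1 - theta d n t)\<close> is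
  nonincreasing. Exit sums grow with the parameter, so the hypothesis at \<open>p\<close> holds on
  the whole interval. The bound does not depend on \<open>n\<close>.\<close>

lemma theta_lower:
  assumes pq: "0 \<le> p" "p \<le> q" "q \<le> 1"
    and exit: "\<And>T. finite T \<Longrightarrow> origin d \<in> T \<Longrightarrow> 1 \<le> exit_sum d p T"
  shows "1 - exp (- (q - p)) \<le> theta d n q"
proof -
  have exit': "1 \<le> exit_sum d t T" if "p \<le> t" "t \<le> q" "finite T" "origin d \<in> T" for t T
  proof -
    have "exit_sum d p T \<le> exit_sum d t T"
      unfolding exit_sum_def bprob_def case_prod_beta
      using that pq by (intro sum_mono bexp_mono_p finite_box_edges incr_of_bool) auto
    then show ?thesis using exit[OF that(3,4)] by simp
  qed
  have "exp q * (1 - theta d n q) \<le> exp p * (1 - theta d n p)"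
  proof (rule DERIV_nonpos_imp_nonincreasing[OF pq(2)])
    fix t assume t: "p \<le> t" "t \<le> q"
    obtain D where D: "(theta d n has_real_derivative D) (at t)" "1 - theta d n t \<le> D"
      using theta_deriv[of t d n] exit' t pq by (meson order_trans)
    have "((\<lambda>t. exp t * (1 - theta d n t)) has_real_derivative (exp t * (1 - theta d n t) - exp t * D)) (at t)"
      by (rule derivative_eq_intros D(1) refl | simp)+
    moreover have "exp t * (1 - theta d n t) - exp t * D \<le> 0"
      using D(2) by simp
    ultimately show "\<exists>y. ((\<lambda>t. exp t * (1 - theta d n t)) has_real_derivative y) (at t) \<and> y \<le> 0" by blast
  qed
  also have "\<dots> \<le> exp p * 1"
    using bprob_nonneg[of p _ "reach d n"] pq by (intro mult_left_mono) (auto simp: theta_def)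
  finally have "1 - theta d n q \<le> exp p / exp q" by (simp add: field_simps)
  then show ?thesis by (simp add: exp_diff[symmetric])
qed

section \<open>The percolation measure\<close>

lemma prob_space_percolation: "prob_space (percolation d p)"
  unfolding percolation_def by (intro prob_space_PiM) (rule prob_space_measure_pmf)

lemma open_edge_measurable:
  assumes "e \<in> edges d"
  shows "{\<omega> \<in> space (percolation d p). \<omega> e \<in> X} \<in> sets (percolation d p)"
proof -
  have "(\<lambda>\<omega>. \<omega> e) \<in> measurable (percolation d p) (measure_pmf (bernoulli_pmf p))"
    unfolding percolation_def by (rule measurable_component_singleton[OF assms])
  then have "(\<lambda>\<omega>. \<omega> e) -` X \<inter> space (percolation d p) \<in> sets (percolation d p)"
    by (rule measurable_sets) simp
  then show ?thesis by (simp add: vimage_def Int_def conj_commute)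
qed

lemma open_set_measurable:
  assumes "finite E" "E \<subseteq> edges d"
  shows "{\<omega> \<in> space (percolation d p). {e \<in> E. \<omega> e} = S} \<in> sets (percolation d p)"
proof (cases "S \<subseteq> E")
  case True
  have "{\<omega> \<in> space (percolation d p). {e \<in> E. \<omega> e} = S}
      = {\<omega> \<in> space (percolation d p). \<forall>e\<in>E. \<omega> e \<in> {e \<in> S}}"
    using True by auto
  also have "\<dots> \<in> sets (percolation d p)"
    using assms by (intro sets.sets_Collect_finite_All open_edge_measurable) auto
  finally show ?thesis .
next
  case False
  then have "{\<omega> \<in> space (percolation d p). {e \<in> E. \<omega> e} = S} = {}" by auto
  then show ?thesis by (simp only: sets.empty_sets)
qed

lemma prob_open_set:
  assumes "0 \<le> p" "p \<le> 1" "finite E" "E \<subseteq> edges d" "S \<subseteq> E"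
  shows "\<P>(\<omega> in percolation d p. {e \<in> E. \<omega> e} = S) = p ^ card S * (1 - p) ^ card (E - S)"
proof -
  interpret P: product_prob_space "\<lambda>_. measure_pmf (bernoulli_pmf p)" "edges d" ..
  have eq: "{\<omega> \<in> space (percolation d p). {e \<in> E. \<omega> e} = S}
      = P.emb (edges d) E (\<Pi>\<^sub>E e\<in>E. {e \<in> S})"
    using assms(4,5) by (auto simp: percolation_def prod_emb_def space_PiM Pi_iff PiE_iff extensional_def)
  have "\<P>(\<omega> in percolation d p. {e \<in> E. \<omega> e} = S) = (\<Prod>e\<in>E. measure (measure_pmf (bernoulli_pmf p)) {e \<in> S})"
    unfolding eq unfolding percolation_def using assms by (intro P.measure_PiM_emb) auto
  also have "\<dots> = (\<Prod>e\<in>E. if e \<in> S then p else 1 - p)"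
    using assms by (intro prod.cong refl) (auto simp: measure_pmf_single)
  also have "\<dots> = (\<Prod>e\<in>E \<inter> {e. e \<in> S}. p) * (\<Prod>e\<in>E \<inter> - {e. e \<in> S}. 1 - p)"
    by (rule prod.If_cases[OF assms(3)])
  also have "\<dots> = p ^ card S * (1 - p) ^ card (E - S)"
  proof -
    have "E \<inter> {e. e \<in> S} = S" "E \<inter> - {e. e \<in> S} = E - S" using assms(5) by auto
    then show ?thesis by simp
  qed
  finally show ?thesis .
qed

text \<open>The link to the product measure: a finite-volume event is a finite disjoint union over
  the possible open sets, whose probabilities are the weights of \<open>bexp\<close>.\<close>

lemma cylinder:
  assumes "0 \<le> p" "p \<le> 1" "finite E" "E \<subseteq> edges d"
  shows "{\<omega> \<in> space (percolation d p). Q {e \<in> E. \<omega> e}} \<in> sets (percolation d p)"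
    and "\<P>(\<omega> in percolation d p. Q {e \<in> E. \<omega> e}) = bprob E p Q"
proof -
  interpret prob_space "percolation d p" by (rule prob_space_percolation)
  let ?A = "\<lambda>S. {\<omega> \<in> space (percolation d p). {e \<in> E. \<omega> e} = S}"
  let ?QQ = "{S \<in> Pow E. Q S}"
  have eq: "{\<omega> \<in> space (percolation d p). Q {e \<in> E. \<omega> e}} = (\<Union>S\<in>?QQ. ?A S)" by auto
  have fin: "finite ?QQ" using assms by simp
  show "{\<omega> \<in> space (percolation d p). Q {e \<in> E. \<omega> e}} \<in> sets (percolation d p)"
    unfolding eq using fin open_set_measurable[OF assms(3,4)] by blast
  have "\<P>(\<omega> in percolation d p. Q {e \<in> E. \<omega> e}) = (\<Sum>S\<in>?QQ. \<P>(\<omega> in percolation d p. {e \<in> E. \<omega> e} = S))"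
    unfolding eq using open_set_measurable[OF assms(3,4)]
    by (intro finite_measure_finite_Union fin) (auto simp: disjoint_family_on_def)
  also have "\<dots> = (\<Sum>S\<in>?QQ. p ^ card S * (1 - p) ^ card (E - S))"
    by (intro sum.cong refl prob_open_set assms) auto
  also have "\<dots> = bprob E p Q"
    unfolding bprob_def bexp_def using assms(3)
    by (intro sum.mono_neutral_cong_left) auto
  finally show "\<P>(\<omega> in percolation d p. Q {e \<in> E. \<omega> e}) = bprob E p Q" .
qed

lemma joined_in_iff:
  "joined_in d V \<omega> x y \<longleftrightarrow> x \<in> V \<and> y \<in> V \<and> conn {e \<in> box_edges d V. \<omega> e} x y"
proof -
  have "{(u, v). u \<in> V \<and> v \<in> V \<and> {u, v} \<in> edges d \<and> \<omega> {u, v}}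
      = {(u, v). {u, v} \<in> {e \<in> box_edges d V. \<omega> e}}"
    by (auto simp: box_edges_def)
  then show ?thesis unfolding joined_in_def conn_def by simp
qed

lemma joined_iff:
  assumes "x \<in> lattice d"
  shows "joined d \<omega> x y \<longleftrightarrow> conn {e \<in> edges d. \<omega> e} x y"
proof -
  have "box_edges d (lattice d) = edges d"
    using edges_lattice by (auto simp: box_edges_def)
  moreover have "y \<in> lattice d" if "conn {e \<in> edges d. \<omega> e} x y"
    using conn_mem[OF that] assms edges_lattice by blast
  ultimately show ?thesis using assms by (auto simp: joined_def joined_in_iff)
qed

lemma left_right_crossing_iff:
  "left_right_crossing d n h \<omega> \<longleftrightarrow> crossing d n h {e \<in> box_edges d (rect d n h). \<omega> e}"
  unfolding left_right_crossing_def crossing_def joined_in_iff by blast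

lemma cube_mono: "m \<le> n \<Longrightarrow> cube d m \<subseteq> cube d n"
  by (force simp: cube_def)

lemma lattice_cube: "x \<in> lattice d \<Longrightarrow> \<exists>n. x \<in> cube d n"
proof -
  assume x: "x \<in> lattice d"
  obtain L where "\<And>y i. y \<in> {x} \<Longrightarrow> i < d \<Longrightarrow> y i \<in> {- int L..int L}"
    using finite_lattice_bound[of "{x}" d] by blast
  then show ?thesis using x by (intro exI[of _ L]) (auto simp: cube_def abs_le_iff minus_le_iff)
qed

lemma conn_in_cube:
  assumes "conn S x y" "S \<subseteq> edges d"
  shows "\<exists>n. conn (S \<inter> Pow (cube d n)) x y"
  using assms(1)
proof (induction rule: conn_induct)
  case (step y z)
  obtain n where n: "conn (S \<inter> Pow (cube d n)) x y" using step by blast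
  have "y \<in> lattice d" "z \<in> lattice d" using step(2) assms(2) edges_lattice by auto
  then obtain k l where kl: "y \<in> cube d k" "z \<in> cube d l" using lattice_cube by blast
  let ?N = "max n (max k l)"
  have "y \<in> cube d ?N" "z \<in> cube d ?N"
    by (rule subsetD[OF cube_mono kl(1)], simp) (rule subsetD[OF cube_mono kl(2)], simp)
  then have "conn (S \<inter> Pow (cube d ?N)) y z" using step(2) by (intro conn_edge) auto
  moreover have "conn (S \<inter> Pow (cube d ?N)) x y"
    using n by (rule conn_mono) (use cube_mono[of n ?N d] in auto)
  ultimately have "conn (S \<inter> Pow (cube d ?N)) x z" by (rule conn_trans[rotated])
  then show ?case by (rule exI)
qed simp

text \<open>The connection event is the increasing union over cubes, which gives measurability and,
  by continuity from below, one inequality. The other holds because every finite volume yields a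
  subevent.\<close>

lemma prob_joined:
  assumes p: "0 \<le> p" "p \<le> 1" and x: "x \<in> lattice d"
  shows "\<P>(\<omega> in percolation d p. joined d \<omega> x y) = tau d p x y"
proof -
  interpret prob_space "percolation d p" by (rule prob_space_percolation)
  let ?E = "\<lambda>n. box_edges d (cube d n)"
  define A where "A n = {\<omega> \<in> space (percolation d p). conn {e \<in> ?E n. \<omega> e} x y}" for n
  have E: "finite (?E n)" "?E n \<subseteq> edges d" for n
    using finite_box_edges[OF finite_cube] by (auto simp: box_edges_def)
  have A: "A n \<in> events" "prob (A n) = bprob (?E n) p (\<lambda>S. conn S x y)" for n
    unfolding A_def using cylinder[OF p E, of "\<lambda>S. conn S x y"] by auto
  have inc: "incseq A"
  proof (rule incseq_SucI)
    fix n
    have "?E n \<subseteq> ?E (Suc n)" using cube_mono[of n "Suc n" d] by (auto simp: box_edges_def)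
    then show "A n \<subseteq> A (Suc n)" unfolding A_def by (auto intro: conn_mono)
  qed
  have J: "{\<omega> \<in> space (percolation d p). joined d \<omega> x y} = (\<Union>n. A n)"
  proof -
    have "conn {e \<in> edges d. \<omega> e} x y \<longleftrightarrow> (\<exists>n. conn {e \<in> ?E n. \<omega> e} x y)" for \<omega>
    proof
      assume "conn {e \<in> edges d. \<omega> e} x y"
      then obtain n where "conn ({e \<in> edges d. \<omega> e} \<inter> Pow (cube d n)) x y"
        using conn_in_cube by blast
      then have "conn {e \<in> ?E n. \<omega> e} x y" by (rule conn_mono) (auto simp: box_edges_def)
      then show "\<exists>n. conn {e \<in> ?E n. \<omega> e} x y" by blast
    qed (use E(2) in \<open>auto intro: conn_mono\<close>)
    then show ?thesis using joined_iff[OF x] by (auto simp: A_def)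
  qed
  show ?thesis
  proof (rule antisym)
    have "(\<lambda>n. prob (A n)) \<longlonglongrightarrow> prob (\<Union>n. A n)"
      using A inc by (intro finite_Lim_measure_incseq) auto
    then show "\<P>(\<omega> in percolation d p. joined d \<omega> x y) \<le> tau d p x y"
      unfolding J A(2) by (rule LIMSEQ_le_const2) (use tau_ge[OF p E] in auto)
    show "tau d p x y \<le> \<P>(\<omega> in percolation d p. joined d \<omega> x y)"
      unfolding tau_def
    proof (rule lprob_le)
      fix F assume F: "finite F" "F \<subseteq> edges d"
      have "bprob F p (\<lambda>S. conn S x y) = \<P>(\<omega> in percolation d p. conn {e \<in> F. \<omega> e} x y)"
        using cylinder(2)[OF p F, of "\<lambda>S. conn S x y"] by simp
      also have "\<dots> \<le> \<P>(\<omega> in percolation d p. joined d \<omega> x y)"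
      proof (rule finite_measure_mono)
        show "{\<omega> \<in> space (percolation d p). joined d \<omega> x y} \<in> events"
          unfolding J using A(1) by blast
        show "{\<omega> \<in> space (percolation d p). conn {e \<in> F. \<omega> e} x y}
            \<subseteq> {\<omega> \<in> space (percolation d p). joined d \<omega> x y}"
          using F(2) joined_iff[OF x] by (auto intro: conn_mono)
      qed
      finally show "bprob F p (\<lambda>S. conn S x y) \<le> \<P>(\<omega> in percolation d p. joined d \<omega> x y)" .
    qed
  qed
qed

text \<open>A path that goes far is stopped at its first boundary vertex, so looking inside the cube
  suffices. The right side refers to one configuration for all \<open>n\<close>, which makes
  monotonicity in \<open>n\<close> evident.\<close>

lemma reach_iff:
  assumes "S \<subseteq> edges d"
  shows "reach d n (S \<inter> Pow (cube d n)) \<longleftrightarrow> (\<exists>y\<in>lattice d. (\<exists>i<d. int n \<le> \<bar>y i\<bar>) \<and> conn S (origin d) y)"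
proof
  assume "reach d n (S \<inter> Pow (cube d n))"
  then obtain y where y: "y \<in> cube_boundary d n" "conn (S \<inter> Pow (cube d n)) (origin d) y"
    by (auto simp: reach_def)
  have "conn S (origin d) y" using y(2) by (rule conn_mono) auto
  then show "\<exists>y\<in>lattice d. (\<exists>i<d. int n \<le> \<bar>y i\<bar>) \<and> conn S (origin d) y"
    using y(1) by (intro bexI[of _ y]) (auto simp: cube_boundary_def cube_def)
next
  let ?S = "S \<inter> Pow (cube d n)"
  assume "\<exists>y\<in>lattice d. (\<exists>i<d. int n \<le> \<bar>y i\<bar>) \<and> conn S (origin d) y"
  then obtain y i where y: "y \<in> lattice d" "i < d" "int n \<le> \<bar>y i\<bar>" "conn S (origin d) y" by blast
  \<comment> \<open>Invariant along the path: either the boundary has been reached within the cube,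
    or the path has not left the cube so far.\<close>
  have "reach d n ?S \<or> y \<in> cube d n \<and> conn ?S (origin d) y"
    using y(4)
  proof (induction rule: conn_induct)
    case (step y z)
    show ?case
    proof (cases "reach d n ?S \<or> y \<in> cube_boundary d n")
      case False
      then have y: "y \<in> cube d n" "conn ?S (origin d) y" "y \<notin> cube_boundary d n" using step by auto
      have e: "{y, z} \<in> edges d" using step(2) assms by auto
      have "\<bar>z i\<bar> \<le> int n" if "i < d" for i
      proof -
        have "\<bar>y i\<bar> \<le> int n" "\<bar>y i\<bar> \<noteq> int n"
          using y that by (simp add: cube_def, use y that in \<open>unfold cube_boundary_def, blast\<close>)
        then show ?thesis using edges_coord[OF e that] by linarith
      qed
      then have z: "z \<in> cube d n" using edges_lattice[OF e] by (simp add: cube_def)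
      then have "conn ?S y z" using step(2) y(1) by (intro conn_edge) auto
      then show ?thesis using z conn_trans[OF y(2)] by simp
    qed (use step in \<open>auto simp: reach_def\<close>)
  qed (simp add: origin_cube)
  then show "reach d n ?S"
  proof
    assume "y \<in> cube d n \<and> conn ?S (origin d) y"
    moreover from this have "\<bar>y i\<bar> = int n" using y(2,3) by (auto simp: cube_def intro: antisym)
    ultimately show ?thesis using y(2) by (auto simp: reach_def cube_boundary_def)
  qed
qed

lemma infinite_cluster_iff:
  "infinite {y. joined d \<omega> (origin d) y} \<longleftrightarrow> (\<forall>n. reach d n {e \<in> box_edges d (cube d n). \<omega> e})"
proof -
  let ?S = "{e \<in> edges d. \<omega> e}"
  have eq: "{e \<in> box_edges d (cube d n). \<omega> e} = ?S \<inter> Pow (cube d n)" for n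
    by (auto simp: box_edges_def)
  have J: "{y. joined d \<omega> (origin d) y} = {y \<in> lattice d. conn ?S (origin d) y}"
  proof -
    have "y \<in> lattice d" if "conn ?S (origin d) y" for y
      using conn_mem[OF that] edges_lattice by auto
    then show ?thesis using joined_iff[of "origin d" d \<omega>] by auto
  qed
  have sub: "?S \<subseteq> edges d" by auto
  show ?thesis
    unfolding eq reach_iff[OF sub] J
  proof (intro iffI allI)
    fix n assume "infinite {y \<in> lattice d. conn ?S (origin d) y}"
    then have "\<not> {y \<in> lattice d. conn ?S (origin d) y} \<subseteq> cube d n"
      using finite_cube finite_subset by blast
    then obtain y where y: "y \<in> lattice d" "conn ?S (origin d) y" "y \<notin> cube d n" by auto
    then obtain i where "i < d" "int n < \<bar>y i\<bar>" by (auto simp: cube_def not_le)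
    then show "\<exists>y\<in>lattice d. (\<exists>i<d. int n \<le> \<bar>y i\<bar>) \<and> conn ?S (origin d) y"
      using y(1,2) by (intro bexI[of _ y]) (auto intro!: exI[of _ i])
  next
    assume reach: "\<forall>n. \<exists>y\<in>lattice d. (\<exists>i<d. int n \<le> \<bar>y i\<bar>) \<and> conn ?S (origin d) y"
    show "infinite {y \<in> lattice d. conn ?S (origin d) y}"
    proof
      assume "finite {y \<in> lattice d. conn ?S (origin d) y}"
      then obtain L where L: "\<And>y i. y \<in> {y \<in> lattice d. conn ?S (origin d) y} \<Longrightarrow> i < d \<Longrightarrow> y i \<in> {- int L..int L}"
        by (rule finite_lattice_bound[where d = d]) blast
      obtain y i where "y \<in> lattice d" "conn ?S (origin d) y" "i < d" "int (Suc L) \<le> \<bar>y i\<bar>"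
        using reach by blast
      then show False using L[of y i] by auto
    qed
  qed
qed

lemma infinite_cluster_prob:
  fixes d :: nat
  assumes p: "0 \<le> p" "p \<le> 1"
  defines "P \<equiv> \<P>(\<omega> in percolation d p. infinite {y. joined d \<omega> (origin d) y})"
  shows "P \<le> theta d n p" and "(\<And>n. \<delta> \<le> theta d n p) \<Longrightarrow> \<delta> \<le> P"
proof -
  interpret prob_space "percolation d p" by (rule prob_space_percolation)
  let ?E = "\<lambda>n. box_edges d (cube d n)"
  define A where "A n = {\<omega> \<in> space (percolation d p). reach d n {e \<in> ?E n. \<omega> e}}" for n
  have E: "finite (?E n)" "?E n \<subseteq> edges d" for n
    using finite_box_edges[OF finite_cube] by (auto simp: box_edges_def)
  have A: "A n \<in> events" "prob (A n) = theta d n p" for n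
    unfolding A_def theta_def using cylinder[OF p E, of "reach d n"] by auto
  have PA: "P = prob (\<Inter>n. A n)"
    unfolding P_def infinite_cluster_iff by (rule arg_cong[of _ _ prob]) (auto simp: A_def)
  show "P \<le> theta d n p"
    unfolding PA A(2)[symmetric] using A(1) by (intro finite_measure_mono) auto
  have dec: "decseq A"
  proof (rule decseq_SucI, rule subsetI)
    fix n \<omega> assume \<omega>: "\<omega> \<in> A (Suc n)"
    then have \<omega>': "reach d (Suc n) {e \<in> ?E (Suc n). \<omega> e}" by (simp add: A_def)
    let ?S = "{e \<in> edges d. \<omega> e}"
    have eq: "{e \<in> ?E n. \<omega> e} = ?S \<inter> Pow (cube d n)" for n by (auto simp: box_edges_def)
    have sub: "?S \<subseteq> edges d" by auto
    have "\<exists>y\<in>lattice d. (\<exists>i<d. int (Suc n) \<le> \<bar>y i\<bar>) \<and> conn ?S (origin d) y"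
      using \<omega>' unfolding eq reach_iff[OF sub] .
    then have "\<exists>y\<in>lattice d. (\<exists>i<d. int n \<le> \<bar>y i\<bar>) \<and> conn ?S (origin d) y"
      by (elim bexE exE conjE, intro bexI exI conjI) auto
    then have "reach d n {e \<in> ?E n. \<omega> e}" unfolding eq reach_iff[OF sub] .
    then show "\<omega> \<in> A n" using \<omega> by (simp add: A_def)
  qed
  show "\<delta> \<le> P" if "\<And>n. \<delta> \<le> theta d n p"
  proof -
    have "(\<lambda>n. prob (A n)) \<longlonglongrightarrow> P"
      unfolding PA using A dec by (intro finite_Lim_measure_decseq) auto
    then show ?thesis unfolding A(2) by (rule LIMSEQ_le_const) (use that in auto)
  qed
qed

text \<open>Puts 0 into the set whose supremum is \<open>critical_prob\<close>; the supremum is then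
  taken over a nonempty set.\<close>

lemma theta_zero: "0 < d \<Longrightarrow> theta d 1 0 = 0"
proof -
  assume d: "0 < d"
  have zero: "bexp E 0 f = f {}" if "finite E" for E :: "(nat \<Rightarrow> int) set set" and f
    using that by (induction E rule: finite_induct) (auto simp: bexp_insert)
  have "origin d \<notin> cube_boundary d 1" by (auto simp: cube_boundary_def origin_apply)
  then have "\<not> reach d 1 {}" unfolding reach_def using conn_mem[of "{}" "origin d"] by blast
  then show ?thesis
    unfolding theta_def bprob_def using zero[OF finite_box_edges[OF finite_cube]] by simp
qed

text \<open>If all exit sums at \<open>p\<close> were at least 1, \<open>theta_lower\<close> would
  keep \<open>theta d n q\<close> away from 0 uniformly in \<open>n\<close> for a larger
  \<open>q\<close> that has almost surely no infinite cluster. So some exit sum is small, and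
  \<open>rate_pos_if_exit_sum\<close> applies.\<close>

lemma subcritical_decay:
  assumes "2 \<le> d" "0 < p" "p < critical_prob d"
  shows "perc_decay d p"
proof -
  let ?A = "{p \<in> {0..1}. \<P>(\<omega> in percolation d p. infinite {y. joined d \<omega> (origin d) y}) = 0}"
  have d: "0 < d" using assms by simp
  have "\<P>(\<omega> in percolation d 0. infinite {y. joined d \<omega> (origin d) y}) \<le> 0"
    using infinite_cluster_prob(1)[of 0 d 1] theta_zero[OF d] by simp
  then have "0 \<in> ?A" by (auto intro: antisym)
  then have "?A \<noteq> {}" by blast
  moreover have "bdd_above ?A" by (rule bdd_aboveI[of _ 1]) auto
  ultimately obtain q where q: "q \<in> ?A" "p < q"
    using assms(3) unfolding critical_prob_def by (auto simp: less_cSup_iff)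
  interpret perc d p by unfold_locales (use assms q in auto)
  have "\<exists>T. finite T \<and> org \<in> T \<and> p * exit_sum d p T < 1"
  proof (rule ccontr)
    assume "\<not> ?thesis"
    then have *: "1 \<le> p * exit_sum d p T" if "finite T" "org \<in> T" for T using that by force
    have "1 \<le> exit_sum d p T" if "finite T" "org \<in> T" for T
    proof -
      have "0 \<le> exit_sum d p T"
        unfolding exit_sum_def by (intro sum_nonneg) (auto intro: bprob_nonneg p01)
      then have "p * exit_sum d p T \<le> exit_sum d p T" using p01 by (intro mult_left_le_one_le) auto
      then show ?thesis using *[OF that] by simp
    qed
    then have "1 - exp (- (q - p)) \<le> theta d n q" for n
      using q p01 by (intro theta_lower) auto
    then have "1 - exp (- (q - p)) \<le> \<P>(\<omega> in percolation d q. infinite {y. joined d \<omega> (origin d) y})"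
      using q by (intro infinite_cluster_prob(2)) auto
    then show False using q by simp
  qed
  then have "0 < r" using rate_pos_if_exit_sum by blast
  then show ?thesis by unfold_locales
qed

theorem proposition2p5:
  fixes d :: nat and p :: real
  assumes "d \<ge> 2"
    and "0 < p" and "p < critical_prob d"
  shows "\<exists>c C :: real. c > 0 \<and> C > 0 \<and>
    (\<forall>n h :: nat. n > 0 \<longrightarrow> h \<ge> 6 * n \<longrightarrow>
      Phi (c * real h ^ (d - 1) * exp (- real n / correlation_length d p))
        \<le> \<P>(\<omega> in percolation d p. left_right_crossing d n h \<omega>) \<and>
      \<P>(\<omega> in percolation d p. left_right_crossing d n h \<omega>)
        \<le> C * real h ^ (d - 1) * exp (- real n / correlation_length d p))"
proof -
  interpret perc_decay d p by (rule subcritical_decay[OF assms])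
  have xi: "correlation_length d p = inverse r"
  proof -
    have "\<P>(\<omega> in percolation d p. joined d \<omega> (origin d) (axis_point d n)) = axis_tau d p n" for n
      unfolding axis_tau_def by (rule prob_joined[OF p01]) simp
    moreover have "lim (\<lambda>n. - (1 / real n) * ln (axis_tau d p n)) = r"
      using axis_tau_limit by (intro limI) simp
    ultimately show ?thesis by (simp add: correlation_length_def)
  qed
  have rate: "exp (- real n / correlation_length d p) = exp (- r * real n)" for n
    unfolding xi by (simp add: divide_inverse mult.commute)
  have prob: "\<P>(\<omega> in percolation d p. left_right_crossing d n h \<omega>)
      = bprob (box_edges d (rect d n h)) p (crossing d n h)" for n h
    unfolding left_right_crossing_iff
    by (rule cylinder(2)[OF p01 finite_box_edges[OF finite_rect]]) (simp add: box_edges_def)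
  obtain c where c: "0 < c" "\<And>n h. 0 < n \<Longrightarrow> 6 * n \<le> h \<Longrightarrow>
      Phi (c * real h ^ (d - 1) * exp (- r * real n)) \<le> bprob (box_edges d (rect d n h)) p (crossing d n h)"
    using crossing_lower by blast
  \<comment> \<open>\<open>2 ^ (d - 1)\<close> absorbs \<open>h + 1 \<le> 2 * h\<close>, and
    \<open>1 / p\<close> comes from \<open>cross_upper\<close>.\<close>
  define C where "C = 2 ^ (d - 1) / p"
  have "bprob (box_edges d (rect d n h)) p (crossing d n h) \<le> C * real h ^ (d - 1) * exp (- r * real n)"
    if "0 < n" "6 * n \<le> h" for n h
  proof -
    have "real (h + 1) ^ (d - 1) * (exp (- r * real (n + 1)) / p)
        \<le> (2 * real h) ^ (d - 1) * (exp (- r * real n) / p)"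
      using that p_pos rate_pos
      by (intro mult_mono power_mono divide_right_mono) (auto simp: algebra_simps)
    also have "\<dots> = C * real h ^ (d - 1) * exp (- r * real n)"
      by (simp add: C_def power_mult_distrib)
    finally show ?thesis using crossing_upper[of n h] by linarith
  qed
  then show ?thesis
    unfolding rate prob using c p_pos by (intro exI[of _ c] exI[of _ C]) (auto simp: C_def)
qed

end
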